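(* Let $(A,\Lambda)$ be any associative form ring, let $(I,\Gamma)$ and $(J,\Delta)$ be two form ideals of $(A,\Lambda)$, and let $n\ge 3$. Then the relative commutator subgroup $[\operatorname{EU}(2n,I,\Gamma),\operatorname{EU}(2n,J,\Delta)]$ is generated (as a group) by the elements of the following two types: (1) $Z_{ij}(ab,c)$ and $Z_{ij}(ba,c)$ with $i,j\in\Omega$, $i\ne\pm j$, $a\in I$, $b\in J$, $c\in A$; and, for $i\in\Omega$, $Z_{i,-i}(x,c)$ with $x\in\lambda^{-(\varepsilon(i)+1)/2}(\Gamma\circ\Delta)$ and $c\in\lambda^{(\varepsilon(i)-1)/2}\Lambda$; (2) $Y_{ij}(a,b)$ with $i,j\in\Omega$, $i\neq j$, $a\in(I,\Gamma)_{ij}$, $b\in(J,\Delta)_{ji}$. Moreover, for the second type of generators it suffices to take one pair $(h,k)$ with $h\neq\pm k$, and one pair $(h,-h)$: for any $h,k\in\Omega$ with $h\ne\pm k$, the group is generated by all elements of type (1) together with the elements $Y_{hk}(a,b)$ ($a\in I$, $b\in J$) and $Y_{h,-h}(a,b)$ ($a\in(I,\Gamma)_{h,-h}$, $b\in(J,\Delta)_{-h,h}$).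
   Context: Form rings. $A$ is an associative ring with $1$ with an involution $a\mapsto\bar a$ (additive, $\overline{ab}=\bar b\,\bar a$, $\bar{\bar a}=a$), and $\lambda\in\operatorname{Cent}(A)$ is fixed with $\lambda\bar\lambda=1$. Put $\Lambda_{\min}=\{c-\lambda\bar c\mid c\in A\}$, $\Lambda_{\max}=\{c\in A\mid c=-\lambda\bar c\}$. A form parameter $\Lambda$ is an additive subgroup with $\Lambda_{\min}\subseteq\Lambda\subseteq\Lambda_{\max}$ and $c\Lambda\bar c\subseteq\Lambda$ for all $c\in A$; then $(A,\Lambda)$ is a form ring. Form ideals. For a two-sided ideal $I$ with $\bar I=I$ put $\Gamma_{\max}(I)=I\cap\Lambda$ and $\Gamma_{\min}(I)=\{a-\lambda\bar a\mid a\in I\}+\langle ac\bar a\mid a\in I,c\in\Lambda\rangle$ ($\langle\cdot\rangle$ = additive subgroup generated). A form ideal $(I,\Gamma)$ consists of such an $I$ and an additive subgroup $\Gamma$ with $\Gamma_{\min}(I)\subseteq\Gamma\subseteq\Gamma_{\max}(I)$ and $c\Gamma\bar c\subseteq\Gamma$ for all $c\in A$. The symmetrised product is $(I,\Gamma)\circ(J,\Delta)=(IJ+JI,\ \Gamma\circ\Delta)$, where $\Gamma\circ\Delta=\Gamma_{\min}(IJ+JI)+{}^J\Gamma+{}^I\Delta$, ${}^J\Gamma=\langle b\gamma\bar b\mid b\in J,\gamma\in\Gamma\rangle$, ${}^I\Delta=\langle a\delta\bar a\mid a\in I,\delta\in\Delta\rangle$. Elementary transvections. $\Omega=\{1,\dots,n,-n,\dots,-1\}$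 indexes rows and columns of $2n\times 2n$ matrices; $\varepsilon(i)$ is the sign of $i$. For $i\ne\pm j$, $c\in A$: $T_{ij}(c)=e+ce_{ij}-\lambda^{(\varepsilon(j)-\varepsilon(i))/2}\bar c\,e_{-j,-i}$. For $c\in\lambda^{-(\varepsilon(i)+1)/2}\Lambda$: $T_{i,-i}(c)=e+ce_{i,-i}$. For a form ideal write $(I,\Gamma)_{ij}=I$ if $i\ne\pm j$ and $(I,\Gamma)_{i,-i}=\lambda^{-(\varepsilon(i)+1)/2}\Gamma$. $\operatorname{EU}(2n,A,\Lambda)$ is generated by all $T_{ij}(c)$, $c\in(A,\Lambda)_{ij}$; $\operatorname{FU}(2n,I,\Gamma)$ is generated by all $T_{ij}(a)$, $a\in(I,\Gamma)_{ij}$; $\operatorname{EU}(2n,I,\Gamma)$ is the normal closure of $\operatorname{FU}(2n,I,\Gamma)$ in $\operatorname{EU}(2n,A,\Lambda)$. Commutators: $[x,y]=xyx^{-1}y^{-1}$. Elementary conjugates: $Z_{ij}(a,c)=T_{ji}(c)T_{ij}(a)T_{ji}(-c)$. Elementary commutators: $Y_{ij}(a,b)=[T_{ij}(a),T_{ji}(b)]$. *)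

theory Defs
  imports
    "HOL-Algebra.Generated_Groups"
    "HOL-Computational_Algebra.Group_Closure"
    "HOL-Library.Set_Algebras"
begin

text \<open>
  The sort \<open>{ring, monoid_mult}\<close> is that of associative rings with 1; unlike \<open>ring_1\<close>, it does
  not exclude the zero ring. Sums of sets of ring elements (\<open>X + Y\<close>) are the elementwise sums
  of \<open>Set_Algebras\<close>, and \<open>c *o X\<close> is \<open>{c * x | x. x \<in> X}\<close>. The additive subgroup generated by
  a set is \<open>group_closure\<close>.
\<close>


section \<open>Form rings and form ideals\<close>

definition add_subgroup :: "'a::ring set \<Rightarrow> bool" where
  "add_subgroup S \<longleftrightarrow> 0 \<in> S \<and> (\<forall>x\<in>S. \<forall>y\<in>S. x + y \<in> S) \<and> (\<forall>x\<in>S. - x \<in> S)"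

definition two_sided_ideal :: "'a::ring set \<Rightarrow> bool" where
  "two_sided_ideal I \<longleftrightarrow> add_subgroup I \<and> (\<forall>x\<in>I. \<forall>c. c * x \<in> I \<and> x * c \<in> I)"

definition ideal_mult :: "'a::ring set \<Rightarrow> 'a set \<Rightarrow> 'a set" where
  "ideal_mult I J = group_closure {a * b | a b. a \<in> I \<and> b \<in> J}"

definition sym_ideal_mult :: "'a::ring set \<Rightarrow> 'a set \<Rightarrow> 'a set" where
  "sym_ideal_mult I J = ideal_mult I J + ideal_mult J I"

definition ring_involution :: "('a::{ring,monoid_mult} \<Rightarrow> 'a) \<Rightarrow> bool" where
  "ring_involution bar \<longleftrightarrow>
     (\<forall>a b. bar (a + b) = bar a + bar b) \<and>
     (\<forall>a b. bar (a * b) = bar b * bar a) \<and>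
     (\<forall>a. bar (bar a) = a)"

context
  fixes bar :: "'a::{ring,monoid_mult} \<Rightarrow> 'a" and lam :: 'a
begin

definition Lambda_min :: "'a set" where
  "Lambda_min = {c - lam * bar c | c. True}"

definition Lambda_max :: "'a set" where
  "Lambda_max = {c. c = - (lam * bar c)}"

definition form_parameter :: "'a set \<Rightarrow> bool" where
  "form_parameter Lam \<longleftrightarrow>
     add_subgroup Lam \<and> Lambda_min \<subseteq> Lam \<and> Lam \<subseteq> Lambda_max \<and>
     (\<forall>c. \<forall>x\<in>Lam. c * x * bar c \<in> Lam)"

definition form_ring :: "'a set \<Rightarrow> bool" where
  "form_ring Lam \<longleftrightarrow>
     ring_involution bar \<and> (\<forall>a. lam * a = a * lam) \<and> lam * bar lam = 1 \<and> form_parameter Lam"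

definition Gamma_max :: "'a set \<Rightarrow> 'a set \<Rightarrow> 'a set" where
  "Gamma_max Lam I = I \<inter> Lam"

definition Gamma_min :: "'a set \<Rightarrow> 'a set \<Rightarrow> 'a set" where
  "Gamma_min Lam I =
     {a - lam * bar a | a. a \<in> I} + group_closure {a * c * bar a | a c. a \<in> I \<and> c \<in> Lam}"

definition form_ideal :: "'a set \<Rightarrow> 'a set \<Rightarrow> 'a set \<Rightarrow> bool" where
  "form_ideal Lam I Gam \<longleftrightarrow>
     two_sided_ideal I \<and> bar ` I = I \<and>
     add_subgroup Gam \<and> Gamma_min Lam I \<subseteq> Gam \<and> Gam \<subseteq> Gamma_max Lam I \<and>
     (\<forall>c. \<forall>x\<in>Gam. c * x * bar c \<in> Gam)"

definition twist :: "'a set \<Rightarrow> 'a set \<Rightarrow> 'a set" where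
  "twist J Gam = group_closure {b * g * bar b | b g. b \<in> J \<and> g \<in> Gam}"

text \<open>The relative form parameter \<open>\<Gamma> \<circ> \<Delta>\<close> of the symmetrised product of \<open>(I, \<Gamma>)\<close> and \<open>(J, \<Delta>)\<close>;
  the underlying ideal of that product is \<open>sym_ideal_mult I J\<close>.\<close>

definition sym_form_mult :: "'a set \<Rightarrow> 'a set \<Rightarrow> 'a set \<Rightarrow> 'a set \<Rightarrow> 'a set \<Rightarrow> 'a set" where
  "sym_form_mult Lam I Gam J Del =
     Gamma_min Lam (sym_ideal_mult I J) + twist J Gam + twist I Del"

text \<open>Integral powers of \<open>\<lambda>\<close>, whose inverse is its conjugate.\<close>

definition lpow :: "int \<Rightarrow> 'a" where
  "lpow k = (if k \<ge> 0 then lam ^ nat k else bar lam ^ nat (- k))"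

end


section \<open>Matrices of degree \<open>2n\<close> and subgroups\<close>

text \<open>
  The \<open>2n \<times> 2n\<close> matrices are functions on pairs of integers that vanish off
  \<open>Omega n \<times> Omega n\<close>. The sign of an index \<open>i\<close> is \<open>sgn i\<close>.
\<close>

definition Omega :: "nat \<Rightarrow> int set" where
  "Omega n = {i. i \<noteq> 0 \<and> \<bar>i\<bar> \<le> int n}"

type_synonym 'a sq_mat = "int \<Rightarrow> int \<Rightarrow> 'a"

definition one_matrix :: "nat \<Rightarrow> 'a::{ring,monoid_mult} sq_mat" where
  "one_matrix n = (\<lambda>k l. if k = l \<and> k \<in> Omega n then 1 else 0)"

definition matrix_unit :: "int \<Rightarrow> int \<Rightarrow> 'a \<Rightarrow> 'a::{ring,monoid_mult} sq_mat" where
  "matrix_unit i j c = (\<lambda>k l. if k = i \<and> l = j then c else 0)"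

definition matrix_monoid :: "nat \<Rightarrow> 'a::{ring,monoid_mult} sq_mat monoid" where
  "matrix_monoid n =
     \<lparr>carrier = {M. \<forall>k l. k \<notin> Omega n \<or> l \<notin> Omega n \<longrightarrow> M k l = 0},
      monoid.mult = (\<lambda>M N k l. \<Sum>m\<in>Omega n. M k m * N m l),
      one = one_matrix n\<rparr>"

definition GL :: "nat \<Rightarrow> 'a::{ring,monoid_mult} sq_mat monoid" where
  "GL n = units_of (matrix_monoid n)"

definition group_commutator :: "('g, 'b) monoid_scheme \<Rightarrow> 'g \<Rightarrow> 'g \<Rightarrow> 'g" where
  "group_commutator G x y = x \<otimes>\<^bsub>G\<^esub> y \<otimes>\<^bsub>G\<^esub> inv\<^bsub>G\<^esub> x \<otimes>\<^bsub>G\<^esub> inv\<^bsub>G\<^esub> y"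

definition commutator_subgroup :: "('g, 'b) monoid_scheme \<Rightarrow> 'g set \<Rightarrow> 'g set \<Rightarrow> 'g set" where
  "commutator_subgroup G H K = generate G {group_commutator G x y | x y. x \<in> H \<and> y \<in> K}"

text \<open>The smallest normal subgroup of \<open>H\<close> (itself a subgroup of \<open>G\<close>) that contains \<open>S\<close>.\<close>

definition normal_closure :: "('g, 'b) monoid_scheme \<Rightarrow> 'g set \<Rightarrow> 'g set \<Rightarrow> 'g set" where
  "normal_closure G H S = \<Inter>{N. N \<lhd> G\<lparr>carrier := H\<rparr> \<and> S \<subseteq> N}"


section \<open>Elementary unitary groups\<close>

context
  fixes bar :: "'a::{ring,monoid_mult} \<Rightarrow> 'a" and lam :: 'a
begin

text \<open>\<open>T n i j c\<close> is meaningful only for distinct \<open>i\<close>, \<open>j\<close> in \<open>Omega n\<close>.\<close>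

definition T :: "nat \<Rightarrow> int \<Rightarrow> int \<Rightarrow> 'a \<Rightarrow> 'a sq_mat" where
  "T n i j c =
     (if j = - i then (\<lambda>k l. one_matrix n k l + matrix_unit i (- i) c k l)
      else (\<lambda>k l. one_matrix n k l + matrix_unit i j c k l
              - matrix_unit (- j) (- i) (lpow bar lam ((sgn j - sgn i) div 2) * bar c) k l))"

text \<open>\<open>(I, \<Gamma>)\<^sub>i\<^sub>j\<close> for \<open>i \<noteq> j\<close>.\<close>

definition entries :: "'a set \<Rightarrow> 'a set \<Rightarrow> int \<Rightarrow> int \<Rightarrow> 'a set" where
  "entries I Gam i j =
     (if j = - i then lpow bar lam (- ((sgn i + 1) div 2)) *o Gam else I)"

definition FU :: "nat \<Rightarrow> 'a set \<Rightarrow> 'a set \<Rightarrow> 'a sq_mat set" where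
  "FU n I Gam = generate (GL n)
     {T n i j a | i j a. i \<in> Omega n \<and> j \<in> Omega n \<and> i \<noteq> j \<and> a \<in> entries I Gam i j}"

definition EU_abs :: "nat \<Rightarrow> 'a set \<Rightarrow> 'a sq_mat set" where
  "EU_abs n Lam = generate (GL n)
     {T n i j c | i j c. i \<in> Omega n \<and> j \<in> Omega n \<and> i \<noteq> j \<and> c \<in> entries UNIV Lam i j}"

definition EU :: "nat \<Rightarrow> 'a set \<Rightarrow> 'a set \<Rightarrow> 'a set \<Rightarrow> 'a sq_mat set" where
  "EU n Lam I Gam = normal_closure (GL n) (EU_abs n Lam) (FU n I Gam)"

definition Z :: "nat \<Rightarrow> int \<Rightarrow> int \<Rightarrow> 'a \<Rightarrow> 'a \<Rightarrow> 'a sq_mat" where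
  "Z n i j a c = T n j i c \<otimes>\<^bsub>GL n\<^esub> T n i j a \<otimes>\<^bsub>GL n\<^esub> T n j i (- c)"

definition Y :: "nat \<Rightarrow> int \<Rightarrow> int \<Rightarrow> 'a \<Rightarrow> 'a \<Rightarrow> 'a sq_mat" where
  "Y n i j a b = group_commutator (GL n) (T n i j a) (T n j i b)"

definition Z_generators ::
    "nat \<Rightarrow> 'a set \<Rightarrow> 'a set \<Rightarrow> 'a set \<Rightarrow> 'a set \<Rightarrow> 'a set \<Rightarrow> 'a sq_mat set" where
  "Z_generators n Lam I Gam J Del =
     {Z n i j (a * b) c | i j a b c.
        i \<in> Omega n \<and> j \<in> Omega n \<and> i \<noteq> j \<and> i \<noteq> - j \<and> a \<in> I \<and> b \<in> J} \<union>
     {Z n i j (b * a) c | i j a b c.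
        i \<in> Omega n \<and> j \<in> Omega n \<and> i \<noteq> j \<and> i \<noteq> - j \<and> a \<in> I \<and> b \<in> J} \<union>
     {Z n i (- i) x c | i x c. i \<in> Omega n \<and>
        x \<in> lpow bar lam (- ((sgn i + 1) div 2)) *o sym_form_mult bar lam Lam I Gam J Del \<and>
        c \<in> lpow bar lam ((sgn i - 1) div 2) *o Lam}"

definition Y_generators_at ::
    "nat \<Rightarrow> 'a set \<Rightarrow> 'a set \<Rightarrow> 'a set \<Rightarrow> 'a set \<Rightarrow> int \<Rightarrow> int \<Rightarrow> 'a sq_mat set" where
  "Y_generators_at n I Gam J Del i j =
     {Y n i j a b | a b. a \<in> entries I Gam i j \<and> b \<in> entries J Del j i}"

definition Y_generators ::
    "nat \<Rightarrow> 'a set \<Rightarrow> 'a set \<Rightarrow> 'a set \<Rightarrow> 'a set \<Rightarrow> 'a sq_mat set" where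
  "Y_generators n I Gam J Del =
     \<Union>{Y_generators_at n I Gam J Del i j | i j. i \<in> Omega n \<and> j \<in> Omega n \<and> i \<noteq> j}"

end

end

theory Submission
  imports Defs "HOL-Library.Function_Algebras"
begin

text \<open>Write \<open>(K, \<Theta>) = (I, \<Gamma>) \<circ> (J, \<Delta>)\<close>. The Chevalley commutator formula shows that
\<open>[T\<^sub>\<alpha>(a), T\<^sub>\<beta>(b)]\<close>, for \<open>a\<close> of level \<open>(I, \<Gamma>)\<close>, \<open>b\<close> of level \<open>(J, \<Delta>)\<close> and roots
\<open>\<beta> \<noteq> -\<alpha>\<close>, is a product of root elements of level \<open>(K, \<Theta>)\<close> whose roots are positive
combinations of \<open>\<alpha>\<close> and \<open>\<beta>\<close> (\<open>commutator_formula\<close>). Everything else is deduced from this and from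
a bookkeeping by linear functionals \<open>f\<close> on the root lattice: the absolute or relative root elements
with \<open>f > 0\<close> generate a group \<open>U\<^sub>f\<close>, which the absolute ones with \<open>f \<ge> 0\<close> normalise. The index pairs
\<open>(i, j)\<close>, with \<open>(i, j)\<close> and \<open>(-j, -i)\<close> identified, are the roots of type \<open>C\<^sub>n\<close>; a functional is an odd
function on the indices, and its value at \<open>(i, j)\<close> is \<open>f i - f j\<close>.

\<^bold>\<open>Generators of the relative group.\<close> The elementary conjugates \<open>Z\<^sub>\<alpha>(a, c)\<close> generate a normal
subgroup, which therefore is \<open>EU(2n, I, \<Gamma>)\<close> (\<open>normal_conjugate_group\<close>). Conjugation by
\<open>T\<^sub>-\<^sub>\<alpha>(d)\<close> only changes \<open>c\<close>. For \<open>\<beta> \<noteq> \<plusminus>\<alpha>\<close> there is an \<open>f\<close> with \<open>f(\<alpha>) = 0 < f(\<beta>)\<close>, and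
\<open>[T\<^sub>\<beta>(d), Z\<^sub>\<alpha>(a, c)]\<close> lies in the relative \<open>U\<^sub>f\<close>. For \<open>\<beta> = \<alpha>\<close> a third index gives an \<open>f\<close> with
\<open>f(\<alpha>) = 0\<close> and an expression \<open>T\<^sub>\<alpha>(a) = u' v u v\<^bsup>-1\<^esup>\<close> with \<open>u, u'\<close> relative
elements of \<open>U\<^sub>-\<^sub>f\<close> and \<open>v\<close> an absolute element of \<open>U\<^sub>f\<close> (\<open>root_element_decomposition\<close>); this form is
preserved by conjugation with \<open>T\<^sub>\<alpha>\<close> and \<open>T\<^sub>-\<^sub>\<alpha>\<close>, and \<open>unipotent_normalizes_negative\<close> writes it as a
product of elementary conjugates.

\<^bold>\<open>The level.\<close> Applied to \<open>(K, \<Theta>)\<close>, this says that the generators of type (1) generate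
\<open>N = EU(2n, K, \<Theta>)\<close>. Reading the commutator formulas backwards shows that the root elements of level
\<open>(K, \<Theta>)\<close> are in \<open>M = [EU(2n, I, \<Gamma>), EU(2n, J, \<Delta>)]\<close>, so \<open>N \<subseteq> M\<close> (\<open>level_subset_mutual\<close>).

\<^bold>\<open>Elementary commutators modulo the level.\<close> If \<open>\<beta> \<noteq> \<plusminus>\<alpha>\<close>, conjugation by \<open>T\<^sub>\<beta>(d)\<close> multiplies the two
entries of \<open>Y\<^sub>\<alpha>(a, b)\<close> by elements of \<open>U\<^sub>f\<close>, which commute modulo \<open>N\<close> with everything
in sight, so that \<open>Y\<^sub>\<alpha>(a, b)\<close> is invariant modulo \<open>N\<close>. Conjugation by
\<open>T\<^sub>\<beta>(1) T\<^sub>-\<^sub>\<beta>(-1) T\<^sub>\<beta>(1)\<close> moves \<open>\<alpha>\<close> to its image under the reflection in \<open>\<beta>\<close>. Hence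
\<open>Y\<^sub>\<alpha>\<close> is congruent to an elementary commutator of every other root of the same length, with other parameters; and
choosing that root not proportional to \<open>\<alpha>\<close> shows that \<open>Y\<^sub>\<alpha>(a, b)\<close> is central modulo \<open>N\<close>
(\<open>elementary_commutator_central\<close>).

\<^bold>\<open>Conclusion.\<close> The group \<open>H\<close> generated by \<open>N\<close> and the \<open>Y\<^sub>\<alpha>\<close> of one short and one long root is
normal and contains all elementary commutators, so modulo \<open>H\<close> all root elements of the two
levels commute. The decomposition \<open>T\<^sub>\<alpha>(b) = u' v u v\<^bsup>-1\<^esup>\<close> extends this to \<open>T\<^sub>\<alpha>(a)\<close> and
\<open>Z\<^sub>\<alpha>(b, c)\<close>, and normality to the whole relative groups (\<open>mutual_subset\<close>); thus \<open>M \<subseteq> H\<close>.\<close>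

section \<open>Form rings\<close>

lemma add_subgroup_zero: "add_subgroup S \<Longrightarrow> 0 \<in> S"
  and add_subgroup_add: "add_subgroup S \<Longrightarrow> x \<in> S \<Longrightarrow> y \<in> S \<Longrightarrow> x + y \<in> S"
  and add_subgroup_minus: "add_subgroup S \<Longrightarrow> x \<in> S \<Longrightarrow> - x \<in> S"
  and add_subgroup_diff: "add_subgroup S \<Longrightarrow> x \<in> S \<Longrightarrow> y \<in> S \<Longrightarrow> x - y \<in> S"
  unfolding add_subgroup_def by (simp_all, metis add_uminus_conv_diff)

lemma two_sided_ideal_add_subgroup: "two_sided_ideal I \<Longrightarrow> add_subgroup I"
  and two_sided_ideal_mult_left: "two_sided_ideal I \<Longrightarrow> x \<in> I \<Longrightarrow> c * x \<in> I"
  and two_sided_ideal_mult_right: "two_sided_ideal I \<Longrightarrow> x \<in> I \<Longrightarrow> x * c \<in> I"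
  unfolding two_sided_ideal_def by simp_all

lemma group_closure_subset:
  assumes "add_subgroup S" "X \<subseteq> S"
  shows "group_closure X \<subseteq> S"
proof
  fix x assume "x \<in> group_closure X"
  then show "x \<in> S"
    by induction (use assms in \<open>auto simp: add_subgroup_zero intro: add_subgroup_diff\<close>)
qed

lemma add_subgroup_group_closure: "add_subgroup (group_closure X)"
  by (simp add: add_subgroup_def group_closure_add)

lemma group_closure_image:
  assumes "\<And>x y. h (x - y) = h x - h y" "h 0 = 0" "\<And>x. x \<in> X \<Longrightarrow> h x \<in> group_closure X'"
    and "x \<in> group_closure X"
  shows "h x \<in> group_closure X'"
  using assms(4) by induction (use assms in \<open>auto intro: group_closure.diff\<close>)

lemma add_subgroup_vimage:
  assumes "add_subgroup S" "\<And>x y. h (x + y) = h x + h y" "h 0 = 0" "\<And>x. h (- x) = - h x"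
  shows "add_subgroup {x. h x \<in> S}"
  using assms by (simp add: add_subgroup_def)

lemma add_subgroup_set_plus:
  assumes "add_subgroup S" "add_subgroup S'"
  shows "add_subgroup (S + S')"
proof -
  have "0 + 0 \<in> S + S'"
    using assms by (intro set_plus_intro add_subgroup_zero)
  moreover have "(a + b) + (c + d) \<in> S + S'"
    if "a \<in> S" "b \<in> S'" "c \<in> S" "d \<in> S'" for a b c d
  proof -
    have "(a + b) + (c + d) = (a + c) + (b + d)" by (simp add: algebra_simps)
    then show ?thesis
      by (metis assms add_subgroup_add set_plus_intro that)
  qed
  moreover have "- (a + b) \<in> S + S'" if "a \<in> S" "b \<in> S'" for a b
    using set_plus_intro[of "- a" S "- b" S'] assms that by (simp add: add_subgroup_minus)
  ultimately show ?thesis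
    unfolding add_subgroup_def by (auto elim!: set_plus_elim)
qed

lemma set_plus_subset:
  assumes "add_subgroup S" "A \<subseteq> S" "B \<subseteq> S"
  shows "A + B \<subseteq> S"
  using assms by (auto elim!: set_plus_elim intro: add_subgroup_add)

lemma sym_ideal_mult_commute: "sym_ideal_mult J I = sym_ideal_mult I J"
  unfolding sym_ideal_mult_def by (rule add.commute)

lemma sym_form_mult_commute:
  "sym_form_mult bar lam Lam J Del I Gam = sym_form_mult bar lam Lam I Gam J Del"
  unfolding sym_form_mult_def by (simp add: sym_ideal_mult_commute[of J I] add.assoc add.commute[of "twist bar I Del"])

locale form_ring_setting =
  fixes bar :: "'a::{ring,monoid_mult} \<Rightarrow> 'a" and lam :: 'a and Lam :: "'a set"
  assumes form_ring: "form_ring bar lam Lam"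
begin

lemma bar_add: "bar (a + b) = bar a + bar b"
  and bar_mult: "bar (a * b) = bar b * bar a"
  and bar_bar [simp]: "bar (bar a) = a"
  using form_ring by (simp_all add: form_ring_def ring_involution_def)

lemma bar_zero [simp]: "bar 0 = 0"
  using bar_add[of 0 0] by simp

lemma bar_minus: "bar (- a) = - bar a"
  using bar_add[of a "- a"] by (simp add: eq_neg_iff_add_eq_0 add.commute)

lemma bar_one [simp]: "bar 1 = 1"
  using bar_mult[of "bar 1" 1] by simp

lemma lam_commute: "lam * a = a * lam"
  and lam_bar_lam: "lam * bar lam = 1"
  using form_ring unfolding form_ring_def by blast+

lemma bar_lam_commute: "bar lam * a = a * bar lam"
  using arg_cong[OF lam_commute[of "bar a"], of bar] by (simp add: bar_mult)

lemma bar_lam_lam: "bar lam * lam = 1"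
  using lam_bar_lam bar_lam_commute[of lam] by simp

lemma form_parameter: "form_parameter bar lam Lam"
  using form_ring by (simp add: form_ring_def)

lemma Lam_add_subgroup: "add_subgroup Lam"
  and Lam_mult: "x \<in> Lam \<Longrightarrow> c * x * bar c \<in> Lam"
  and Lam_min: "c - lam * bar c \<in> Lam"
  and Lam_max: "x \<in> Lam \<Longrightarrow> lam * bar x = - x"
proof -
  show "add_subgroup Lam" "x \<in> Lam \<Longrightarrow> c * x * bar c \<in> Lam"
    and "c - lam * bar c \<in> Lam"
    using form_parameter unfolding form_parameter_def Lambda_min_def by auto
  assume "x \<in> Lam"
  then have "x = - (lam * bar x)"
    using form_parameter unfolding form_parameter_def Lambda_max_def by blast
  then show "lam * bar x = - x" by (metis minus_minus)
qed

text \<open>The powers of \<open>\<lambda>\<close> in the elementary transvections are coboundaries in the indices: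
  \<open>\<lambda>\<^bsup>(\<epsilon>(j) - \<epsilon>(i))/2\<^esup> = \<nu>\<^sub>j \<nu>\<^sub>i\<^bsup>-1\<^esup>\<close> and \<open>\<lambda>\<^bsup>-(\<epsilon>(i)+1)/2\<^esup> = \<nu>\<^sub>i\<^bsup>-1\<^esup>\<close>. The inverse of
  \<open>\<nu>\<^sub>i\<close> is its conjugate.\<close>

definition nu :: "int \<Rightarrow> 'a" where
  "nu i = (if i > 0 then lam else 1)"

text \<open>The scalars \<open>\<lambda>\<^bsup>(\<epsilon>(j) - \<epsilon>(i))/2\<^esup>\<close>, which satisfy the cocycle identity \<open>sc_sc\<close>.\<close>

definition sc :: "int \<Rightarrow> int \<Rightarrow> 'a" where
  "sc i j = nu j * bar (nu i)"

lemma nu_commute: "nu i * a = a * nu i"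
  by (cases "i > 0") (simp_all add: nu_def lam_commute[of a])

lemma bar_nu_commute: "bar (nu i) * a = a * bar (nu i)"
  by (cases "i > 0") (simp_all add: nu_def bar_lam_commute[of a])

lemma nu_bar_nu [simp]: "nu i * bar (nu i) = 1"
  and bar_nu_nu [simp]: "bar (nu i) * nu i = 1"
  by (auto simp: nu_def lam_bar_lam bar_lam_lam)

lemma nu_cancel [simp]:
  "nu i * (bar (nu i) * a) = a" "bar (nu i) * (nu i * a) = a"
  by (simp_all add: mult.assoc[symmetric])

lemma nu_uminus: "i \<noteq> 0 \<Longrightarrow> nu i * nu (- i) = lam"
  by (auto simp: nu_def)

lemma sc_commute: "sc i j * a = a * sc i j"
proof -
  have "sc i j * a = nu j * (bar (nu i) * a)" by (simp only: sc_def mult.assoc)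
  also have "\<dots> = nu j * a * bar (nu i)" by (simp only: bar_nu_commute[of i a] mult.assoc)
  also have "\<dots> = a * sc i j" by (simp only: sc_def nu_commute[of j a] mult.assoc)
  finally show ?thesis .
qed

lemma bar_sc: "bar (sc i j) = sc j i"
  by (simp add: sc_def bar_mult)

lemma sc_self [simp]: "sc i i = 1"
  by (simp add: sc_def)

lemma sc_uminus: "i \<noteq> 0 \<Longrightarrow> j \<noteq> 0 \<Longrightarrow> sc (- j) (- i) = sc i j"
  by (auto simp: sc_def nu_def lam_bar_lam bar_lam_lam)

lemma sc_sc: "sc j k * sc i j = sc i k"
proof -
  have "sc j k * sc i j = nu k * (bar (nu j) * (nu j * bar (nu i)))"
    by (simp only: sc_def mult.assoc)
  then show ?thesis by (simp add: sc_def)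
qed

text \<open>This is the form in which the cocycle identity meets products of matrix units, where an
arbitrary ring element separates the two central scalars.\<close>

lemma sc_trans: "sc j k * a * (sc i j * b) = sc i k * (a * b)"
proof -
  have "sc j k * a * (sc i j * b) = sc j k * ((a * sc i j) * b)" by (simp only: mult.assoc)
  also have "\<dots> = sc j k * sc i j * (a * b)" by (simp only: sc_commute[of i j a, symmetric] mult.assoc)
  finally show ?thesis by (simp only: sc_sc)
qed

lemma sc_cancel: "sc i j * (sc j i * a) = a"
  by (simp add: mult.assoc[symmetric] sc_sc)

lemma lpow_exponent_T:
  assumes "i \<noteq> 0" "j \<noteq> 0"
  shows "lpow bar lam ((sgn j - sgn i) div 2) = sc i j"
  using assms by (auto simp: lpow_def sc_def nu_def sgn_if lam_bar_lam)

lemma lpow_exponent_entries: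
  assumes "i \<noteq> 0"
  shows "lpow bar lam (- ((sgn i + 1) div 2)) = bar (nu i)"
  using assms by (auto simp: lpow_def nu_def sgn_if)

lemma lpow_exponent_opposite_entries:
  assumes "i \<noteq> 0"
  shows "lpow bar lam ((sgn i - 1) div 2) = bar (nu (- i))"
  using assms by (auto simp: lpow_def nu_def sgn_if)


section \<open>Form ideals\<close>

lemma form_ideal_ideal: "form_ideal bar lam Lam I Gam \<Longrightarrow> two_sided_ideal I"
  and form_ideal_bar: "form_ideal bar lam Lam I Gam \<Longrightarrow> x \<in> I \<Longrightarrow> bar x \<in> I"
  and form_ideal_add_subgroup: "form_ideal bar lam Lam I Gam \<Longrightarrow> add_subgroup Gam"
  and form_ideal_Gam_I: "form_ideal bar lam Lam I Gam \<Longrightarrow> x \<in> Gam \<Longrightarrow> x \<in> I"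
  and form_ideal_Gam_Lam: "form_ideal bar lam Lam I Gam \<Longrightarrow> x \<in> Gam \<Longrightarrow> x \<in> Lam"
  and form_ideal_Gam_mult: "form_ideal bar lam Lam I Gam \<Longrightarrow> x \<in> Gam \<Longrightarrow> c * x * bar c \<in> Gam"
  unfolding form_ideal_def Gamma_max_def by auto

lemma zero_in_Gamma_min: "two_sided_ideal I \<Longrightarrow> 0 \<in> Gamma_min bar lam Lam I"
proof -
  assume "two_sided_ideal I"
  then have "0 - lam * bar 0 \<in> {a - lam * bar a | a. a \<in> I}"
    using two_sided_ideal_add_subgroup add_subgroup_zero by blast
  then have "(0 - lam * bar 0) + 0 \<in> Gamma_min bar lam Lam I"
    unfolding Gamma_min_def by (intro set_plus_intro) auto
  then show ?thesis by simp
qed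

lemma Gamma_min_trace:
  assumes "x \<in> I"
  shows "x - lam * bar x \<in> Gamma_min bar lam Lam I"
proof -
  have "(x - lam * bar x) + 0 \<in> Gamma_min bar lam Lam I"
    unfolding Gamma_min_def by (intro set_plus_intro) (use assms in auto)
  then show ?thesis by simp
qed

lemma form_ideal_trace:
  "form_ideal bar lam Lam I Gam \<Longrightarrow> x \<in> I \<Longrightarrow> x - lam * bar x \<in> Gam"
  using Gamma_min_trace unfolding form_ideal_def by blast

lemma add_subgroup_traces:
  assumes "two_sided_ideal I"
  shows "add_subgroup {a - lam * bar a | a. a \<in> I}"
proof -
  note I = two_sided_ideal_add_subgroup[OF assms]
  have "0 - lam * bar 0 \<in> {a - lam * bar a | a. a \<in> I}"
    using add_subgroup_zero[OF I] by blast
  moreover have "(a - lam * bar a) + (b - lam * bar b) \<in> {a - lam * bar a | a. a \<in> I}"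
    if "a \<in> I" "b \<in> I" for a b
  proof -
    have "(a - lam * bar a) + (b - lam * bar b) = (a + b) - lam * bar (a + b)"
      by (simp add: bar_add algebra_simps)
    then show ?thesis using add_subgroup_add[OF I] that by blast
  qed
  moreover have "- (a - lam * bar a) \<in> {a - lam * bar a | a. a \<in> I}" if "a \<in> I" for a
  proof -
    have "- (a - lam * bar a) = (- a) - lam * bar (- a)" by (simp add: bar_minus)
    then show ?thesis using add_subgroup_minus[OF I] that by blast
  qed
  ultimately show ?thesis
    unfolding add_subgroup_def by auto
qed

lemma add_subgroup_Gamma_min:
  "two_sided_ideal I \<Longrightarrow> add_subgroup (Gamma_min bar lam Lam I)"
  unfolding Gamma_min_def
  by (intro add_subgroup_set_plus add_subgroup_traces add_subgroup_group_closure)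

lemma add_subgroup_twist: "add_subgroup (twist bar J Gam)"
  unfolding twist_def by (rule add_subgroup_group_closure)

lemma two_sided_ideal_UNIV: "two_sided_ideal UNIV"
  by (simp add: two_sided_ideal_def add_subgroup_def)

lemma form_ideal_UNIV: "form_ideal bar lam Lam UNIV Lam"
proof -
  have "Gamma_min bar lam Lam UNIV \<subseteq> Lam"
    unfolding Gamma_min_def
    by (intro set_plus_subset Lam_add_subgroup group_closure_subset)
      (auto simp: Lam_min Lam_mult)
  moreover have "range bar = UNIV"
    by (metis bar_bar surjI)
  ultimately show ?thesis
    by (simp add: form_ideal_def two_sided_ideal_UNIV Lam_add_subgroup Lam_mult Gamma_max_def)
qed

lemma Gamma_min_mult_Lam:
  assumes "two_sided_ideal I" "a \<in> I" "c \<in> Lam"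
  shows "a * c * bar a \<in> Gamma_min bar lam Lam I"
proof -
  have "0 \<in> I" using assms(1) by (simp add: two_sided_ideal_def add_subgroup_def)
  then have "(0 - lam * bar 0) + a * c * bar a \<in> Gamma_min bar lam Lam I"
    unfolding Gamma_min_def using assms by (intro set_plus_intro group_closure.base) blast+
  then show ?thesis by simp
qed

lemma form_ideal_mult_Lam:
  assumes "form_ideal bar lam Lam I Gam" "a \<in> I" "c \<in> Lam"
  shows "a * c * bar a \<in> Gam"
  using Gamma_min_mult_Lam[OF form_ideal_ideal[OF assms(1)] assms(2,3)] assms(1)
  by (auto simp: form_ideal_def)

end


section \<open>The symmetrised product of two form ideals\<close>

locale two_form_ideals = form_ring_setting +
  fixes I Gam J Del
  assumes IG: "form_ideal bar lam Lam I Gam" and JD: "form_ideal bar lam Lam J Del"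
begin

abbreviation K where "K \<equiv> sym_ideal_mult I J"
abbreviation Theta where "Theta \<equiv> sym_form_mult bar lam Lam I Gam J Del"

lemma ideal_mult_ideal:
  assumes "two_sided_ideal I'" "two_sided_ideal J'"
  shows "two_sided_ideal (ideal_mult I' J')"
proof -
  have "c * x \<in> ideal_mult I' J'" "x * c \<in> ideal_mult I' J'" if "x \<in> ideal_mult I' J'" for c x
  proof -
    show "c * x \<in> ideal_mult I' J'"
      using that unfolding ideal_mult_def
    proof (rule group_closure_image[rotated -1])
      fix x assume "x \<in> {a * b |a b. a \<in> I' \<and> b \<in> J'}"
      then show "c * x \<in> group_closure {a * b |a b. a \<in> I' \<and> b \<in> J'}"
        using two_sided_ideal_mult_left[OF assms(1)]
        by (force simp flip: mult.assoc intro: group_closure.base)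
    qed (simp_all add: algebra_simps)
    show "x * c \<in> ideal_mult I' J'"
      using that unfolding ideal_mult_def
    proof (rule group_closure_image[rotated -1])
      fix x assume "x \<in> {a * b |a b. a \<in> I' \<and> b \<in> J'}"
      then show "x * c \<in> group_closure {a * b |a b. a \<in> I' \<and> b \<in> J'}"
        using two_sided_ideal_mult_right[OF assms(2)]
        by (force simp: mult.assoc intro: group_closure.base)
    qed (simp_all add: algebra_simps)
  qed
  then show ?thesis
    unfolding two_sided_ideal_def by (simp add: ideal_mult_def add_subgroup_group_closure)
qed

lemma K_ideal: "two_sided_ideal K"
proof -
  have *: "two_sided_ideal (ideal_mult I J)" "two_sided_ideal (ideal_mult J I)"
    by (intro ideal_mult_ideal form_ideal_ideal[OF IG] form_ideal_ideal[OF JD])+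
  have "c * (x + y) \<in> K" "(x + y) * c \<in> K"
    if "x \<in> ideal_mult I J" "y \<in> ideal_mult J I" for c x y
    unfolding sym_ideal_mult_def ring_distribs
    by (intro set_plus_intro two_sided_ideal_mult_left two_sided_ideal_mult_right * that)+
  moreover have "add_subgroup K"
    unfolding sym_ideal_mult_def
    by (intro add_subgroup_set_plus * two_sided_ideal_add_subgroup)
  ultimately show ?thesis
    unfolding two_sided_ideal_def
    by (metis set_plus_elim sym_ideal_mult_def)
qed

lemma K_products: "a \<in> I \<Longrightarrow> b \<in> J \<Longrightarrow> a * b \<in> K" "a \<in> I \<Longrightarrow> b \<in> J \<Longrightarrow> b * a \<in> K"
proof -
  assume ab: "a \<in> I" "b \<in> J"
  have "a * b + 0 \<in> K"
    unfolding sym_ideal_mult_def ideal_mult_def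
    by (intro set_plus_intro group_closure.base) (use ab in auto)
  then show "a * b \<in> K" by simp
  have "0 + b * a \<in> K"
    unfolding sym_ideal_mult_def ideal_mult_def
    by (intro set_plus_intro group_closure.base) (use ab in auto)
  then show "b * a \<in> K" by simp
qed

lemma K_subset:
  assumes "add_subgroup S" "\<And>a b. a \<in> I \<Longrightarrow> b \<in> J \<Longrightarrow> a * b \<in> S" "\<And>a b. a \<in> I \<Longrightarrow> b \<in> J \<Longrightarrow> b * a \<in> S"
  shows "K \<subseteq> S"
  unfolding sym_ideal_mult_def ideal_mult_def
  by (intro set_plus_subset group_closure_subset assms(1); safe; rule assms(2-3); assumption)

lemma bar_K: "x \<in> K \<Longrightarrow> bar x \<in> K"
proof -
  have "add_subgroup {x. bar x \<in> K}"
    by (rule add_subgroup_vimage[OF two_sided_ideal_add_subgroup[OF K_ideal]])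
      (simp_all add: bar_add bar_minus)
  then have "K \<subseteq> {x. bar x \<in> K}"
    by (rule K_subset)
      (auto simp: bar_mult K_products form_ideal_bar[OF IG] form_ideal_bar[OF JD])
  then show "x \<in> K \<Longrightarrow> bar x \<in> K" by auto
qed

lemma Theta_subset:
  assumes S: "add_subgroup S"
    and "\<And>x. x \<in> K \<Longrightarrow> x - lam * bar x \<in> S"
    and "\<And>x c. x \<in> K \<Longrightarrow> c \<in> Lam \<Longrightarrow> x * c * bar x \<in> S"
    and "\<And>b g. b \<in> J \<Longrightarrow> g \<in> Gam \<Longrightarrow> b * g * bar b \<in> S"
    and "\<And>a d. a \<in> I \<Longrightarrow> d \<in> Del \<Longrightarrow> a * d * bar a \<in> S"
  shows "Theta \<subseteq> S"
  unfolding sym_form_mult_def Gamma_min_def twist_def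
  by (intro set_plus_subset group_closure_subset S; safe; rule assms(2-5); assumption)

lemma Theta_add_subgroup: "add_subgroup Theta"
  unfolding sym_form_mult_def
  by (intro add_subgroup_set_plus add_subgroup_Gamma_min K_ideal add_subgroup_twist)

lemma Gamma_min_Theta: "Gamma_min bar lam Lam K \<subseteq> Theta"
proof
  fix x assume "x \<in> Gamma_min bar lam Lam K"
  then have "x + 0 + 0 \<in> Theta"
    unfolding sym_form_mult_def
    by (intro set_plus_intro add_subgroup_zero[OF add_subgroup_twist])
  then show "x \<in> Theta" by simp
qed

lemma Theta_twist:
  "b \<in> J \<Longrightarrow> g \<in> Gam \<Longrightarrow> b * g * bar b \<in> Theta"
  "a \<in> I \<Longrightarrow> d \<in> Del \<Longrightarrow> a * d * bar a \<in> Theta"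
proof -
  note z = zero_in_Gamma_min[OF K_ideal] add_subgroup_zero[OF add_subgroup_twist]
  {
    assume "b \<in> J" "g \<in> Gam"
    then have "0 + b * g * bar b + 0 \<in> Theta"
      unfolding sym_form_mult_def
      by (intro set_plus_intro z) (auto simp: twist_def intro!: group_closure.base)
    then show "b * g * bar b \<in> Theta" by simp
  next
    assume "a \<in> I" "d \<in> Del"
    then have "0 + 0 + a * d * bar a \<in> Theta"
      unfolding sym_form_mult_def
      by (intro set_plus_intro z) (auto simp: twist_def intro!: group_closure.base)
    then show "a * d * bar a \<in> Theta" by simp
  }
qed

lemma Theta_Lam_mult: "x \<in> K \<Longrightarrow> c \<in> Lam \<Longrightarrow> x * c * bar x \<in> Theta"
  using Gamma_min_mult_Lam[OF K_ideal] Gamma_min_Theta by blast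

lemma conj_trace: "c * (x - lam * bar x) * bar c = c * x * bar c - lam * bar (c * x * bar c)"
proof -
  have "c * (lam * bar x) * bar c = (c * lam) * (bar x * bar c)" by (simp only: mult.assoc)
  also have "\<dots> = lam * (c * bar x * bar c)" by (subst lam_commute[of c, symmetric]) (simp only: mult.assoc)
  finally show ?thesis by (simp add: bar_mult right_diff_distrib left_diff_distrib mult.assoc)
qed

lemma conj_conj: "c * (b * g * bar b) * bar c = (c * b) * g * bar (c * b)"
  by (simp add: bar_mult mult.assoc)

lemma form_ideal_Theta: "form_ideal bar lam Lam K Theta"
proof -
  have "c * x * bar c \<in> Theta" if "x \<in> Theta" for c x
  proof -
    have "Theta \<subseteq> {x. c * x * bar c \<in> Theta}"
    proof (rule Theta_subset)
      show "add_subgroup {x. c * x * bar c \<in> Theta}"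
        using Theta_add_subgroup by (simp add: add_subgroup_def algebra_simps)
    next
      fix x assume "x \<in> K"
      then show "x - lam * bar x \<in> {x. c * x * bar c \<in> Theta}"
        unfolding mem_Collect_eq conj_trace
        by (intro subsetD[OF Gamma_min_Theta] Gamma_min_trace
            two_sided_ideal_mult_left two_sided_ideal_mult_right K_ideal)
    qed (simp_all only: mem_Collect_eq conj_conj Theta_twist Theta_Lam_mult
          two_sided_ideal_mult_left K_ideal form_ideal_ideal[OF IG] form_ideal_ideal[OF JD])
    then show ?thesis using that by auto
  qed
  moreover have "Theta \<subseteq> Lam"
  proof (rule Theta_subset)
  qed (simp_all add: Lam_add_subgroup Lam_min Lam_mult form_ideal_Gam_Lam[OF IG]
        form_ideal_Gam_Lam[OF JD])
  moreover have "Theta \<subseteq> K"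
  proof (rule Theta_subset)
    note K = two_sided_ideal_add_subgroup[OF K_ideal]
    show "add_subgroup K" by (rule K)
    show "x - lam * bar x \<in> K" if "x \<in> K" for x
      using that by (intro add_subgroup_diff[OF K] two_sided_ideal_mult_left[OF K_ideal] bar_K)
    show "x * c * bar x \<in> K" if "x \<in> K" for x c
      using that by (intro two_sided_ideal_mult_right[OF K_ideal])
    show "b * g * bar b \<in> K" if "b \<in> J" "g \<in> Gam" for b g
      using that by (intro two_sided_ideal_mult_right[OF K_ideal] K_products form_ideal_Gam_I[OF IG])
    show "a * d * bar a \<in> K" if "a \<in> I" "d \<in> Del" for a d
      using that by (intro two_sided_ideal_mult_right[OF K_ideal] K_products form_ideal_Gam_I[OF JD])
  qed
  moreover have "bar ` K = K"
    using bar_K by (metis bar_bar image_eqI image_subsetI subsetI subset_antisym)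
  ultimately show ?thesis
    unfolding form_ideal_def Gamma_max_def
    using K_ideal Theta_add_subgroup Gamma_min_Theta by auto
qed

end

text \<open>The absolute form ring is a form ideal of itself and multiplication by it does
not enlarge a form ideal, so that commutator formulas for two form ideals also cover commutators of an absolute with a relative
element.\<close>

lemma (in form_ring_setting) sym_mult_UNIV_subset:
  assumes "form_ideal bar lam Lam I Gam"
  shows "sym_ideal_mult UNIV I \<subseteq> I" "sym_form_mult bar lam Lam UNIV Lam I Gam \<subseteq> Gam"
proof -
  interpret two_form_ideals bar lam Lam UNIV Lam I Gam
    by unfold_locales (fact form_ideal_UNIV assms)+
  note I = form_ideal_ideal[OF assms]
  show KI: "K \<subseteq> I"
    by (rule K_subset)
      (simp_all add: two_sided_ideal_add_subgroup two_sided_ideal_mult_left two_sided_ideal_mult_right I)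
  show "Theta \<subseteq> Gam"
  proof (rule Theta_subset)
    show "add_subgroup Gam" by (rule form_ideal_add_subgroup[OF assms])
  qed (use KI assms in \<open>auto intro: form_ideal_trace form_ideal_mult_Lam form_ideal_Gam_mult\<close>)
qed


section \<open>Matrices and elementary transvections\<close>

definition mat_mult :: "nat \<Rightarrow> 'a::{ring,monoid_mult} sq_mat \<Rightarrow> 'a sq_mat \<Rightarrow> 'a sq_mat" where
  "mat_mult n M N = (\<lambda>k l. \<Sum>m\<in>Omega n. M k m * N m l)"

lemma mult_matrix_monoid: "monoid.mult (matrix_monoid n) = mat_mult n"
  by (simp add: matrix_monoid_def mat_mult_def fun_eq_iff)

lemma finite_Omega [simp]: "finite (Omega n)"
proof (rule finite_subset)
  show "Omega n \<subseteq> {- int n..int n}" by (auto simp: Omega_def)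
qed simp

lemma uminus_Omega [simp]: "- i \<in> Omega n \<longleftrightarrow> i \<in> Omega n"
  and zero_Omega [simp]: "0 \<notin> Omega n"
  by (auto simp: Omega_def)

lemma Omega_nonzero: "i \<in> Omega n \<Longrightarrow> i \<noteq> 0"
  by (auto simp: Omega_def)

lemma Omega_neq_uminus: "i \<in> Omega n \<Longrightarrow> i \<noteq> - i"
  by (auto simp: Omega_def)

lemma mat_mult_add_left: "mat_mult n (A + B) C = mat_mult n A C + mat_mult n B C"
  and mat_mult_add_right: "mat_mult n A (B + C) = mat_mult n A B + mat_mult n A C"
  and mat_mult_diff_left: "mat_mult n (A - B) C = mat_mult n A C - mat_mult n B C"
  and mat_mult_diff_right: "mat_mult n A (B - C) = mat_mult n A B - mat_mult n A C"
  and mat_mult_uminus_left: "mat_mult n (- A) C = - mat_mult n A C"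
  and mat_mult_uminus_right: "mat_mult n A (- C) = - mat_mult n A C"
  and mat_mult_zero_left: "mat_mult n 0 C = 0"
  and mat_mult_zero_right: "mat_mult n A 0 = 0"
  by (auto simp: mat_mult_def fun_eq_iff sum.distrib sum_subtractf sum_negf algebra_simps)

lemma mat_mult_assoc: "mat_mult n (mat_mult n A B) C = mat_mult n A (mat_mult n B C)"
proof (intro ext)
  fix k l
  have "mat_mult n (mat_mult n A B) C k l
      = (\<Sum>m\<in>Omega n. \<Sum>p\<in>Omega n. A k p * B p m * C m l)"
    by (simp add: mat_mult_def sum_distrib_right)
  also have "\<dots> = (\<Sum>p\<in>Omega n. \<Sum>m\<in>Omega n. A k p * B p m * C m l)"
    by (rule sum.swap)
  also have "\<dots> = mat_mult n A (mat_mult n B C) k l"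
    by (simp add: mat_mult_def sum_distrib_left mult.assoc)
  finally show "mat_mult n (mat_mult n A B) C k l = mat_mult n A (mat_mult n B C) k l" .
qed

lemma mat_mult_one_left: "M \<in> carrier (matrix_monoid n) \<Longrightarrow> mat_mult n (one_matrix n) M = M"
proof (intro ext)
  fix k l assume "M \<in> carrier (matrix_monoid n)"
  then have *: "k \<notin> Omega n \<Longrightarrow> M k l = 0" by (simp add: matrix_monoid_def)
  have "mat_mult n (one_matrix n) M k l = (\<Sum>m\<in>Omega n. if m = k then M k l else 0)"
    unfolding mat_mult_def one_matrix_def by (rule sum.cong) auto
  then show "mat_mult n (one_matrix n) M k l = M k l" using * by (simp add: sum.delta)
qed

lemma mat_mult_one_right: "M \<in> carrier (matrix_monoid n) \<Longrightarrow> mat_mult n M (one_matrix n) = M"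
proof (intro ext)
  fix k l assume "M \<in> carrier (matrix_monoid n)"
  then have *: "l \<notin> Omega n \<Longrightarrow> M k l = 0" by (simp add: matrix_monoid_def)
  have "mat_mult n M (one_matrix n) k l = (\<Sum>m\<in>Omega n. if m = l then M k l else 0)"
    unfolding mat_mult_def one_matrix_def by (rule sum.cong) auto
  then show "mat_mult n M (one_matrix n) k l = M k l" using * by (simp add: sum.delta)
qed

lemma one_matrix_carrier: "one_matrix n \<in> carrier (matrix_monoid n)"
  by (auto simp: matrix_monoid_def one_matrix_def)

lemma matrix_unit_carrier:
  "i \<in> Omega n \<Longrightarrow> j \<in> Omega n \<Longrightarrow> matrix_unit i j a \<in> carrier (matrix_monoid n)"
  by (auto simp: matrix_monoid_def matrix_unit_def)

lemma monoid_matrix_monoid: "monoid (matrix_monoid n)"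
proof (rule monoidI)
  show "x \<otimes>\<^bsub>matrix_monoid n\<^esub> y \<in> carrier (matrix_monoid n)"
    if "x \<in> carrier (matrix_monoid n)" "y \<in> carrier (matrix_monoid n)" for x y :: "'a sq_mat"
    using that by (auto simp: matrix_monoid_def)
qed (simp_all add: mult_matrix_monoid mat_mult_assoc,
     simp_all add: matrix_monoid_def mat_mult_one_left[unfolded matrix_monoid_def]
        mat_mult_one_right[unfolded matrix_monoid_def] one_matrix_carrier[unfolded matrix_monoid_def, simplified])

lemma group_GL: "group (GL n)"
  unfolding GL_def by (rule monoid.units_group[OF monoid_matrix_monoid])

lemma mult_GL: "monoid.mult (GL n) = mat_mult n"
  by (simp add: GL_def units_of_mult mult_matrix_monoid)

lemma mat_mult_unit:
  "mat_mult n (matrix_unit i j a) (matrix_unit k l b) =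
     (if j = k \<and> j \<in> Omega n then matrix_unit i l (a * b) else 0)"
proof (intro ext)
  fix p q
  have "mat_mult n (matrix_unit i j a) (matrix_unit k l b) p q =
     (\<Sum>m\<in>Omega n. if m = j then (if p = i \<and> j = k \<and> q = l then a * b else 0) else 0)"
    unfolding mat_mult_def matrix_unit_def by (rule sum.cong) auto
  then show "mat_mult n (matrix_unit i j a) (matrix_unit k l b) p q =
     (if j = k \<and> j \<in> Omega n then matrix_unit i l (a * b) else 0) p q"
    by (auto simp: matrix_unit_def sum.delta)
qed

lemma matrix_unit_add: "matrix_unit i j (a + b) = matrix_unit i j a + matrix_unit i j b"
  and matrix_unit_diff: "matrix_unit i j (a - b) = matrix_unit i j a - matrix_unit i j b"
  and matrix_unit_uminus: "matrix_unit i j (- a) = - matrix_unit i j a"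
  and matrix_unit_zero: "matrix_unit i j 0 = 0"
  by (auto simp: matrix_unit_def fun_eq_iff)

context form_ring_setting
begin

text \<open>The difference between an elementary transvection and the identity: for \<open>j \<noteq> -i\<close> it is
\<open>x - x\<^sup>*\<close> with \<open>x = c e\<^sub>i\<^sub>j\<close> and \<open>*\<close> the adjoint involution of the unitary group.\<close>

definition transvection_part :: "int \<Rightarrow> int \<Rightarrow> 'a \<Rightarrow> 'a sq_mat" where
  "transvection_part i j c =
     (if j = - i then matrix_unit i (- i) c
      else matrix_unit i j c - matrix_unit (- j) (- i) (sc i j * bar c))"

lemma T_eq:
  assumes "i \<in> Omega n" "j \<in> Omega n"
  shows "T bar lam n i j c = one_matrix n + transvection_part i j c"
  using assms Omega_nonzero[OF assms(1)] Omega_nonzero[OF assms(2)]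
  by (auto simp: T_def transvection_part_def fun_eq_iff lpow_exponent_T)

lemma mat_mult_transvection_one:
  assumes "i \<in> Omega n" "j \<in> Omega n"
  shows "mat_mult n (one_matrix n) (transvection_part i j c) = transvection_part i j c"
    and "mat_mult n (transvection_part i j c) (one_matrix n) = transvection_part i j c"
proof -
  have "transvection_part i j c \<in> carrier (matrix_monoid n)"
    using assms matrix_unit_carrier[OF assms, of c]
      matrix_unit_carrier[of "- j" n "- i" "sc i j * bar c"]
    by (auto simp: transvection_part_def matrix_monoid_def)
  then show "mat_mult n (one_matrix n) (transvection_part i j c) = transvection_part i j c"
    and "mat_mult n (transvection_part i j c) (one_matrix n) = transvection_part i j c"
    by (simp_all add: mat_mult_one_left mat_mult_one_right)
qed

lemmas mat_expand =
  mat_mult_add_left mat_mult_add_right mat_mult_diff_left mat_mult_diff_right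
  mat_mult_uminus_left mat_mult_uminus_right mat_mult_zero_left mat_mult_zero_right
  mat_mult_one_left[OF one_matrix_carrier] mat_mult_transvection_one T_eq
  
lemmas part_expand =
  mat_mult_add_left mat_mult_add_right mat_mult_diff_left mat_mult_diff_right
  mat_mult_uminus_left mat_mult_uminus_right mat_mult_zero_left mat_mult_zero_right
  matrix_unit_add matrix_unit_diff matrix_unit_uminus matrix_unit_zero mat_mult_unit

lemma T_zero: "T bar lam n i j 0 = one_matrix n"
  by (auto simp: T_def matrix_unit_def fun_eq_iff)

lemma T_add_mat:
  assumes "i \<in> Omega n" "j \<in> Omega n" "i \<noteq> j"
  shows "mat_mult n (T bar lam n i j a) (T bar lam n i j b) = T bar lam n i j (a + b)"
proof -
  note nz = assms Omega_nonzero[OF assms(1)] Omega_nonzero[OF assms(2)]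
  have "mat_mult n (transvection_part i j a) (transvection_part i j b) = 0"
    using nz by (auto simp: transvection_part_def part_expand)
  moreover have "transvection_part i j (a + b) = transvection_part i j a + transvection_part i j b"
    by (simp add: transvection_part_def part_expand bar_add distrib_left)
  ultimately show ?thesis
    using assms by (simp add: mat_expand add_ac)
qed

lemma T_GL:
  assumes "i \<in> Omega n" "j \<in> Omega n" "i \<noteq> j"
  shows "T bar lam n i j c \<in> carrier (GL n)"
proof -
  have car: "T bar lam n i j x \<in> carrier (matrix_monoid n)" for x
    using assms by (auto simp: T_def matrix_monoid_def one_matrix_def matrix_unit_def)
  have "T bar lam n i j (- c) \<otimes>\<^bsub>matrix_monoid n\<^esub> T bar lam n i j c = \<one>\<^bsub>matrix_monoid n\<^esub>"
    "T bar lam n i j c \<otimes>\<^bsub>matrix_monoid n\<^esub> T bar lam n i j (- c) = \<one>\<^bsub>matrix_monoid n\<^esub>"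
    by (simp_all add: mult_matrix_monoid T_add_mat[OF assms] T_zero)
      (simp_all add: matrix_monoid_def)
  then show ?thesis
    unfolding GL_def units_of_carrier Units_def using car by blast
qed

lemma T_flip_mat:
  assumes "i \<in> Omega n" "j \<in> Omega n" "j \<noteq> - i"
  shows "T bar lam n i j c = T bar lam n (- j) (- i) (- (sc i j * bar c))"
proof -
  note nz = Omega_nonzero[OF assms(1)] Omega_nonzero[OF assms(2)]
  have "sc (- j) (- i) * bar (- (sc i j * bar c)) = - (sc i j * (c * sc j i))"
    by (simp add: bar_minus bar_mult bar_sc sc_uminus nz)
  also have "c * sc j i = sc j i * c" by (rule sc_commute[symmetric])
  finally show ?thesis
    using assms by (auto simp: T_eq transvection_part_def part_expand sc_cancel)
qed

lemma T_commute_mat: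
  assumes "i \<in> Omega n" "j \<in> Omega n" "k \<in> Omega n" "l \<in> Omega n"
    and "j \<noteq> k" "i \<noteq> l" "i \<noteq> - k" "j \<noteq> - l"
  shows "mat_mult n (T bar lam n i j a) (T bar lam n k l b) =
    mat_mult n (T bar lam n k l b) (T bar lam n i j a)"
proof -
  have "mat_mult n (transvection_part i j a) (transvection_part k l b) = 0"
    "mat_mult n (transvection_part k l b) (transvection_part i j a) = 0"
    using assms by (auto simp: transvection_part_def part_expand)
  then show ?thesis using assms by (simp add: mat_expand add_ac)
qed

text \<open>As \<open>P\<close> annihilates \<open>A\<close> and \<open>B\<close> from the left,
\<open>(1 + P)(1 + B)(1 + A) = 1 + P + B + A + B A\<close>, and \<open>P\<close> is what \<open>A B\<close> and \<open>B A\<close> differ by.\<close>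

lemma mat_mult_one_plus_commutator:
  assumes "mat_mult n (one_matrix n) A = A" "mat_mult n A (one_matrix n) = A"
    and "mat_mult n (one_matrix n) B = B" "mat_mult n B (one_matrix n) = B"
    and "mat_mult n P (one_matrix n) = P"
    and "mat_mult n A B = mat_mult n B A + P"
    and "mat_mult n P A = 0" "mat_mult n P B = 0"
  shows "mat_mult n (one_matrix n + A) (one_matrix n + B) =
    mat_mult n (one_matrix n + P) (mat_mult n (one_matrix n + B) (one_matrix n + A))"
proof -
  have "mat_mult n (one_matrix n) (mat_mult n B A) = mat_mult n B A"
    "mat_mult n P (mat_mult n B A) = 0"
    by (simp_all add: assms mat_mult_zero_left flip: mat_mult_assoc)
  then show ?thesis
    by (simp add: mat_mult_add_left mat_mult_add_right assms mat_mult_one_left[OF one_matrix_carrier] add_ac)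
qed

lemma T_commutator_short_mat:
  assumes "i \<in> Omega n" "j \<in> Omega n" "k \<in> Omega n"
    and "i \<noteq> j" "i \<noteq> - j" "j \<noteq> k" "j \<noteq> - k" "i \<noteq> k" "i \<noteq> - k"
  shows "mat_mult n (T bar lam n i j a) (T bar lam n j k b) =
    mat_mult n (T bar lam n i k (a * b))
      (mat_mult n (T bar lam n j k b) (T bar lam n i j a))"
proof -
  note nz = assms Omega_nonzero[OF assms(1)] Omega_nonzero[OF assms(2)] Omega_nonzero[OF assms(3)]
  have "mat_mult n (transvection_part i j a) (transvection_part j k b) =
      mat_mult n (transvection_part j k b) (transvection_part i j a) + transvection_part i k (a * b)"
    "mat_mult n (transvection_part i k (a * b)) (transvection_part i j a) = 0"
    "mat_mult n (transvection_part i k (a * b)) (transvection_part j k b) = 0"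
    using nz by (auto simp: transvection_part_def part_expand bar_mult sc_trans)
  then show ?thesis
    unfolding T_eq[OF assms(1,2)] T_eq[OF assms(2,3)] T_eq[OF assms(1,3)]
    by (intro mat_mult_one_plus_commutator mat_mult_transvection_one assms)
qed

lemma T_commutator_long_mat:
  assumes "i \<in> Omega n" "j \<in> Omega n" "i \<noteq> j" "i \<noteq> - j"
  shows "mat_mult n (T bar lam n i j a) (T bar lam n j (- i) b) =
    mat_mult n (T bar lam n i (- i) (a * b - sc i (- i) * bar (a * b)))
      (mat_mult n (T bar lam n j (- i) b) (T bar lam n i j a))"
proof -
  note nz = assms Omega_nonzero[OF assms(1)] Omega_nonzero[OF assms(2)]
  have i: "- i \<in> Omega n" using assms by simp
  let ?x = "a * b - sc i (- i) * bar (a * b)"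
  have "mat_mult n (transvection_part i j a) (transvection_part j (- i) b) =
      mat_mult n (transvection_part j (- i) b) (transvection_part i j a) + transvection_part i (- i) ?x"
    "mat_mult n (transvection_part i (- i) ?x) (transvection_part i j a) = 0"
    "mat_mult n (transvection_part i (- i) ?x) (transvection_part j (- i) b) = 0"
    using nz by (auto simp: transvection_part_def part_expand bar_mult sc_trans)
  then show ?thesis
    unfolding T_eq[OF assms(1,2)] T_eq[OF assms(2) i] T_eq[OF assms(1) i]
    by (intro mat_mult_one_plus_commutator mat_mult_transvection_one assms i)
qed

text \<open>The hypothesis on \<open>a\<close> says that \<open>a e\<^sub>i\<^sub>,\<^sub>-\<^sub>i\<close> is antisymmetric for the adjoint involution, as it is for
the parameters of long root elements. It makes the two entries of \<open>T\<^sub>i\<^sub>j(a b)\<close> match.\<close>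

lemma T_commutator_mixed_mat:
  assumes "i \<in> Omega n" "j \<in> Omega n" "i \<noteq> j" "i \<noteq> - j"
    and a: "sc i (- i) * bar a = - a"
  shows "mat_mult n (T bar lam n i (- i) a) (T bar lam n (- i) j b) =
    mat_mult n (T bar lam n (- j) j (- (sc (- i) j * bar b * a * b)))
      (mat_mult n (T bar lam n i j (a * b))
        (mat_mult n (T bar lam n (- i) j b) (T bar lam n i (- i) a)))"
proof -
  note nz = assms(1-4) Omega_nonzero[OF assms(1)] Omega_nonzero[OF assms(2)]
  have s: "sc i j * bar (a * b) = - (sc (- i) j * bar b * a)"
  proof -
    have "sc i j * bar (a * b) = sc (- i) j * bar b * (sc i (- i) * bar a)"
      by (simp add: bar_mult sc_trans)
    then show ?thesis by (simp add: a)
  qed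
  let ?c = "sc (- i) j * bar b * a"
  have parts: "transvection_part i j (a * b) = matrix_unit i j (a * b) + matrix_unit (- j) (- i) ?c"
    "transvection_part (- i) j b = matrix_unit (- i) j b - matrix_unit (- j) i (sc (- i) j * bar b)"
    "transvection_part i (- i) a = matrix_unit i (- i) a"
    "transvection_part (- j) j (- (?c * b)) = - matrix_unit (- j) j (?c * b)"
    using nz s by (auto simp: transvection_part_def part_expand)
  have ones: "mat_mult n (one_matrix n) (matrix_unit p q x) = matrix_unit p q x"
    "mat_mult n (matrix_unit p q x) (one_matrix n) = matrix_unit p q x"
    if "p \<in> Omega n" "q \<in> Omega n" for p q x
    using that by (simp_all add: mat_mult_one_left mat_mult_one_right matrix_unit_carrier)
  show ?thesis
    using nz by (simp add: T_eq parts[unfolded mult.assoc] ones mat_mult_one_left[OF one_matrix_carrier]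
        part_expand algebra_simps)
qed

text \<open>Conjugation by the element \<open>T\<^sub>k\<^sub>j(1) T\<^sub>j\<^sub>k(-1) T\<^sub>k\<^sub>j(1)\<close> interchanges, up to units, the indices
  \<open>j\<close> and \<open>k\<close> (and \<open>-j\<close> and \<open>-k\<close>).\<close>

definition weyl :: "nat \<Rightarrow> int \<Rightarrow> int \<Rightarrow> 'a sq_mat" where
  "weyl n k j = mat_mult n (T bar lam n k j 1) (mat_mult n (T bar lam n j k (- 1)) (T bar lam n k j 1))"

text \<open>The element is a monomial matrix, here written as a perturbation of the identity.\<close>

lemma weyl_eq:
  assumes "k \<in> Omega n" "j \<in> Omega n" "k \<noteq> j" "k \<noteq> - j"
  shows "weyl n k j = one_matrix n + (matrix_unit k j 1 - matrix_unit j k 1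
    - matrix_unit j j 1 - matrix_unit k k 1
    + matrix_unit (- k) (- j) (sc j k) - matrix_unit (- j) (- k) (sc k j)
    - matrix_unit (- j) (- j) 1 - matrix_unit (- k) (- k) 1)"
proof -
  note nz = assms Omega_nonzero[OF assms(1)] Omega_nonzero[OF assms(2)]
  have parts: "transvection_part k j 1 = matrix_unit k j 1 - matrix_unit (- j) (- k) (sc k j)"
    "transvection_part j k (- 1) = - matrix_unit j k 1 + matrix_unit (- k) (- j) (sc j k)"
    using nz by (auto simp: transvection_part_def part_expand bar_minus)
  have ones: "mat_mult n (one_matrix n) (matrix_unit p q x) = matrix_unit p q x"
    "mat_mult n (matrix_unit p q x) (one_matrix n) = matrix_unit p q x"
    if "p \<in> Omega n" "q \<in> Omega n" for p q x
    using that by (simp_all add: mat_mult_one_left mat_mult_one_right matrix_unit_carrier)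
  show ?thesis
    unfolding weyl_def
    using nz by (simp add: T_eq parts ones mat_mult_one_left[OF one_matrix_carrier]
        part_expand sc_sc sc_trans algebra_simps)
qed

lemma weyl_short:
  assumes "k \<in> Omega n" "j \<in> Omega n" "i \<in> Omega n"
    and "k \<noteq> j" "k \<noteq> - j" "i \<noteq> k" "i \<noteq> - k" "i \<noteq> j" "i \<noteq> - j"
  shows "mat_mult n (weyl n k j) (T bar lam n i k a) = mat_mult n (T bar lam n i j (- a)) (weyl n k j)"
    and "mat_mult n (weyl n k j) (T bar lam n k i a) = mat_mult n (T bar lam n j i (- a)) (weyl n k j)"
proof -
  note nz = assms Omega_nonzero[OF assms(1)] Omega_nonzero[OF assms(2)] Omega_nonzero[OF assms(3)]
  have parts: "transvection_part p q x = matrix_unit p q x - matrix_unit (- q) (- p) (sc p q * bar x)"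
    if "p \<noteq> - q" for p q x
    using that by (auto simp: transvection_part_def)
  have ones: "mat_mult n (one_matrix n) (matrix_unit p q x) = matrix_unit p q x"
    "mat_mult n (matrix_unit p q x) (one_matrix n) = matrix_unit p q x"
    if "p \<in> Omega n" "q \<in> Omega n" for p q x
    using that by (simp_all add: mat_mult_one_left mat_mult_one_right matrix_unit_carrier)
  have s: "sc p q * bar x * sc q r = sc p r * bar x" "sc p q * (sc r p * x) = sc r q * x" for p q r x
    by (simp_all add: mult.assoc sc_commute[symmetric] flip: sc_sc) (simp_all add: mult.assoc[symmetric] sc_sc)
  have s': "sc p q * (x * sc r p) = sc r q * x" for p q r x
    using sc_trans[of p q x r 1] by (simp add: mult.assoc)
  show "mat_mult n (weyl n k j) (T bar lam n i k a) = mat_mult n (T bar lam n i j (- a)) (weyl n k j)"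
    using nz by (simp add: weyl_eq T_eq parts ones mat_mult_one_left[OF one_matrix_carrier]
        part_expand sc_sc sc_trans bar_minus s algebra_simps)
  show "mat_mult n (weyl n k j) (T bar lam n k i a) = mat_mult n (T bar lam n j i (- a)) (weyl n k j)"
    using nz by (simp add: weyl_eq T_eq parts ones mat_mult_one_left[OF one_matrix_carrier]
        part_expand sc_sc sc_trans bar_minus s s' algebra_simps)
qed

lemma weyl_long:
  assumes "k \<in> Omega n" "i \<in> Omega n" "k \<noteq> i" "k \<noteq> - i"
  shows "mat_mult n (weyl n k i) (T bar lam n i (- i) a) =
      mat_mult n (T bar lam n k (- k) (a * sc k i)) (weyl n k i)"
    and "mat_mult n (weyl n k i) (T bar lam n (- i) i a) =
      mat_mult n (T bar lam n (- k) k (sc i k * a)) (weyl n k i)"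
proof -
  note nz = assms Omega_nonzero[OF assms(1)] Omega_nonzero[OF assms(2)]
  have parts: "transvection_part p (- p) x = matrix_unit p (- p) x" 
     "transvection_part (- p) p x = matrix_unit (- p) p x" for p x
    by (auto simp: transvection_part_def)
  have ones: "mat_mult n (one_matrix n) (matrix_unit p q x) = matrix_unit p q x"
    "mat_mult n (matrix_unit p q x) (one_matrix n) = matrix_unit p q x"
    if "p \<in> Omega n" "q \<in> Omega n" for p q x
    using that by (simp_all add: mat_mult_one_left mat_mult_one_right matrix_unit_carrier)
  have s: "a * (sc p q * sc q p) = a" for a p q
    by (simp add: sc_sc)
  show "mat_mult n (weyl n k i) (T bar lam n i (- i) a) =
      mat_mult n (T bar lam n k (- k) (a * sc k i)) (weyl n k i)"
    using nz by (simp add: weyl_eq T_eq parts ones mat_mult_one_left[OF one_matrix_carrier]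
        part_expand sc_sc s algebra_simps)
  show "mat_mult n (weyl n k i) (T bar lam n (- i) i a) =
      mat_mult n (T bar lam n (- k) k (sc i k * a)) (weyl n k i)"
    using nz by (simp add: weyl_eq T_eq parts ones mat_mult_one_left[OF one_matrix_carrier]
        part_expand sc_sc s algebra_simps)
qed

end


section \<open>Commutators and normal subgroups\<close>

definition conjugate :: "('g, 'b) monoid_scheme \<Rightarrow> 'g \<Rightarrow> 'g \<Rightarrow> 'g" where
  "conjugate G g x = g \<otimes>\<^bsub>G\<^esub> x \<otimes>\<^bsub>G\<^esub> inv\<^bsub>G\<^esub> g"

context group
begin

lemma mult_inv_cancel:
  assumes "x \<in> carrier G" "y \<in> carrier G"
  shows "x \<otimes> (inv x \<otimes> y) = y" "inv x \<otimes> (x \<otimes> y) = y"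
  using assms by (simp_all flip: m_assoc)

lemmas group_word = m_assoc inv_mult_group mult_inv_cancel

lemma conjugate_closed [simp]:
  "g \<in> carrier G \<Longrightarrow> x \<in> carrier G \<Longrightarrow> conjugate G g x \<in> carrier G"
  by (simp add: conjugate_def)

lemma commutator_closed [simp]:
  "x \<in> carrier G \<Longrightarrow> y \<in> carrier G \<Longrightarrow> group_commutator G x y \<in> carrier G"
  by (simp add: group_commutator_def)

lemma conjugate_mult:
  assumes "g \<in> carrier G" "x \<in> carrier G" "y \<in> carrier G"
  shows "conjugate G g (x \<otimes> y) = conjugate G g x \<otimes> conjugate G g y"
  using assms by (simp add: conjugate_def group_word)

lemma conjugate_inv:
  assumes "g \<in> carrier G" "x \<in> carrier G"
  shows "conjugate G g (inv x) = inv (conjugate G g x)"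
  using assms by (simp add: conjugate_def group_word)

lemma conjugate_conjugate:
  assumes "g \<in> carrier G" "h \<in> carrier G" "x \<in> carrier G"
  shows "conjugate G g (conjugate G h x) = conjugate G (g \<otimes> h) x"
  using assms by (simp add: conjugate_def group_word)

lemma conjugate_one [simp]:
  "x \<in> carrier G \<Longrightarrow> conjugate G \<one> x = x" "g \<in> carrier G \<Longrightarrow> conjugate G g \<one> = \<one>"
  by (simp_all add: conjugate_def)

lemma conjugate_inv_cancel [simp]:
  assumes "g \<in> carrier G" "x \<in> carrier G"
  shows "conjugate G g (conjugate G (inv g) x) = x" "conjugate G (inv g) (conjugate G g x) = x"
  using assms by (simp_all add: conjugate_conjugate)

lemma conjugate_eqI:
  assumes "g \<in> carrier G" "x \<in> carrier G" "y \<in> carrier G" "g \<otimes> x = y \<otimes> g"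
  shows "conjugate G g x = y"
  using assms by (simp add: conjugate_def group_word)

lemma conjugate_conjugate_commute:
  assumes "g \<in> carrier G" "v \<in> carrier G" "u \<in> carrier G"
  shows "conjugate G g (conjugate G v u) = conjugate G (conjugate G g v) (conjugate G g u)"
  using assms by (simp add: conjugate_def group_word)

lemma conjugate_commutator:
  assumes "g \<in> carrier G" "x \<in> carrier G" "y \<in> carrier G"
  shows "conjugate G g (group_commutator G x y) =
    group_commutator G (conjugate G g x) (conjugate G g y)"
  using assms by (simp add: conjugate_def group_commutator_def group_word)

lemma commutator_eq_conjugate:
  "group_commutator G x y = conjugate G x y \<otimes> inv y"
  by (simp add: conjugate_def group_commutator_def)

lemma conjugate_eq_commutator:
  assumes "x \<in> carrier G" "y \<in> carrier G"
  shows "conjugate G x y = group_commutator G x y \<otimes> y"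
  using assms by (simp add: conjugate_def group_commutator_def group_word)

lemma conjugate_eq_mult_commutator:
  assumes "x \<in> carrier G" "y \<in> carrier G"
  shows "conjugate G x y = y \<otimes> group_commutator G (inv y) x"
  using assms by (simp add: conjugate_def group_commutator_def group_word)

lemma inv_commutator:
  assumes "x \<in> carrier G" "y \<in> carrier G"
  shows "inv (group_commutator G x y) = group_commutator G y x"
  using assms by (simp add: group_commutator_def group_word)

lemma commutator_one [simp]:
  "x \<in> carrier G \<Longrightarrow> group_commutator G \<one> x = \<one>" "x \<in> carrier G \<Longrightarrow> group_commutator G x \<one> = \<one>"
  by (simp_all add: group_commutator_def)

lemma commutator_eqI:
  assumes "x \<in> carrier G" "y \<in> carrier G" "z \<in> carrier G" "x \<otimes> y = z \<otimes> (y \<otimes> x)"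
  shows "group_commutator G x y = z"
  using assms by (simp add: group_commutator_def group_word)

lemma commutator_mult_left:
  assumes "x \<in> carrier G" "y \<in> carrier G" "z \<in> carrier G"
  shows "group_commutator G (x \<otimes> y) z =
    conjugate G x (group_commutator G y z) \<otimes> group_commutator G x z"
  using assms by (simp add: conjugate_def group_commutator_def group_word)

lemma commutator_mult_right:
  assumes "x \<in> carrier G" "y \<in> carrier G" "z \<in> carrier G"
  shows "group_commutator G x (y \<otimes> z) =
    group_commutator G x y \<otimes> conjugate G y (group_commutator G x z)"
  using assms by (simp add: conjugate_def group_commutator_def group_word)

lemma commutator_inv_left:
  assumes "x \<in> carrier G" "y \<in> carrier G"
  shows "group_commutator G (inv x) y = conjugate G (inv x) (inv (group_commutator G x y))"
  using assms by (simp add: conjugate_def group_commutator_def group_word)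

lemma commutator_conjugate_right:
  assumes "x \<in> carrier G" "y \<in> carrier G" "g \<in> carrier G"
  shows "group_commutator G x (conjugate G g y) =
    conjugate G g (group_commutator G (conjugate G (inv g) x) y)"
  using assms by (simp add: conjugate_commutator)

lemma normal_conjugate:
  "N \<lhd> G \<Longrightarrow> g \<in> carrier G \<Longrightarrow> x \<in> N \<Longrightarrow> conjugate G g x \<in> N"
  unfolding conjugate_def by (rule normal.inv_op_closed2)

lemma normal_subset: "N \<lhd> G \<Longrightarrow> N \<subseteq> carrier G"
  by (simp add: normal_imp_subgroup subgroup.subset)

lemma normal_commutator:
  assumes "N \<lhd> G" "x \<in> N" "y \<in> carrier G"
  shows "group_commutator G x y \<in> N" "group_commutator G y x \<in> N"
proof -
  note sg = normal_imp_subgroup[OF assms(1)]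
  have x: "x \<in> carrier G" using assms normal_subset by blast
  have "group_commutator G y x \<in> N"
    unfolding commutator_eq_conjugate
    by (intro subgroup.m_closed[OF sg] normal_conjugate subgroup.m_inv_closed[OF sg] assms)
  moreover from subgroup.m_inv_closed[OF sg this] show "group_commutator G x y \<in> N"
    using inv_commutator[OF assms(3) x] by simp
  ultimately show "group_commutator G y x \<in> N" by simp
qed

lemma commutator_mem_swap:
  assumes "subgroup N G" "x \<in> carrier G" "y \<in> carrier G" "group_commutator G x y \<in> N"
  shows "group_commutator G y x \<in> N"
  using subgroup.m_inv_closed[OF assms(1,4)] assms by (simp add: inv_commutator)

lemma subgroup_commuting_mod:
  assumes N: "N \<lhd> G" and y: "y \<in> carrier G"
  shows "subgroup {x \<in> carrier G. group_commutator G x y \<in> N} G"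
proof -
  note sg = normal_imp_subgroup[OF N]
  show ?thesis
  proof (rule subgroupI)
    show "{x \<in> carrier G. group_commutator G x y \<in> N} \<noteq> {}"
      using subgroup.one_closed[OF sg] y by (auto intro!: exI[of _ \<one>])
    show "inv x \<in> {x \<in> carrier G. group_commutator G x y \<in> N}"
      if "x \<in> {x \<in> carrier G. group_commutator G x y \<in> N}" for x
      using that y
      by (simp add: commutator_inv_left normal_conjugate[OF N] subgroup.m_inv_closed[OF sg])
    show "x \<otimes> x' \<in> {x \<in> carrier G. group_commutator G x y \<in> N}"
      if "x \<in> {x \<in> carrier G. group_commutator G x y \<in> N}"
        "x' \<in> {x \<in> carrier G. group_commutator G x y \<in> N}" for x x'
      using that y
      by (simp add: commutator_mult_left normal_conjugate[OF N] subgroup.m_closed[OF sg])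
  qed auto
qed

lemma generate_commuting_mod:
  assumes N: "N \<lhd> G" and A: "A \<subseteq> carrier G" and B: "B \<subseteq> carrier G"
    and AB: "\<And>x y. x \<in> A \<Longrightarrow> y \<in> B \<Longrightarrow> group_commutator G x y \<in> N"
    and x: "x \<in> generate G A" and y: "y \<in> generate G B"
  shows "group_commutator G x y \<in> N"
proof -
  note sg = normal_imp_subgroup[OF N]
  have xc: "x \<in> carrier G" using x A generate_incl by blast
  have 1: "group_commutator G y x \<in> N" if "y \<in> B" for y
  proof -
    have "generate G A \<subseteq> {x \<in> carrier G. group_commutator G x y \<in> N}"
      using A AB B that by (intro generate_subgroup_incl subgroup_commuting_mod[OF N]) auto
    then show ?thesis using x that B xc commutator_mem_swap[OF sg] by blast
  qed
  have "generate G B \<subseteq> {y \<in> carrier G. group_commutator G y x \<in> N}"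
    using B 1 xc by (intro generate_subgroup_incl subgroup_commuting_mod[OF N]) auto
  then show ?thesis using y xc commutator_mem_swap[OF sg] by blast
qed

text \<open>Expand with \<open>[x p, z] = x [p, z] x\<^bsup>-1\<^esup> [x, z]\<close> and its mirror image: every factor other than \<open>[x, y]\<close>
is a conjugate of one of the three given commutators. In the application \<open>p\<close> and \<open>x\<close> have the same level and
do not commute, and likewise \<open>q\<close> and \<open>y\<close>.\<close>

lemma commutator_mod_absorb:
  assumes N: "N \<lhd> G"
    and car: "x \<in> carrier G" "p \<in> carrier G" "y \<in> carrier G" "q \<in> carrier G"
    and "group_commutator G p y \<in> N" "group_commutator G p q \<in> N" "group_commutator G x q \<in> N"
  shows "group_commutator G (x \<otimes> p) (y \<otimes> q) \<otimes> inv (group_commutator G x y) \<in> N"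
proof -
  note sg = normal_imp_subgroup[OF N]
  define a where "a = conjugate G x (group_commutator G p (y \<otimes> q))"
  define b where "b = conjugate G y (group_commutator G x q)"
  have ab: "a \<in> N" "b \<in> N"
    unfolding a_def b_def commutator_mult_right[OF car(2,3,4)]
    using assms by (auto intro!: normal_conjugate[OF N] subgroup.m_closed[OF sg])
  then have abc: "a \<in> carrier G" "b \<in> carrier G" using normal_subset[OF N] by auto
  have "group_commutator G (x \<otimes> p) (y \<otimes> q) = a \<otimes> (group_commutator G x y \<otimes> b)"
    using car by (simp add: commutator_mult_left a_def b_def commutator_mult_right[of x y q])
  then have "group_commutator G (x \<otimes> p) (y \<otimes> q) \<otimes> inv (group_commutator G x y)
      = a \<otimes> conjugate G (group_commutator G x y) b"
    using car abc by (simp add: conjugate_def m_assoc)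
  then show ?thesis
    using ab car by (simp add: subgroup.m_closed[OF sg] normal_conjugate[OF N])
qed

lemma generate_conjugate_closed:
  assumes S: "S \<subseteq> carrier G" "\<And>s. s \<in> S \<Longrightarrow> inv s \<in> S" and A: "A \<subseteq> carrier G"
    and SA: "\<And>s x. s \<in> S \<Longrightarrow> x \<in> A \<Longrightarrow> conjugate G s x \<in> generate G A"
    and g: "g \<in> generate G S" and x: "x \<in> generate G A"
  shows "conjugate G g x \<in> generate G A"
proof -
  note sg = generate_is_subgroup[OF A]
  have step: "conjugate G s x \<in> generate G A" if s: "s \<in> S" and "x \<in> generate G A" for s x
    using that(2)
  proof induction
    case one
    show ?case using subsetD[OF S(1) s] by (simp add: generate.one)
  next
    case (incl h)
    then show ?case using SA s by blast
  next
    case (inv h)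
    then have "conjugate G s (inv h) = inv (conjugate G s h)"
      using s S(1) A by (intro conjugate_inv) auto
    then show ?case using SA[OF s inv] subgroup.m_inv_closed[OF sg] by simp
  next
    case (eng h1 h2)
    then have "conjugate G s (h1 \<otimes> h2) = conjugate G s h1 \<otimes> conjugate G s h2"
      using s S(1) generate_in_carrier[OF A] by (intro conjugate_mult) auto
    then show ?case using eng subgroup.m_closed[OF sg] by simp
  qed
  have "\<forall>x \<in> generate G A. conjugate G g x \<in> generate G A"
    using g
  proof induction
    case one
    then show ?case using generate_in_carrier[OF A] by auto
  next
    case (eng h1 h2)
    then show ?case
      using generate_in_carrier[OF A] generate_in_carrier[OF S(1)]
      by (auto simp flip: conjugate_conjugate)
  qed (use step S(2) in auto)
  then show ?thesis using x by blast
qed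

lemma normal_commutator_subgroup:
  assumes "H \<lhd> G" "K \<lhd> G"
  shows "commutator_subgroup G H K \<lhd> G"
  unfolding commutator_subgroup_def
proof (rule normal_generateI)
  have sub: "H \<subseteq> carrier G" "K \<subseteq> carrier G" using assms normal_subset by auto
  show "{group_commutator G x y |x y. x \<in> H \<and> y \<in> K} \<subseteq> carrier G"
    using sub by (blast intro: commutator_closed)
  fix h g assume "h \<in> {group_commutator G x y |x y. x \<in> H \<and> y \<in> K}" and g: "g \<in> carrier G"
  then obtain x y where xy: "x \<in> H" "y \<in> K" "h = group_commutator G x y" by blast
  have "conjugate G g h = group_commutator G (conjugate G g x) (conjugate G g y)"
    unfolding xy(3) using xy sub g by (intro conjugate_commutator) auto
  then show "g \<otimes> h \<otimes> inv g \<in> {group_commutator G x y |x y. x \<in> H \<and> y \<in> K}"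
    unfolding conjugate_def[symmetric] using xy g assms normal_conjugate by blast
qed

lemma commutator_subgroup_subset:
  assumes "subgroup N G" "\<And>x y. x \<in> H \<Longrightarrow> y \<in> K \<Longrightarrow> group_commutator G x y \<in> N"
  shows "commutator_subgroup G H K \<subseteq> N"
  unfolding commutator_subgroup_def using assms by (intro generate_subgroup_incl) auto

definition congruent_mod :: "'a set \<Rightarrow> 'a \<Rightarrow> 'a \<Rightarrow> bool" where
  "congruent_mod N x y \<longleftrightarrow> x \<in> carrier G \<and> y \<in> carrier G \<and> x \<otimes> inv y \<in> N"

lemma congruent_mod_sym:
  assumes "subgroup N G" "congruent_mod N x y"
  shows "congruent_mod N y x"
proof -
  have "inv (x \<otimes> inv y) = y \<otimes> inv x"
    using assms by (simp add: congruent_mod_def inv_mult_group)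
  then show ?thesis
    using assms subgroup.m_inv_closed[OF assms(1), of "x \<otimes> inv y"] by (simp add: congruent_mod_def)
qed

lemma congruent_mod_trans:
  assumes "subgroup N G" "congruent_mod N x y" "congruent_mod N y z"
  shows "congruent_mod N x z"
proof -
  have "(x \<otimes> inv y) \<otimes> (y \<otimes> inv z) = x \<otimes> inv z"
    using assms by (simp add: congruent_mod_def m_assoc mult_inv_cancel)
  then show ?thesis
    using assms subgroup.m_closed[OF assms(1), of "x \<otimes> inv y" "y \<otimes> inv z"]
    by (simp add: congruent_mod_def)
qed

lemma congruent_mod_conjugate:
  assumes "N \<lhd> G" "g \<in> carrier G" "congruent_mod N x y"
  shows "congruent_mod N (conjugate G g x) (conjugate G g y)"
  using assms normal_conjugate[OF assms(1,2), of "x \<otimes> inv y"]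
  by (simp add: congruent_mod_def conjugate_mult conjugate_inv)

lemma congruent_mod_mem:
  assumes "subgroup H G" "N \<subseteq> H" "congruent_mod N x y" "y \<in> H"
  shows "x \<in> H"
proof -
  have "x = (x \<otimes> inv y) \<otimes> y" using assms by (simp add: congruent_mod_def m_assoc)
  also have "\<dots> \<in> H"
    by (rule subgroup.m_closed[OF assms(1) _ assms(4)])
      (use assms in \<open>auto simp: congruent_mod_def\<close>)
  finally show ?thesis .
qed

lemma subgroup_conjugate_vimage:
  assumes "subgroup H G" "y \<in> carrier G"
  shows "subgroup {g \<in> carrier G. conjugate G y g \<in> H} G"
proof (rule subgroupI)
  show "{g \<in> carrier G. conjugate G y g \<in> H} \<noteq> {}"
    using assms subgroup.one_closed[OF assms(1)] by (auto intro!: exI[of _ \<one>])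
qed (use assms in \<open>auto simp: conjugate_inv conjugate_mult subgroup.m_inv_closed subgroup.m_closed\<close>)

lemma normal_commuting_mod:
  assumes N: "N \<lhd> G" and M: "M \<lhd> G"
  shows "{x \<in> carrier G. \<forall>y \<in> M. group_commutator G x y \<in> N} \<lhd> G" (is "?C \<lhd> G")
  unfolding normal_inv_iff
proof (intro conjI ballI)
  have Mc: "M \<subseteq> carrier G" by (rule normal_subset[OF M])
  have sg: "subgroup {x \<in> carrier G. group_commutator G x y \<in> N} G" if "y \<in> M" for y
    using that Mc by (intro subgroup_commuting_mod[OF N]) auto
  show "subgroup ?C G"
  proof (rule subgroupI)
    show "?C \<noteq> {}" using subgroup.one_closed[OF sg] by auto
    show "inv x \<in> ?C" if "x \<in> ?C" for x
      using that subgroup.m_inv_closed[OF sg] by auto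
    show "x \<otimes> y \<in> ?C" if "x \<in> ?C" "y \<in> ?C" for x y
      using that subgroup.m_closed[OF sg] by auto
  qed auto
  fix g x assume g: "g \<in> carrier G" and x: "x \<in> ?C"
  have "group_commutator G (conjugate G g x) y \<in> N" if y: "y \<in> M" for y
  proof -
    have "conjugate G (inv g) y \<in> M" using g y by (intro normal_conjugate[OF M]) auto
    then have "conjugate G g (group_commutator G x (conjugate G (inv g) y)) \<in> N"
      using x g by (intro normal_conjugate[OF N]) auto
    then show ?thesis using x y g Mc by (auto simp: conjugate_commutator)
  qed
  then show "g \<otimes> x \<otimes> inv g \<in> ?C"
    using g x by (simp flip: conjugate_def)
qed

end


section \<open>Roots and elementary relations\<close>

context form_ring_setting
begin

lemma entries_short: "j \<noteq> - i \<Longrightarrow> entries bar lam I Gam i j = I"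
  by (simp add: entries_def)

lemma entries_long:
  assumes "i \<noteq> 0"
  shows "x \<in> entries bar lam I Gam i (- i) \<longleftrightarrow> nu i * x \<in> Gam"
proof -
  have "x = bar (nu i) * g \<longleftrightarrow> nu i * x = g" for g by auto
  then show ?thesis
    using assms by (auto simp: entries_def lpow_exponent_entries elt_set_times_def)
qed

lemma entries_mono:
  assumes "I \<subseteq> I'" "Gam \<subseteq> Gam'"
  shows "entries bar lam I Gam i j \<subseteq> entries bar lam I' Gam' i j"
  using assms by (auto simp: entries_def elt_set_times_def)

lemma add_subgroup_entries:
  assumes "form_ideal bar lam Lam I Gam" "i \<noteq> 0"
  shows "add_subgroup (entries bar lam I Gam i j)"
proof (cases "j = - i")
  case True
  then show ?thesis
    using form_ideal_add_subgroup[OF assms(1)] assms(2)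
    by (simp add: add_subgroup_def entries_long distrib_left)
next
  case False
  then show ?thesis
    by (simp add: entries_short two_sided_ideal_add_subgroup form_ideal_ideal[OF assms(1)])
qed

lemma entries_subset_ideal:
  assumes "form_ideal bar lam Lam I Gam" "i \<noteq> 0"
  shows "entries bar lam I Gam i j \<subseteq> I"
proof
  fix x assume x: "x \<in> entries bar lam I Gam i j"
  show "x \<in> I"
  proof (cases "j = - i")
    case True
    then have "nu i * x \<in> I"
      using x assms by (auto simp: entries_long intro: form_ideal_Gam_I)
    then have "bar (nu i) * (nu i * x) \<in> I"
      by (rule two_sided_ideal_mult_left[OF form_ideal_ideal[OF assms(1)]])
    then show ?thesis by simp
  qed (use x in \<open>simp add: entries_short\<close>)
qed

lemma entries_subset_UNIV:
  assumes "form_ideal bar lam Lam I Gam"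
  shows "entries bar lam I Gam i j \<subseteq> entries bar lam UNIV Lam i j"
  using assms by (intro entries_mono) (auto intro: form_ideal_Gam_Lam)

lemma flip_entries:
  assumes "form_ideal bar lam Lam I Gam" "a \<in> entries bar lam I Gam i j" "j \<noteq> - i"
  shows "- (sc i j * bar a) \<in> entries bar lam I Gam (- j) (- i)"
proof -
  note I = form_ideal_ideal[OF assms(1)]
  have "- (sc i j * bar a) \<in> I"
    using assms by (intro add_subgroup_minus[OF two_sided_ideal_add_subgroup[OF I]]
        two_sided_ideal_mult_left[OF I] form_ideal_bar) (simp_all add: entries_short)
  then show ?thesis using assms(3) by (simp add: entries_short)
qed

end

text \<open>Each notion has two alternatives because the pairs \<open>(i, j)\<close> and \<open>(-j, -i)\<close> index the same root
  subgroup.\<close>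

definition opposite_roots :: "int \<Rightarrow> int \<Rightarrow> int \<Rightarrow> int \<Rightarrow> bool" where
  "opposite_roots i j k l \<longleftrightarrow> k = j \<and> l = i \<or> k = - i \<and> l = - j"

definition proportional_roots :: "int \<Rightarrow> int \<Rightarrow> int \<Rightarrow> int \<Rightarrow> bool" where
  "proportional_roots i j k l \<longleftrightarrow> opposite_roots i j k l \<or> opposite_roots i j l k"

text \<open>A linear functional on the root lattice of type \<open>C\<^sub>n\<close>, given by its values on the weights; it takes
the value \<open>f i - f j\<close> on the root of \<open>(i, j)\<close>.\<close>

definition odd_fun :: "(int \<Rightarrow> int) \<Rightarrow> bool" where
  "odd_fun f \<longleftrightarrow> (\<forall>m. f (- m) = - f m)"

text \<open>The root of \<open>(p, q)\<close> is a positive combination of those of \<open>(i, j)\<close> and \<open>(k, l)\<close>. Testing this by all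
functionals avoids introducing the root lattice.\<close>

definition root_combination :: "int \<Rightarrow> int \<Rightarrow> int \<Rightarrow> int \<Rightarrow> int \<Rightarrow> int \<Rightarrow> bool" where
  "root_combination i j k l p q \<longleftrightarrow> (\<exists>m m'. 0 < m \<and> 0 < m' \<and>
     (\<forall>f. odd_fun f \<longrightarrow> f p - f q = m * (f i - f j) + m' * (f k - f l)))"

lemma odd_fun_uminus: "odd_fun f \<Longrightarrow> odd_fun (\<lambda>m. - f m)"
  by (simp add: odd_fun_def)

lemma root_combination_flips:
  "root_combination (- j) (- i) k l = root_combination i j k l"
  "root_combination i j (- l) (- k) = root_combination i j k l"
  "root_combination k l i j = root_combination i j k l"
proof -
  show "root_combination (- j) (- i) k l = root_combination i j k l"
    "root_combination i j (- l) (- k) = root_combination i j k l"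
    unfolding root_combination_def odd_fun_def
    by (intro ext ex_cong1 conj_cong refl all_cong, simp)+
  have "root_combination k l i j p q" if "root_combination i j k l p q" for i j k l p q
    using that unfolding root_combination_def by (metis add.commute)
  then show "root_combination k l i j = root_combination i j k l" by (intro ext iffI)
qed

definition coordinate :: "int \<Rightarrow> int \<Rightarrow> int" where
  "coordinate p m = (if m = p then 1 else if m = - p then - 1 else 0)"

lemma odd_fun_coordinate: "p \<noteq> 0 \<Longrightarrow> odd_fun (coordinate p)"
  by (auto simp: odd_fun_def coordinate_def)

text \<open>If one index of \<open>(k, l)\<close> does not occur in \<open>(i, j)\<close> up to sign, its coordinate function does it, up to
sign. Otherwise both roots lie in the plane of \<open>i\<close> and \<open>j\<close>, and the sum of the two coordinates works,
again up to sign.\<close>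

lemma generic_functional:
  assumes "i \<noteq> 0" "j \<noteq> 0" "k \<noteq> 0" "l \<noteq> 0" "i \<noteq> j" "k \<noteq> l" "\<not> proportional_roots i j k l"
  shows "\<exists>f. odd_fun f \<and> f i = f j \<and> f l < f k"
proof -
  have odd: "odd_fun (\<lambda>m. coordinate i m + coordinate j m)"
    using odd_fun_coordinate[OF assms(1)] odd_fun_coordinate[OF assms(2)] by (simp add: odd_fun_def)
  have "\<exists>f. odd_fun f \<and> f i = f j \<and> f l \<noteq> f k"
  proof (cases "k \<notin> {i, - i, j, - j}")
    case True
    then have "coordinate k i = coordinate k j" "coordinate k l \<noteq> coordinate k k"
      using assms by (auto simp: coordinate_def)
    then show ?thesis using odd_fun_coordinate[OF assms(3)] by blast
  next
    case k: False
    show ?thesis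
    proof (cases "l \<notin> {i, - i, j, - j}")
      case True
      then have "coordinate l i = coordinate l j" "coordinate l l \<noteq> coordinate l k"
        using assms by (auto simp: coordinate_def)
      then show ?thesis using odd_fun_coordinate[OF assms(4)] by blast
    next
      case False
      have "j \<noteq> - i"
        using k False assms by (auto simp: proportional_roots_def opposite_roots_def)
      then have "coordinate i i + coordinate j i = coordinate i j + coordinate j j" "coordinate i l + coordinate j l \<noteq> coordinate i k + coordinate j k"
        using k False assms
        by (auto simp: coordinate_def proportional_roots_def opposite_roots_def)
      then show ?thesis using odd by blast
    qed
  qed
  then obtain f where f: "odd_fun f" "f i = f j" "f l \<noteq> f k" by blast
  show ?thesis
  proof (cases "f l < f k")
    case False
    then show ?thesis
      using f odd_fun_uminus by (intro exI[of _ "\<lambda>m. - f m"]) auto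
  qed (use f in blast)
qed

text \<open>The properties of the elementary unitary group on which the argument rests, stated for an abstract
group: the commutator relations between root elements, and the action of Weyl elements on the root
elements that are needed. The commutator relations are stated as equations between products, so that
they do not refer to inverses.\<close>

locale elementary_relations = group G + form_ring_setting bar lam Lam
  for G (structure) and bar :: "'a::{ring,monoid_mult} \<Rightarrow> 'a" and lam Lam +
  fixes n :: nat and t :: "int \<Rightarrow> int \<Rightarrow> 'a \<Rightarrow> 'b"
  assumes n: "3 \<le> n"
    and t_generate: "carrier G = generate G
      {t i j c | i j c. i \<in> Omega n \<and> j \<in> Omega n \<and> i \<noteq> j \<and> c \<in> entries bar lam UNIV Lam i j}"
    and t_carrier: "i \<in> Omega n \<Longrightarrow> j \<in> Omega n \<Longrightarrow> i \<noteq> j \<Longrightarrow> c \<in> entries bar lam UNIV Lam i j \<Longrightarrow>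
      t i j c \<in> carrier G"
    and t_add: "i \<in> Omega n \<Longrightarrow> j \<in> Omega n \<Longrightarrow> i \<noteq> j \<Longrightarrow> t i j a \<otimes> t i j b = t i j (a + b)"
    and t_flip: "i \<in> Omega n \<Longrightarrow> j \<in> Omega n \<Longrightarrow> j \<noteq> - i \<Longrightarrow>
      t i j c = t (- j) (- i) (- (sc i j * bar c))"
    and t_commute: "i \<in> Omega n \<Longrightarrow> j \<in> Omega n \<Longrightarrow> k \<in> Omega n \<Longrightarrow> l \<in> Omega n \<Longrightarrow>
      j \<noteq> k \<Longrightarrow> i \<noteq> l \<Longrightarrow> i \<noteq> - k \<Longrightarrow> j \<noteq> - l \<Longrightarrow> t i j a \<otimes> t k l b = t k l b \<otimes> t i j a"
    and t_short: "i \<in> Omega n \<Longrightarrow> j \<in> Omega n \<Longrightarrow> k \<in> Omega n \<Longrightarrow>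
      i \<noteq> j \<Longrightarrow> i \<noteq> - j \<Longrightarrow> j \<noteq> k \<Longrightarrow> j \<noteq> - k \<Longrightarrow> i \<noteq> k \<Longrightarrow> i \<noteq> - k \<Longrightarrow>
      t i j a \<otimes> t j k b = t i k (a * b) \<otimes> (t j k b \<otimes> t i j a)"
    and t_long: "i \<in> Omega n \<Longrightarrow> j \<in> Omega n \<Longrightarrow> i \<noteq> j \<Longrightarrow> i \<noteq> - j \<Longrightarrow>
      t i j a \<otimes> t j (- i) b =
        t i (- i) (a * b - sc i (- i) * bar (a * b)) \<otimes> (t j (- i) b \<otimes> t i j a)"
    and t_mixed: "i \<in> Omega n \<Longrightarrow> j \<in> Omega n \<Longrightarrow> i \<noteq> j \<Longrightarrow> i \<noteq> - j \<Longrightarrow> sc i (- i) * bar a = - a \<Longrightarrow>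
      t i (- i) a \<otimes> t (- i) j b = t (- j) j (- (sc (- i) j * bar b * a * b)) \<otimes>
        (t i j (a * b) \<otimes> (t (- i) j b \<otimes> t i (- i) a))"
    and t_weyl_short: "k \<in> Omega n \<Longrightarrow> j \<in> Omega n \<Longrightarrow> i \<in> Omega n \<Longrightarrow>
      k \<noteq> j \<Longrightarrow> k \<noteq> - j \<Longrightarrow> i \<noteq> k \<Longrightarrow> i \<noteq> - k \<Longrightarrow> i \<noteq> j \<Longrightarrow> i \<noteq> - j \<Longrightarrow>
      (t k j 1 \<otimes> (t j k (- 1) \<otimes> t k j 1)) \<otimes> t i k a =
        t i j (- a) \<otimes> (t k j 1 \<otimes> (t j k (- 1) \<otimes> t k j 1))"
      "k \<in> Omega n \<Longrightarrow> j \<in> Omega n \<Longrightarrow> i \<in> Omega n \<Longrightarrow>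
      k \<noteq> j \<Longrightarrow> k \<noteq> - j \<Longrightarrow> i \<noteq> k \<Longrightarrow> i \<noteq> - k \<Longrightarrow> i \<noteq> j \<Longrightarrow> i \<noteq> - j \<Longrightarrow>
      (t k j 1 \<otimes> (t j k (- 1) \<otimes> t k j 1)) \<otimes> t k i a =
        t j i (- a) \<otimes> (t k j 1 \<otimes> (t j k (- 1) \<otimes> t k j 1))"
    and t_weyl_long: "k \<in> Omega n \<Longrightarrow> i \<in> Omega n \<Longrightarrow> k \<noteq> i \<Longrightarrow> k \<noteq> - i \<Longrightarrow>
      (t k i 1 \<otimes> (t i k (- 1) \<otimes> t k i 1)) \<otimes> t i (- i) a =
        t k (- k) (a * sc k i) \<otimes> (t k i 1 \<otimes> (t i k (- 1) \<otimes> t k i 1))"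
      "k \<in> Omega n \<Longrightarrow> i \<in> Omega n \<Longrightarrow> k \<noteq> i \<Longrightarrow> k \<noteq> - i \<Longrightarrow>
      (t k i 1 \<otimes> (t i k (- 1) \<otimes> t k i 1)) \<otimes> t (- i) i a =
        t (- k) k (sc i k * a) \<otimes> (t k i 1 \<otimes> (t i k (- 1) \<otimes> t k i 1))"
begin

abbreviation root :: "int \<Rightarrow> int \<Rightarrow> bool" where
  "root i j \<equiv> i \<in> Omega n \<and> j \<in> Omega n \<and> i \<noteq> j"

abbreviation ent :: "'a set \<Rightarrow> 'a set \<Rightarrow> int \<Rightarrow> int \<Rightarrow> 'a set" where
  "ent \<equiv> entries bar lam"

abbreviation form :: "'a set \<Rightarrow> 'a set \<Rightarrow> bool" where
  "form \<equiv> form_ideal bar lam Lam"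

abbreviation cj where "cj \<equiv> conjugate G"
abbreviation cm where "cm \<equiv> group_commutator G"

definition root_elements :: "'a set \<Rightarrow> 'a set \<Rightarrow> (int \<Rightarrow> int \<Rightarrow> bool) \<Rightarrow> 'b set" where
  "root_elements I Gam P = {t p q x | p q x. root p q \<and> P p q \<and> x \<in> ent I Gam p q}"

text \<open>The unipotent group of a functional \<open>f\<close> is formed for any form ideal, since it measures by how much
  relative root elements are moved; the absolute parabolic group acts on it by conjugation.\<close>

definition unipotent :: "(int \<Rightarrow> int) \<Rightarrow> 'a set \<Rightarrow> 'a set \<Rightarrow> 'b set" where
  "unipotent f I Gam = generate G (root_elements I Gam (\<lambda>p q. f q < f p))"

definition parabolic :: "(int \<Rightarrow> int) \<Rightarrow> 'b set" where
  "parabolic f = generate G (root_elements UNIV Lam (\<lambda>p q. f q \<le> f p))"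

definition elementary :: "'a set \<Rightarrow> 'a set \<Rightarrow> 'b set" where
  "elementary I Gam = generate G (root_elements I Gam (\<lambda>_ _. True))"

lemma form_absolute: "form UNIV Lam"
  by (rule form_ideal_UNIV)

lemma t_closed [simp]:
  "form I Gam \<Longrightarrow> root i j \<Longrightarrow> a \<in> ent I Gam i j \<Longrightarrow> t i j a \<in> carrier G"
  using entries_subset_UNIV t_carrier by blast

lemma ent_add: "form I Gam \<Longrightarrow> root i j \<Longrightarrow> a \<in> ent I Gam i j \<Longrightarrow> b \<in> ent I Gam i j \<Longrightarrow> a + b \<in> ent I Gam i j"
  and ent_uminus: "form I Gam \<Longrightarrow> root i j \<Longrightarrow> a \<in> ent I Gam i j \<Longrightarrow> - a \<in> ent I Gam i j"
  and ent_zero: "form I Gam \<Longrightarrow> root i j \<Longrightarrow> 0 \<in> ent I Gam i j"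
proof -
  assume *: "form I Gam" "root i j"
  then have s: "add_subgroup (ent I Gam i j)"
    by (intro add_subgroup_entries) (auto simp: Omega_nonzero)
  show "a \<in> ent I Gam i j \<Longrightarrow> b \<in> ent I Gam i j \<Longrightarrow> a + b \<in> ent I Gam i j"
    "a \<in> ent I Gam i j \<Longrightarrow> - a \<in> ent I Gam i j" "0 \<in> ent I Gam i j"
    using add_subgroup_add[OF s] add_subgroup_minus[OF s] add_subgroup_zero[OF s] by auto
qed

lemma t_zero: "root i j \<Longrightarrow> t i j 0 = \<one>"
proof -
  assume r: "root i j"
  then have "t i j 0 \<in> carrier G" using ent_zero[OF form_absolute] t_closed[OF form_absolute] by blast
  moreover have "t i j 0 \<otimes> t i j 0 = t i j 0" using t_add[of i j 0 0] r by simp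
  ultimately show ?thesis by simp
qed

lemma t_uminus: "form I Gam \<Longrightarrow> root i j \<Longrightarrow> a \<in> ent I Gam i j \<Longrightarrow> t i j (- a) = inv (t i j a)"
proof -
  assume *: "form I Gam" "root i j" "a \<in> ent I Gam i j"
  have "t i j (- a) \<otimes> t i j a = \<one>" using * t_add[of i j "- a" a] by (simp add: t_zero)
  then show ?thesis using * by (intro inv_equality[symmetric]) (simp_all add: ent_uminus)
qed

lemma opposite_rootsE:
  assumes "opposite_roots i j k l" "form I Gam" "root i j" "a \<in> ent I Gam k l"
  obtains a' where "a' \<in> ent I Gam j i" "t k l a = t j i a'"
proof (cases "k = j \<and> l = i")
  case False
  then have kl: "k = - i" "l = - j" using assms(1) by (auto simp: opposite_roots_def)
  show ?thesis
  proof (cases "l = - k")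
    case True
    then have "k = j" "l = i" using kl by auto
    then show ?thesis using that assms by blast
  next
    case nl: False
    have "t k l a = t j i (- (sc k l * bar a))"
      using t_flip[of k l a] nl kl assms(3) by simp
    moreover have "- (sc k l * bar a) \<in> ent I Gam j i"
      using flip_entries[OF assms(2,4) nl] kl by simp
    ultimately show ?thesis using that by blast
  qed
qed (use that assms in blast)

lemma root_elements_carrier: "form I Gam \<Longrightarrow> root_elements I Gam P \<subseteq> carrier G"
  by (auto simp: root_elements_def)

lemma root_elements_inv: "form I Gam \<Longrightarrow> s \<in> root_elements I Gam P \<Longrightarrow> inv s \<in> root_elements I Gam P"
  unfolding root_elements_def using t_uminus[symmetric] ent_uminus by blast

lemma root_elements_mono:
  assumes "\<And>p q. root p q \<Longrightarrow> P p q \<Longrightarrow> Q p q" "I \<subseteq> I'" "Gam \<subseteq> Gam'"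
  shows "root_elements I Gam P \<subseteq> root_elements I' Gam' Q"
  using assms entries_mono[OF assms(2,3)] unfolding root_elements_def by blast

lemma t_in_root_elements: "root p q \<Longrightarrow> P p q \<Longrightarrow> x \<in> ent I Gam p q \<Longrightarrow> t p q x \<in> root_elements I Gam P"
  unfolding root_elements_def by blast

lemma t_in_generate: "root p q \<Longrightarrow> P p q \<Longrightarrow> x \<in> ent I Gam p q \<Longrightarrow> t p q x \<in> generate G (root_elements I Gam P)"
  by (intro generate.incl t_in_root_elements)

lemma t_in_unipotent: "root p q \<Longrightarrow> f q < f p \<Longrightarrow> x \<in> ent I Gam p q \<Longrightarrow> t p q x \<in> unipotent f I Gam"
  unfolding unipotent_def by (rule t_in_generate)

lemma t_in_parabolic: "root p q \<Longrightarrow> f q \<le> f p \<Longrightarrow> x \<in> ent UNIV Lam p q \<Longrightarrow> t p q x \<in> parabolic f"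
  unfolding parabolic_def by (rule t_in_generate)

lemma t_in_elementary: "root p q \<Longrightarrow> x \<in> ent I Gam p q \<Longrightarrow> t p q x \<in> elementary I Gam"
  unfolding elementary_def by (rule t_in_generate) auto

lemma subgroup_unipotent: "form I Gam \<Longrightarrow> subgroup (unipotent f I Gam) G"
  and subgroup_elementary: "form I Gam \<Longrightarrow> subgroup (elementary I Gam) G"
  and subgroup_parabolic: "subgroup (parabolic f) G"
  unfolding unipotent_def elementary_def parabolic_def
  by (auto intro!: generate_is_subgroup root_elements_carrier form_absolute)

lemma unipotent_carrier: "form I Gam \<Longrightarrow> unipotent f I Gam \<subseteq> carrier G"
  by (intro subgroup.subset subgroup_unipotent)

lemma unipotent_subset_elementary: "unipotent f I Gam \<subseteq> elementary I Gam"
  unfolding unipotent_def elementary_def by (intro mono_generate root_elements_mono) auto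

lemma unipotent_subset_parabolic: "unipotent f UNIV Lam \<subseteq> parabolic f"
  unfolding unipotent_def parabolic_def by (intro mono_generate root_elements_mono) auto

lemma commutator_disjoint:
  assumes "form I Gam" "form J Del" "root i j" "root k l" "a \<in> ent I Gam i j" "b \<in> ent J Del k l"
    and "j \<noteq> k" "i \<noteq> l" "i \<noteq> - k" "j \<noteq> - l"
  shows "cm (t i j a) (t k l b) = \<one>"
  using assms t_commute[of i j k l a b] by (intro commutator_eqI) simp_all

lemma commutator_short:
  assumes "form I Gam" "form J Del" "a \<in> ent I Gam i j" "b \<in> ent J Del j k"
    and "root i j" "root j k" "root i k" "i \<noteq> - j" "j \<noteq> - k" "i \<noteq> - k"
  shows "cm (t i j a) (t j k b) = t i k (a * b)"
  using assms t_short[of i j k a b] t_closed[OF form_absolute, of i k "a * b"]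
  by (intro commutator_eqI) (auto simp: entries_short)

text \<open>The second part identifies the parameter as a trace \<open>x - \<lambda> bar x\<close> up to \<open>\<nu>\<^sub>i\<close>, hence as an element of the
smallest form parameter.\<close>

lemma commutator_long:
  assumes "form I Gam" "form J Del" "a \<in> ent I Gam i j" "b \<in> ent J Del j (- i)"
    and "root i j" "i \<noteq> - j"
  shows "cm (t i j a) (t j (- i) b) = t i (- i) (a * b - sc i (- i) * bar (a * b))"
    and "nu i * (a * b - sc i (- i) * bar (a * b)) = nu i * (a * b) - lam * bar (nu i * (a * b))"
proof -
  have i: "i \<noteq> 0" using assms Omega_nonzero by blast
  have "nu i * (sc i (- i) * bar (a * b)) = (nu i * nu (- i)) * (bar (nu i) * bar (a * b))"
    by (simp add: sc_def mult.assoc)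
  also have "\<dots> = lam * bar (nu i * (a * b))"
    using i by (simp add: nu_uminus bar_mult[of "nu i"] bar_nu_commute[of i "bar (a * b)"])
  finally show eq: "nu i * (a * b - sc i (- i) * bar (a * b)) = nu i * (a * b) - lam * bar (nu i * (a * b))"
    by (simp add: right_diff_distrib)
  have "a * b - sc i (- i) * bar (a * b) \<in> ent UNIV Lam i (- i)"
    using i by (simp add: entries_long eq Lam_min)
  then have "t i (- i) (a * b - sc i (- i) * bar (a * b)) \<in> carrier G"
    using assms Omega_neq_uminus by (intro t_closed[OF form_absolute]) auto
  then show "cm (t i j a) (t j (- i) b) = t i (- i) (a * b - sc i (- i) * bar (a * b))"
    using assms t_long[of i j a b] by (intro commutator_eqI) (auto simp: Omega_neq_uminus)
qed

lemma long_entry_antisymmetric: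
  assumes "a \<in> ent UNIV Lam i (- i)" "i \<noteq> 0"
  shows "sc i (- i) * bar a = - a"
proof -
  have "nu i * a \<in> Lam" using assms by (simp add: entries_long)
  from Lam_max[OF this] have e: "lam * (bar a * bar (nu i)) = - (nu i * a)" by (simp add: bar_mult)
  have "sc i (- i) * bar a = (bar (nu i) * (nu i * nu (- i))) * (bar (nu i) * bar a)"
    by (simp add: sc_def mult.assoc)
  also have "\<dots> = bar (nu i) * (lam * (bar a * bar (nu i)))"
    using assms(2) by (simp add: nu_uminus bar_nu_commute[of i "bar a"] mult.assoc)
  finally show ?thesis by (simp add: e)
qed

lemma mixed_entry:
  assumes "i \<noteq> 0" "j \<noteq> 0"
  shows "nu (- j) * (- (sc (- i) j * bar b * a * b)) = - (bar b * (nu i * a) * b)"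
proof -
  have "nu (- j) * (- (sc (- i) j * bar b * a * b)) =
      - ((nu j * nu (- j)) * bar (nu (- i)) * (bar b * (a * b)))"
    by (simp add: sc_def mult.assoc nu_commute[of "- j" "nu j"])
       (simp add: mult.assoc[symmetric] nu_commute[of "- j" "nu j"])
  also have "nu j * nu (- j) = nu i * nu (- i)" using assms by (simp add: nu_uminus)
  also have "nu i * nu (- i) * bar (nu (- i)) = nu i" by (simp add: mult.assoc)
  also have "nu i * (bar b * (a * b)) = bar b * (nu i * a) * b"
    by (simp add: nu_commute[of i "bar b"] flip: mult.assoc)
  finally show ?thesis .
qed

lemma commutator_mixed:
  assumes "form I Gam" "form J Del" "a \<in> ent I Gam i (- i)" "b \<in> ent J Del (- i) j"
    and "root i j" "i \<noteq> - j"
  shows "cm (t i (- i) a) (t (- i) j b) =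
      t (- j) j (- (sc (- i) j * bar b * a * b)) \<otimes> t i j (a * b)"
    and "- (sc (- i) j * bar b * a * b) \<in> ent UNIV Lam (- j) j"
proof -
  have nz: "i \<noteq> 0" "j \<noteq> 0" "i \<noteq> - i" "j \<noteq> - j" using assms Omega_nonzero by auto
  have "a \<in> ent UNIV Lam i (- i)" using entries_subset_UNIV[OF assms(1)] assms(3) by blast
  with nz have a: "nu i * a \<in> Lam" "sc i (- i) * bar a = - a"
    by (simp_all add: entries_long long_entry_antisymmetric)
  have "- (bar b * (nu i * a) * bar (bar b)) \<in> Lam"
    by (intro add_subgroup_minus[OF Lam_add_subgroup] Lam_mult a)
  then show m: "- (sc (- i) j * bar b * a * b) \<in> ent UNIV Lam (- j) j"
    using entries_long[of "- j" _ UNIV Lam] nz mixed_entry[OF nz(1,2), of b a] by simp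
  have c: "t (- j) j (- (sc (- i) j * bar b * a * b)) \<in> carrier G" "t i j (a * b) \<in> carrier G"
    using assms nz m by (auto intro!: t_closed[OF form_absolute] simp: entries_short)
  then show "cm (t i (- i) a) (t (- i) j b) =
      t (- j) j (- (sc (- i) j * bar b * a * b)) \<otimes> t i j (a * b)"
    using assms nz t_mixed[of i j a b] a
    by (intro commutator_eqI) (auto simp: m_assoc)
qed

end


section \<open>The Chevalley commutator formula\<close>

context elementary_relations
begin

lemma commutator_formula_adjacent:
  assumes IG: "form I Gam" and JD: "form J Del"
    and "root i j" "root j l" "i \<noteq> l" "j \<noteq> - l \<or> i = - j"
    and ab: "a \<in> ent I Gam i j" "b \<in> ent J Del j l"
  shows "cm (t i j a) (t j l b) \<in> generate G (root_elements (sym_ideal_mult I J)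
    (sym_form_mult bar lam Lam I Gam J Del) (root_combination i j j l))"
proof -
  interpret two_form_ideals bar lam Lam I Gam J Del by unfold_locales (fact IG JD)+
  note gen = t_in_generate[where I = K and Gam = Theta]
  have nz: "i \<noteq> 0" "j \<noteq> 0" "l \<noteq> 0" "i \<noteq> - i" "j \<noteq> - j" "l \<noteq> - l"
    using assms Omega_nonzero by auto
  have abI: "a \<in> I" "b \<in> J"
    using entries_subset_ideal[OF IG] entries_subset_ideal[OF JD] ab nz by blast+
  consider (short) "i \<noteq> - j" "i \<noteq> - l" | (long) "i \<noteq> - j" "i = - l" | (mixed) "i = - j" by blast
  then show ?thesis
  proof cases
    case short
    have "root_combination i j j l i l"
      unfolding root_combination_def by (intro exI[of _ 1]) simp
    moreover have "cm (t i j a) (t j l b) = t i l (a * b)"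
      using short assms by (intro commutator_short[OF IG JD]) auto
    ultimately show ?thesis
      using short assms abI by (auto intro!: gen K_products(1) simp: entries_short)
  next
    case long
    then have l: "l = - i" by simp
    have "root_combination i j j l i (- i)"
      unfolding root_combination_def by (intro exI[of _ 1]) (simp add: l)
    moreover have "nu i * (a * b) \<in> K"
      by (intro two_sided_ideal_mult_left[OF K_ideal] K_products abI)
    then have "nu i * (a * b) - lam * bar (nu i * (a * b)) \<in> Theta"
      using Gamma_min_Theta Gamma_min_trace by blast
    ultimately show ?thesis
      using long assms nz commutator_long[OF IG JD ab(1), of b] unfolding l
      by (auto intro!: gen simp: entries_long)
  next
    case mixed
    then have j: "j = - i" by simp
    have "root_combination i j j l i l"
      unfolding root_combination_def by (intro exI[of _ 1]) simp
    moreover have "root_combination i j j l (- l) l"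
      unfolding root_combination_def
      by (intro exI[of _ 1] exI[of _ 2]) (simp add: j odd_fun_def)
    moreover have "i \<noteq> - l" using assms j by auto
    moreover have "nu i * a \<in> Gam" using ab nz unfolding j by (simp add: entries_long)
    then have "- (bar b * (nu i * a) * bar (bar b)) \<in> Theta"
      using abI JD by (intro add_subgroup_minus[OF Theta_add_subgroup] Theta_twist form_ideal_bar)
    then have "- (sc (- i) l * bar b * a * b) \<in> ent K Theta (- l) l"
      using entries_long[of "- l" _ K Theta] nz mixed_entry[of i l b a] by simp
    ultimately show ?thesis
      using assms nz abI commutator_mixed(1)[OF IG JD, of a i b l] unfolding j
      by (auto intro!: generate.eng gen K_products(1) simp: entries_short)
  qed
qed

text \<open>Up to the identification of \<open>(i, j)\<close> with \<open>(-j, -i)\<close> and up to interchanging the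
  two factors, either the root elements commute or the second index of the first is the first
  index of the second. As flipping and interchanging act on the form ideals and parameters as well, the claim is
  first turned into a property \<open>Q\<close> of the indices alone.\<close>

lemma commutator_formula:
  assumes "form I Gam" "form J Del" "root i j" "root k l" "\<not> opposite_roots i j k l"
    and "a \<in> ent I Gam i j" "b \<in> ent J Del k l"
  shows "cm (t i j a) (t k l b) \<in> generate G (root_elements (sym_ideal_mult I J)
    (sym_form_mult bar lam Lam I Gam J Del) (root_combination i j k l))"
proof -
  define Q where "Q i j k l \<longleftrightarrow> (\<forall>I Gam J Del a b. form I Gam \<longrightarrow> form J Del \<longrightarrow>
     a \<in> ent I Gam i j \<longrightarrow> b \<in> ent J Del k l \<longrightarrow>
     cm (t i j a) (t k l b) \<in> generate G (root_elements (sym_ideal_mult I J)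
       (sym_form_mult bar lam Lam I Gam J Del) (root_combination i j k l)))" for i j k l
  have flip: "\<exists>a'. a' \<in> ent I Gam (- j) (- i) \<and> t i j a = t (- j) (- i) a'"
    if "form I Gam" "root i j" "a \<in> ent I Gam i j" for I Gam i j a
    using opposite_rootsE[of "- i" "- j" i j I Gam a] that
    by (auto simp: opposite_roots_def)
  have flip1: "Q i j k l" if q: "Q (- j) (- i) k l" and r: "root i j" for i j k l
    unfolding Q_def
  proof (intro allI impI)
    fix I Gam J Del a b
    assume *: "form I Gam" "form J Del" "a \<in> ent I Gam i j" "b \<in> ent J Del k l"
    obtain a' where "a' \<in> ent I Gam (- j) (- i)" "t i j a = t (- j) (- i) a'"
      using flip[OF *(1) r *(3)] by blast
    then show "cm (t i j a) (t k l b) \<in> generate G (root_elements (sym_ideal_mult I J)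
        (sym_form_mult bar lam Lam I Gam J Del) (root_combination i j k l))"
      using q *(1,2,4) unfolding Q_def root_combination_flips(1)[of j i] by metis
  qed
  have swap: "Q i j k l" if "Q k l i j" "root i j" "root k l" for i j k l
    unfolding Q_def
  proof (intro allI impI)
    fix I Gam J Del a b
    assume *: "form I Gam" "form J Del" "a \<in> ent I Gam i j" "b \<in> ent J Del k l"
    interpret two_form_ideals bar lam Lam I Gam J Del by unfold_locales (fact *)+
    have "cm (t k l b) (t i j a) \<in> generate G (root_elements (sym_ideal_mult J I)
        (sym_form_mult bar lam Lam J Del I Gam) (root_combination k l i j))"
      using that(1) * unfolding Q_def by blast
    then have "cm (t k l b) (t i j a) \<in> generate G (root_elements K Theta (root_combination i j k l))"
      unfolding sym_ideal_mult_commute[of J I] sym_form_mult_commute[of bar lam Lam J Del I Gam]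
        root_combination_flips(3)[of k l i j] .
    then show "cm (t i j a) (t k l b) \<in> generate G (root_elements K Theta (root_combination i j k l))"
      by (rule commutator_mem_swap[rotated -1])
        (use that * form_ideal_Theta in \<open>auto intro!: generate_is_subgroup root_elements_carrier\<close>)
  qed
  have flip2: "Q i j k l" if "Q i j (- l) (- k)" "root i j" "root k l" for i j k l
    by (rule swap, rule flip1, rule swap) (use that in auto)
  have adjacent: "Q i j j l" if r: "root i j" "root j l" "i \<noteq> l" for i j l
  proof (cases "j \<noteq> - l \<or> i = - j")
    case True
    then show ?thesis
      unfolding Q_def using commutator_formula_adjacent that by blast
  next
    case False
    then have l: "l = - j" by auto
    have "Q j (- j) (- j) (- i)"
      unfolding Q_def using commutator_formula_adjacent[of _ _ _ _ j "- j" "- i"] that l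
      by (auto simp: Omega_neq_uminus)
    then have "Q j (- j) i j" by (rule flip2) (use that l in auto)
    then have "Q i j j (- j)" by (rule swap) (use that l in auto)
    then show ?thesis unfolding l .
  qed
  have "Q i j k l"
  proof -
    consider "j = k" | "j \<noteq> k" "i = l" | "j \<noteq> k" "i \<noteq> l" "i = - k" |
      "j \<noteq> k" "i \<noteq> l" "i \<noteq> - k" "j = - l" | "j \<noteq> k" "i \<noteq> l" "i \<noteq> - k" "j \<noteq> - l"
      by blast
    then show ?thesis
    proof cases
      case 1
      then show ?thesis using assms adjacent by (auto simp: opposite_roots_def)
    next
      case 2
      then show ?thesis using assms adjacent[of k i j] swap[of k l i j] by auto
    next
      case 3
      then have "Q (- j) (- i) k l"
        using assms adjacent[of "- j" k l] by (auto simp: opposite_roots_def)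
      then show ?thesis using assms flip1 by blast
    next
      case 4
      then have "Q i j (- l) (- k)"
        using assms adjacent[of i j "- k"] by (auto simp: opposite_roots_def)
      then show ?thesis using assms flip2 by blast
    next
      case 5
      then show ?thesis
        unfolding Q_def using assms commutator_disjoint by (auto simp: generate.one)
    qed
  qed
  then show ?thesis using assms unfolding Q_def by blast
qed

lemma commutator_in_elementary:
  assumes "form I Gam" "form J Del" "root i j" "root k l" "\<not> opposite_roots i j k l"
    and "a \<in> ent I Gam i j" "b \<in> ent J Del k l"
  shows "cm (t i j a) (t k l b) \<in>
    elementary (sym_ideal_mult I J) (sym_form_mult bar lam Lam I Gam J Del)"
proof -
  have "generate G (root_elements (sym_ideal_mult I J) (sym_form_mult bar lam Lam I Gam J Del)
      (root_combination i j k l)) \<subseteq>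
    elementary (sym_ideal_mult I J) (sym_form_mult bar lam Lam I Gam J Del)"
    unfolding elementary_def by (intro mono_generate root_elements_mono) auto
  then show ?thesis using commutator_formula[OF assms] by blast
qed

text \<open>A positive combination of two roots with nonnegative values of \<open>f\<close>, one of them positive, has a
positive value; in particular the two roots cannot be opposite.\<close>

lemma commutator_in_unipotent:
  assumes "form I Gam" "form J Del" "root i j" "root k l" "a \<in> ent I Gam i j" "b \<in> ent J Del k l"
    and f: "odd_fun f" "f j \<le> f i" "f l \<le> f k" "f j < f i \<or> f l < f k"
  shows "cm (t i j a) (t k l b) \<in>
    unipotent f (sym_ideal_mult I J) (sym_form_mult bar lam Lam I Gam J Del)"
proof -
  have "\<not> opposite_roots i j k l"
    using f by (auto simp: opposite_roots_def odd_fun_def)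
  note * = commutator_formula[OF assms(1-4) this assms(5,6)]
  have "f q < f p" if comb: "root_combination i j k l p q" for p q
  proof -
    obtain m m' where m: "0 < m" "0 < m'" "f p - f q = m * (f i - f j) + m' * (f k - f l)"
      using comb f(1) unfolding root_combination_def by blast
    have "0 \<le> m * (f i - f j)" "0 \<le> m' * (f k - f l)" using m f by simp_all
    moreover have "0 < m * (f i - f j) \<or> 0 < m' * (f k - f l)" using m f(4) by auto
    ultimately show ?thesis using m by linarith
  qed
  then have "generate G (root_elements (sym_ideal_mult I J) (sym_form_mult bar lam Lam I Gam J Del)
      (root_combination i j k l)) \<subseteq>
    unipotent f (sym_ideal_mult I J) (sym_form_mult bar lam Lam I Gam J Del)"
    unfolding unipotent_def by (intro mono_generate root_elements_mono) auto
  then show ?thesis using * by blast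
qed

lemma absolute_commutator_in_elementary:
  assumes "form I Gam" "root i j" "root k l" "\<not> opposite_roots i j k l"
    and "c \<in> ent UNIV Lam i j" "a \<in> ent I Gam k l"
  shows "cm (t i j c) (t k l a) \<in> elementary I Gam"
proof -
  have "elementary (sym_ideal_mult UNIV I) (sym_form_mult bar lam Lam UNIV Lam I Gam) \<subseteq> elementary I Gam"
    unfolding elementary_def
    by (intro mono_generate root_elements_mono sym_mult_UNIV_subset[OF assms(1)])
  then show ?thesis
    using commutator_in_elementary[OF form_absolute assms(1-6)] by blast
qed

lemma absolute_commutator_in_unipotent:
  assumes "form I Gam" "root i j" "root k l" "c \<in> ent UNIV Lam i j" "a \<in> ent I Gam k l"
    and "odd_fun f" "f j \<le> f i" "f l \<le> f k" "f j < f i \<or> f l < f k"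
  shows "cm (t i j c) (t k l a) \<in> unipotent f I Gam"
proof -
  have "unipotent f (sym_ideal_mult UNIV I) (sym_form_mult bar lam Lam UNIV Lam I Gam) \<subseteq> unipotent f I Gam"
    unfolding unipotent_def
    by (intro mono_generate root_elements_mono sym_mult_UNIV_subset[OF assms(1)])
  then show ?thesis
    using commutator_in_unipotent[OF form_absolute assms(1-5)] assms by blast
qed

lemma parabolic_normalizes_unipotent:
  assumes IG: "form I Gam" and f: "odd_fun f" and g: "g \<in> parabolic f" and u: "u \<in> unipotent f I Gam"
  shows "cj g u \<in> unipotent f I Gam"
  unfolding unipotent_def
proof (rule generate_conjugate_closed[OF root_elements_carrier[OF form_absolute]
      root_elements_inv[OF form_absolute] root_elements_carrier[OF IG]])
  show "g \<in> generate G (root_elements UNIV Lam (\<lambda>p q. f q \<le> f p))"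
    using g by (simp add: parabolic_def)
  show "u \<in> generate G (root_elements I Gam (\<lambda>p q. f q < f p))"
    using u by (simp add: unipotent_def)
  fix s x
  assume "s \<in> root_elements UNIV Lam (\<lambda>p q. f q \<le> f p)"
    and "x \<in> root_elements I Gam (\<lambda>p q. f q < f p)"
  then obtain i j c k l a where *: "s = t i j c" "root i j" "f j \<le> f i" "c \<in> ent UNIV Lam i j"
    "x = t k l a" "root k l" "f l < f k" "a \<in> ent I Gam k l"
    unfolding root_elements_def by blast
  have "cm s x \<in> unipotent f I Gam"
    unfolding * using * by (intro absolute_commutator_in_unipotent IG f) auto
  moreover have "x \<in> unipotent f I Gam"
    unfolding * using * by (intro t_in_unipotent) auto
  moreover have "cj s x = cm s x \<otimes> x"
    using * IG form_absolute by (intro conjugate_eq_commutator) (metis t_closed)+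
  ultimately show "cj s x \<in> generate G (root_elements I Gam (\<lambda>p q. f q < f p))"
    using subgroup.m_closed[OF subgroup_unipotent[OF IG]] unfolding unipotent_def by simp
qed

text \<open>Induction on \<open>u\<close> with \<open>[u v, x] = u [v, x] u\<^bsup>-1\<^esup> [u, x]\<close>: conjugation by \<open>u\<close> preserves the
  relative unipotent group, in which the commutators of generators lie.\<close>

lemma unipotent_commutator_level:
  assumes IG: "form I Gam" and f: "odd_fun f" "f k = f l" and kl: "root k l" "a \<in> ent I Gam k l"
    and u: "u \<in> unipotent f UNIV Lam"
  shows "cm u (t k l a) \<in> unipotent f I Gam"
proof -
  note sg = subgroup_unipotent[OF IG, of f]
  have tc: "t k l a \<in> carrier G" using IG kl by (rule t_closed)
  have gen: "cm s (t k l a) \<in> unipotent f I Gam"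
    if "s \<in> root_elements UNIV Lam (\<lambda>p q. f q < f p)" for s
    using that kl f unfolding root_elements_def
    by (auto intro!: absolute_commutator_in_unipotent IG)
  show ?thesis
    using u unfolding unipotent_def[of f UNIV]
  proof induction
    case one
    then show ?case using tc subgroup.one_closed[OF sg] by simp
  next
    case (incl h)
    then show ?case by (rule gen)
  next
    case (inv h)
    then show ?case using root_elements_inv[OF form_absolute] by (intro gen)
  next
    case (eng u v)
    then have uv: "u \<in> unipotent f UNIV Lam" "v \<in> unipotent f UNIV Lam"
      by (simp_all add: unipotent_def)
    then have "cm (u \<otimes> v) (t k l a) = cj u (cm v (t k l a)) \<otimes> cm u (t k l a)"
      using unipotent_carrier[OF form_absolute] tc by (intro commutator_mult_left) auto
    moreover have "cj u (cm v (t k l a)) \<in> unipotent f I Gam"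
      using uv(1) unipotent_subset_parabolic eng.IH by (intro parabolic_normalizes_unipotent IG f) auto
    ultimately show ?case using eng.IH subgroup.m_closed[OF sg] by simp
  qed
qed


section \<open>Elementary conjugates generate a normal subgroup\<close>

text \<open>The elementary conjugate \<open>Z\<^sub>i\<^sub>j(a, c)\<close>. The group generated by all of them will be the relative elementary
group, by \<open>normal_conjugate_group\<close> and \<open>conjugate_group_least\<close>.\<close>

definition elementary_conjugate :: "int \<Rightarrow> int \<Rightarrow> 'a \<Rightarrow> 'a \<Rightarrow> 'b" where
  "elementary_conjugate i j a c = cj (t j i c) (t i j a)"

definition conjugate_group :: "'a set \<Rightarrow> 'a set \<Rightarrow> 'b set" where
  "conjugate_group I Gam = generate G {elementary_conjugate i j a c | i j a c.
     root i j \<and> a \<in> ent I Gam i j \<and> c \<in> ent UNIV Lam j i}"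

lemma elementary_conjugate_carrier:
  assumes "form I Gam" "root i j" "a \<in> ent I Gam i j" "c \<in> ent UNIV Lam j i"
  shows "elementary_conjugate i j a c \<in> carrier G"
  unfolding elementary_conjugate_def
  using assms t_closed[OF form_absolute, of j i c] by (auto intro: t_closed)

lemma conjugate_group_generators_carrier:
  "form I Gam \<Longrightarrow> {elementary_conjugate i j a c | i j a c.
     root i j \<and> a \<in> ent I Gam i j \<and> c \<in> ent UNIV Lam j i} \<subseteq> carrier G"
  using elementary_conjugate_carrier by blast

lemma elementary_conjugate_mem:
  "root i j \<Longrightarrow> a \<in> ent I Gam i j \<Longrightarrow> c \<in> ent UNIV Lam j i \<Longrightarrow>
    elementary_conjugate i j a c \<in> conjugate_group I Gam"
  unfolding conjugate_group_def by (rule generate.incl) blast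

lemma subgroup_conjugate_group: "form I Gam \<Longrightarrow> subgroup (conjugate_group I Gam) G"
  unfolding conjugate_group_def
  by (rule generate_is_subgroup[OF conjugate_group_generators_carrier])

lemma elementary_subset_conjugate_group:
  assumes "form I Gam"
  shows "elementary I Gam \<subseteq> conjugate_group I Gam"
  unfolding elementary_def
proof (rule generate_subgroup_incl[OF _ subgroup_conjugate_group[OF assms]], rule subsetI)
  fix x assume "x \<in> root_elements I Gam (\<lambda>_ _. True)"
  then obtain p q a where x: "x = t p q a" "root p q" "a \<in> ent I Gam p q"
    unfolding root_elements_def by blast
  moreover have "elementary_conjugate p q a 0 = t p q a"
    using x assms by (simp add: elementary_conjugate_def t_zero)
  ultimately show "x \<in> conjugate_group I Gam"
    using elementary_conjugate_mem[of p q a I Gam 0] ent_zero[OF form_absolute, of q p] by auto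
qed

text \<open>For non-proportional roots take a functional \<open>f\<close> that vanishes on the root of \<open>(i, j)\<close> and is
  positive on that of \<open>(k, l)\<close>: conjugation by \<open>t j i c\<close> can be moved past the commutator.\<close>

lemma commutator_elementary_conjugate_generic:
  assumes IG: "form I Gam" and ij: "root i j" "a \<in> ent I Gam i j" "c \<in> ent UNIV Lam j i"
    and kl: "root k l" "d \<in> ent UNIV Lam k l" and np: "\<not> proportional_roots i j k l"
  shows "cm (t k l d) (elementary_conjugate i j a c) \<in> elementary I Gam"
proof -
  have "i \<noteq> 0" "j \<noteq> 0" "k \<noteq> 0" "l \<noteq> 0" using ij kl by auto
  then obtain f where f: "odd_fun f" "f i = f j" "f l < f k"
    using generic_functional[OF _ _ _ _ _ _ np] ij(1) kl(1) by auto
  let ?y = "t j i c" and ?x = "t k l d"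
  have car: "?y \<in> carrier G" "?x \<in> carrier G" "t i j a \<in> carrier G"
    using ij kl IG t_closed[OF form_absolute, of j i c] t_closed[OF form_absolute, of k l d] by auto
  have y: "?y \<in> parabolic f" using ij f by (intro t_in_parabolic) auto
  have "cj (inv ?y) ?x \<in> unipotent f UNIV Lam"
    by (rule parabolic_normalizes_unipotent[OF form_absolute f(1)
          subgroup.m_inv_closed[OF subgroup_parabolic y] t_in_unipotent[OF kl(1) f(3) kl(2)]])
  then have "cm (cj (inv ?y) ?x) (t i j a) \<in> unipotent f I Gam"
    by (rule unipotent_commutator_level[OF IG f(1,2) ij(1,2)])
  then have "cj ?y (cm (cj (inv ?y) ?x) (t i j a)) \<in> unipotent f I Gam"
    by (rule parabolic_normalizes_unipotent[OF IG f(1) y])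
  then show ?thesis
    unfolding elementary_conjugate_def commutator_conjugate_right[OF car(2,3,1)]
    using unipotent_subset_elementary by blast
qed

text \<open>Conjugation of \<open>Z\<^sub>i\<^sub>j(a, c)\<close> by \<open>T\<^sub>i\<^sub>j(d)\<close> is the one case that the commutator formula does not
  settle. It does not occur when \<open>Z\<^sub>i\<^sub>j(a, c)\<close> is conjugated by generators at which \<open>f\<close> is positive,
  provided that \<open>f\<close> is negative at \<open>(i, j)\<close>; this restriction on the elementary conjugates survives the
  conjugation.\<close>

definition negative_conjugate_group :: "(int \<Rightarrow> int) \<Rightarrow> 'a set \<Rightarrow> 'a set \<Rightarrow> 'b set" where
  "negative_conjugate_group f I Gam = generate G (root_elements I Gam (\<lambda>_ _. True) \<union>
     {elementary_conjugate i j a c | i j a c.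
       root i j \<and> f i < f j \<and> a \<in> ent I Gam i j \<and> c \<in> ent UNIV Lam j i})"

lemma negative_conjugate_group_subset:
  assumes "form I Gam"
  shows "negative_conjugate_group f I Gam \<subseteq> conjugate_group I Gam"
  unfolding negative_conjugate_group_def
proof (rule generate_subgroup_incl[OF _ subgroup_conjugate_group[OF assms]])
  have "root_elements I Gam (\<lambda>_ _. True) \<subseteq> elementary I Gam"
    unfolding elementary_def by (intro subsetI generate.incl)
  then have "root_elements I Gam (\<lambda>_ _. True) \<subseteq> conjugate_group I Gam"
    using elementary_subset_conjugate_group[OF assms] by blast
  then show "root_elements I Gam (\<lambda>_ _. True) \<union> {elementary_conjugate i j a c | i j a c.
       root i j \<and> f i < f j \<and> a \<in> ent I Gam i j \<and> c \<in> ent UNIV Lam j i} \<subseteq> conjugate_group I Gam"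
    using elementary_conjugate_mem by blast
qed

lemma conjugate_opposite:
  assumes IG: "form I Gam" and ij: "root i j" "a \<in> ent I Gam i j" "c \<in> ent UNIV Lam j i"
    and d: "opposite_roots i j k l" "d \<in> ent UNIV Lam k l"
  obtains d' where "d' \<in> ent UNIV Lam j i" "t k l d = t j i d'"
    "cj (t k l d) (elementary_conjugate i j a c) = elementary_conjugate i j a (d' + c)"
proof -
  obtain d' where d': "d' \<in> ent UNIV Lam j i" "t k l d = t j i d'"
    using opposite_rootsE[OF d(1) form_absolute ij(1) d(2)] by blast
  have ji: "root j i" using ij by auto
  have car: "t j i c \<in> carrier G" "t j i d' \<in> carrier G" "t i j a \<in> carrier G"
    by (rule t_closed[OF form_absolute ji ij(3)] t_closed[OF form_absolute ji d'(1)]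
        t_closed[OF IG ij(1,2)])+
  have "cj (t k l d) (elementary_conjugate i j a c) = elementary_conjugate i j a (d' + c)"
    unfolding elementary_conjugate_def d'(2) using car ij
    by (simp add: conjugate_conjugate t_add)
  then show ?thesis using that d' by blast
qed

text \<open>A root element with \<open>f > 0\<close> turns a relative root element of the opposite root, where \<open>f < 0\<close>, into an elementary
conjugate, changes the second parameter of an elementary conjugate of the opposite root, and moves all
other generators by relative root elements.\<close>

lemma unipotent_normalizes_negative:
  assumes IG: "form I Gam" and f: "odd_fun f"
    and u: "u \<in> unipotent f UNIV Lam" and x: "x \<in> negative_conjugate_group f I Gam"
  shows "cj u x \<in> negative_conjugate_group f I Gam"
proof -
  let ?X = "root_elements I Gam (\<lambda>_ _. True) \<union> {elementary_conjugate i j a c | i j a c.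
       root i j \<and> f i < f j \<and> a \<in> ent I Gam i j \<and> c \<in> ent UNIV Lam j i}"
  have X: "?X \<subseteq> carrier G"
    using root_elements_carrier[OF IG] conjugate_group_generators_carrier[OF IG] by blast
  note sg = generate_is_subgroup[OF X]
  have el: "elementary I Gam \<subseteq> generate G ?X"
    unfolding elementary_def by (rule mono_generate) blast
  have conj: "elementary_conjugate i j a c \<in> generate G ?X"
    if "root i j" "f i < f j" "a \<in> ent I Gam i j" "c \<in> ent UNIV Lam j i" for i j a c
    using that by (intro generate.incl) blast
  show ?thesis
    unfolding negative_conjugate_group_def
  proof (rule generate_conjugate_closed[OF root_elements_carrier[OF form_absolute]
        root_elements_inv[OF form_absolute] X])
    show "u \<in> generate G (root_elements UNIV Lam (\<lambda>p q. f q < f p))"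
      using u by (simp add: unipotent_def)
    show "x \<in> generate G ?X" using x by (simp add: negative_conjugate_group_def)
    fix s x assume s: "s \<in> root_elements UNIV Lam (\<lambda>p q. f q < f p)" and x: "x \<in> ?X"
    from s obtain k l d where s: "s = t k l d" "root k l" "f l < f k" "d \<in> ent UNIV Lam k l"
      unfolding root_elements_def by blast
    have sc: "s \<in> carrier G" using s form_absolute by auto
    have comm: "cj s x \<in> generate G ?X" if "cm s x \<in> elementary I Gam" "x \<in> generate G ?X" for x
      using that conjugate_eq_commutator[OF sc, of x] el subgroup.m_closed[OF sg]
        subgroup.mem_carrier[OF sg] by auto
    from x show "cj s x \<in> generate G ?X"
    proof
      assume "x \<in> root_elements I Gam (\<lambda>_ _. True)"
      then obtain p q a where x: "x = t p q a" "root p q" "a \<in> ent I Gam p q"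
        unfolding root_elements_def by blast
      show ?thesis
      proof (cases "opposite_roots p q k l")
        case True
        then obtain d' where d': "d' \<in> ent UNIV Lam q p" "s = t q p d'"
          using opposite_rootsE[OF True form_absolute x(2) s(4)] s(1) by blast
        have "f p < f q"
          using True s(3) f by (auto simp: opposite_roots_def odd_fun_def)
        then show ?thesis
          using conj[of p q a d'] x d' by (simp add: elementary_conjugate_def)
      next
        case False
        then have "\<not> opposite_roots k l p q"
          by (auto simp: opposite_roots_def)
        then have "cm s x \<in> elementary I Gam"
          unfolding s x using s x by (intro absolute_commutator_in_elementary IG)
        moreover have "x \<in> generate G ?X"
          using el t_in_elementary x by blast
        ultimately show ?thesis by (rule comm)
      qed
    next
      assume "x \<in> {elementary_conjugate i j a c | i j a c.
         root i j \<and> f i < f j \<and> a \<in> ent I Gam i j \<and> c \<in> ent UNIV Lam j i}"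
      then obtain p q a c where x: "x = elementary_conjugate p q a c" "root p q" "f p < f q"
        "a \<in> ent I Gam p q" "c \<in> ent UNIV Lam q p" by blast
      show ?thesis
      proof (cases "opposite_roots p q k l")
        case True
        obtain d' where "d' \<in> ent UNIV Lam q p" "cj s x = elementary_conjugate p q a (d' + c)"
          using conjugate_opposite[OF IG x(2,4,5) True s(4)] s(1) x(1) by metis
        then show ?thesis
          using conj[of p q a "d' + c"] x ent_add[OF form_absolute, of q p d' c] by auto
      next
        case False
        then have "\<not> proportional_roots p q k l"
          using s x f by (auto simp: proportional_roots_def opposite_roots_def odd_fun_def)
        then have "cm s x \<in> elementary I Gam"
          unfolding s x using s x by (intro commutator_elementary_conjugate_generic IG)
        then show ?thesis using conj x by (intro comm) auto
      qed
    qed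
  qed
qed

lemma third_index:
  obtains k where "k \<in> Omega n" "k \<noteq> i" "k \<noteq> - i" "k \<noteq> j" "k \<noteq> - j"
proof -
  have "1 \<in> Omega n" "2 \<in> Omega n" "3 \<in> Omega n" using n by (auto simp: Omega_def)
  moreover have "\<exists>k\<in>{1, 2, 3}. k \<noteq> i \<and> k \<noteq> - i \<and> k \<noteq> j \<and> k \<noteq> - j"
    by (rule ccontr) (simp; linarith)
  ultimately show ?thesis using that by auto
qed

lemma nu_mult_eqD: "nu i * x = y \<Longrightarrow> x = bar (nu i) * y"
  by auto

lemma commutator_long_normalized:
  assumes "form I Gam" "form J Del" "a \<in> I" "b \<in> J" "root i j" "i \<noteq> - j"
  shows "cm (t i j (bar (nu i) * a)) (t j (- i) b) =
    t i (- i) (bar (nu i) * (a * b - lam * bar (a * b)))"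
proof -
  have a: "bar (nu i) * a \<in> ent I Gam i j"
    using assms two_sided_ideal_mult_left[OF form_ideal_ideal[OF assms(1)]] by (auto simp: entries_short)
  have b: "b \<in> ent J Del j (- i)" using assms by (auto simp: entries_short)
  let ?x = "bar (nu i) * a * b - sc i (- i) * bar (bar (nu i) * a * b)"
  note c = commutator_long[OF assms(1,2) a b assms(5,6)]
  have "nu i * (bar (nu i) * a * b) = a * b" by (simp add: mult.assoc)
  then have "nu i * ?x = a * b - lam * bar (a * b)" using c(2) by simp
  then have "?x = bar (nu i) * (a * b - lam * bar (a * b))" by (rule nu_mult_eqD)
  then show ?thesis using c(1) by simp
qed

text \<open>The parameters are chosen such that the long root element on the right has the parameter
\<open>b g (bar b)\<close> of the twisted form parameters, up to the factor \<open>\<nu>\<^sub>i\<^bsup>-1\<^esup>\<close> of the entries at \<open>(i, -i)\<close>.\<close>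

lemma commutator_mixed_normalized:
  assumes "form I Gam" "form J Del" "g \<in> Gam" "b \<in> J" "root i k" "i \<noteq> - k"
  shows "cm (t k (- k) (- (bar (nu k) * g))) (t (- k) (- i) (bar b)) =
      t i (- i) (bar (nu i) * (b * g * bar b)) \<otimes> t k (- i) (- (bar (nu k) * (g * bar b)))"
proof -
  have nz: "i \<noteq> 0" "k \<noteq> 0" "i \<noteq> - i" "k \<noteq> - k" using assms Omega_nonzero by auto
  let ?a = "- (bar (nu k) * g)"
  have a: "?a \<in> ent I Gam k (- k)"
    using assms nz by (simp add: entries_long add_subgroup_minus form_ideal_add_subgroup)
  have b: "bar b \<in> ent J Del (- k) (- i)"
    using assms form_ideal_bar by (auto simp: entries_short)
  let ?x = "- (sc (- k) (- i) * bar (bar b) * ?a * bar b)"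
  have "nu i * ?x = - (bar (bar b) * (nu k * ?a) * bar b)"
    using mixed_entry[of k "- i" "bar b" ?a] nz by simp
  then have "nu i * ?x = b * g * bar b" by simp
  then have "?x = bar (nu i) * (b * g * bar b)" by (rule nu_mult_eqD)
  then show ?thesis
    using commutator_mixed(1)[OF assms(1,2) a b] assms by (simp add: mult.assoc)
qed

text \<open>Let \<open>k\<close> be a third index. A short root element is \<open>T\<^sub>i\<^sub>j(d) = [T\<^sub>i\<^sub>k(d), T\<^sub>k\<^sub>j(1)]\<close>, and the coordinate
  \<open>f\<close> of \<open>k\<close> is \<open>0\<close> at \<open>(i, j)\<close>, \<open>-1\<close> at \<open>(i, k)\<close> and \<open>1\<close> at \<open>(k, j)\<close>. A long root element is,
  up to a short one, a commutator \<open>[T\<^sub>k\<^sub>,\<^sub>-\<^sub>k(a), T\<^sub>-\<^sub>k\<^sub>,\<^sub>-\<^sub>i(1)]\<close>, and the same applies with the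
  opposite sign of \<open>f\<close>.\<close>

lemma root_element_decomposition:
  assumes IG: "form I Gam" and ij: "root i j" "d \<in> ent I Gam i j"
  obtains f u u' v where "odd_fun f" "f i = f j" "v \<in> unipotent f UNIV Lam"
    "u \<in> unipotent (\<lambda>m. - f m) I Gam" "u' \<in> unipotent (\<lambda>m. - f m) I Gam"
    "t i j d = u' \<otimes> cj v u"
proof -
  have nz: "i \<noteq> 0" "j \<noteq> 0" "i \<noteq> - i" using ij Omega_nonzero by auto
  obtain k where k: "k \<in> Omega n" "k \<noteq> i" "k \<noteq> - i" "k \<noteq> j" "k \<noteq> - j" by (rule third_index)
  have k0: "k \<noteq> 0" "k \<noteq> - k" using k Omega_nonzero by auto
  show ?thesis
  proof (cases "j = - i")
    case False
    let ?f = "coordinate k"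
    let ?x = "t i k d" and ?y = "t k j 1"
    have d: "d \<in> I" using False ij by (simp add: entries_short)
    have x: "?x \<in> unipotent (\<lambda>m. - ?f m) I Gam"
      using k ij d by (intro t_in_unipotent) (auto simp: coordinate_def entries_short)
    have y: "?y \<in> unipotent ?f UNIV Lam"
      using k ij by (intro t_in_unipotent) (auto simp: coordinate_def entries_short)
    have car: "?x \<in> carrier G" "?y \<in> carrier G"
      using x y unipotent_carrier IG form_absolute by blast+
    have "t i j d = cm ?x ?y"
      using commutator_short[OF IG form_absolute, of d i k 1 j] k ij d False
      by (auto simp: entries_short)
    also have "\<dots> = ?x \<otimes> cj ?y (inv ?x)"
      using car by (simp add: group_commutator_def conjugate_def m_assoc)
    finally have eq: "t i j d = ?x \<otimes> cj ?y (inv ?x)" .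
    show ?thesis
    proof (rule that[OF odd_fun_coordinate[OF k0(1)] _ y _ x eq])
      show "?f i = ?f j" using k ij by (auto simp: coordinate_def)
      show "inv ?x \<in> unipotent (\<lambda>m. - ?f m) I Gam"
        by (rule subgroup.m_inv_closed[OF subgroup_unipotent[OF IG] x])
    qed
  next
    case j: True
    let ?f = "\<lambda>m. - coordinate k m"
    define g where "g = nu i * d"
    have g: "g \<in> Gam" "d = bar (nu i) * g"
      using ij nz by (simp_all add: g_def j entries_long)
    let ?x = "t k (- k) (- (bar (nu k) * g))" and ?y = "t (- k) (- i) 1"
    let ?z = "t k (- i) (- (bar (nu k) * g))"
    have x: "?x \<in> unipotent (\<lambda>m. - ?f m) I Gam"
      using k k0 g form_ideal_add_subgroup[OF IG]
      by (intro t_in_unipotent) (auto simp: coordinate_def entries_long add_subgroup_minus)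
    have y: "?y \<in> unipotent ?f UNIV Lam"
      using k ij k0 by (intro t_in_unipotent) (auto simp: coordinate_def entries_short)
    have "- (bar (nu k) * g) \<in> I"
      by (intro add_subgroup_minus[OF two_sided_ideal_add_subgroup] two_sided_ideal_mult_left
          form_ideal_ideal[OF IG] form_ideal_Gam_I[OF IG] g)
    then have ze: "- (bar (nu k) * g) \<in> ent I Gam k (- i)" using k by (simp add: entries_short)
    then have z: "?z \<in> unipotent (\<lambda>m. - ?f m) I Gam"
      using k ij by (intro t_in_unipotent) (auto simp: coordinate_def)
    have car: "?x \<in> carrier G" "?y \<in> carrier G" "?z \<in> carrier G" "t i (- i) d \<in> carrier G"
      using x y z unipotent_carrier IG form_absolute ij j by (blast intro: t_closed)+
    have "cm ?x ?y = t i (- i) d \<otimes> ?z"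
      using commutator_mixed_normalized[OF IG form_absolute g(1), of 1 i k] k ij g(2) by auto
    moreover have "t i (- i) d \<otimes> ?z = ?z \<otimes> t i (- i) d"
      using k ij nz by (intro t_commute) auto
    moreover have "cm ?x ?y = ?x \<otimes> cj ?y (inv ?x)"
      using car by (simp add: group_commutator_def conjugate_def m_assoc)
    ultimately have "?z \<otimes> t i (- i) d = ?x \<otimes> cj ?y (inv ?x)" by simp
    then have "inv ?z \<otimes> (?z \<otimes> t i (- i) d) = inv ?z \<otimes> (?x \<otimes> cj ?y (inv ?x))" by simp
    then have eq: "t i j d = (inv ?z \<otimes> ?x) \<otimes> cj ?y (inv ?x)"
      using car by (simp add: j m_assoc mult_inv_cancel)
    note sg = subgroup_unipotent[OF IG, of "\<lambda>m. - ?f m"]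
    show ?thesis
    proof (rule that[OF odd_fun_uminus[OF odd_fun_coordinate[OF k0(1)]] _ y _ _ eq])
      show "?f i = ?f j" using k ij by (auto simp: coordinate_def j)
      show "inv ?x \<in> unipotent (\<lambda>m. - ?f m) I Gam" "inv ?z \<otimes> ?x \<in> unipotent (\<lambda>m. - ?f m) I Gam"
        by (rule subgroup.m_inv_closed[OF sg] subgroup.m_closed[OF sg] x z)+
    qed
  qed
qed

lemma t_proportionalE:
  assumes "proportional_roots i j k l" "\<not> opposite_roots i j k l" "root i j" "root k l" "d \<in> ent UNIV Lam k l"
  obtains d' where "d' \<in> ent UNIV Lam i j" "t k l d = t i j d'"
proof -
  have "opposite_roots j i k l"
    using assms by (auto simp: proportional_roots_def opposite_roots_def)
  then show ?thesis
    using opposite_rootsE[OF _ form_absolute _ assms(5), of j i] assms that by auto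
qed

text \<open>Only the case \<open>(k, l) = (i, j)\<close> remains after the preceding lemmas. There \<open>g = T\<^sub>i\<^sub>j(d') T\<^sub>j\<^sub>i(c)\<close> lies in
the parabolic groups of both \<open>f\<close> and \<open>-f\<close>, so that conjugation by \<open>g\<close> preserves the shape of the decomposition of
\<open>T\<^sub>i\<^sub>j(a)\<close>.\<close>

lemma conjugate_group_invariant:
  assumes IG: "form I Gam" and ij: "root i j" "a \<in> ent I Gam i j" "c \<in> ent UNIV Lam j i"
    and kl: "root k l" "d \<in> ent UNIV Lam k l"
  shows "cj (t k l d) (elementary_conjugate i j a c) \<in> conjugate_group I Gam"
proof -
  note sg = subgroup_conjugate_group[OF IG]
  have el: "elementary I Gam \<subseteq> conjugate_group I Gam"
    by (rule elementary_subset_conjugate_group[OF IG])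
  have ji: "root j i" using ij by auto
  consider (opposite) "opposite_roots i j k l" | (generic) "\<not> proportional_roots i j k l" |
    (same) "proportional_roots i j k l" "\<not> opposite_roots i j k l" by blast
  then show ?thesis
  proof cases
    case opposite
    obtain d' where "d' \<in> ent UNIV Lam j i"
      "cj (t k l d) (elementary_conjugate i j a c) = elementary_conjugate i j a (d' + c)"
      by (rule conjugate_opposite[OF IG ij opposite kl(2)])
    then show ?thesis
      using elementary_conjugate_mem[OF ij(1,2)] ent_add[OF form_absolute ji _ ij(3)] by simp
  next
    case generic
    have "elementary_conjugate i j a c \<in> conjugate_group I Gam"
      by (rule elementary_conjugate_mem[OF ij])
    moreover have "cm (t k l d) (elementary_conjugate i j a c) \<in> conjugate_group I Gam"
      using commutator_elementary_conjugate_generic[OF IG ij kl generic] el by blast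
    ultimately show ?thesis
      using conjugate_eq_commutator[OF t_closed[OF form_absolute kl] elementary_conjugate_carrier[OF IG ij]]
        subgroup.m_closed[OF sg] by simp
  next
    case same
    obtain d' where d': "d' \<in> ent UNIV Lam i j" "t k l d = t i j d'"
      by (rule t_proportionalE[OF same ij(1) kl])
    obtain f u u' v where f: "odd_fun f" "f i = f j" and v: "v \<in> unipotent f UNIV Lam"
      and u: "u \<in> unipotent (\<lambda>m. - f m) I Gam" "u' \<in> unipotent (\<lambda>m. - f m) I Gam"
      and eq: "t i j a = u' \<otimes> cj v u"
      by (rule root_element_decomposition[OF IG ij(1,2)])
    define g where "g = t i j d' \<otimes> t j i c"
    have car: "t i j d' \<in> carrier G" "t j i c \<in> carrier G" "t i j a \<in> carrier G"
      by (rule t_closed[OF form_absolute ij(1) d'(1)] t_closed[OF form_absolute ji ij(3)]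
          t_closed[OF IG ij(1,2)])+
    have gp: "g \<in> parabolic f'" if "f' i = f' j" for f'
      unfolding g_def using that ij d'(1)
      by (intro subgroup.m_closed[OF subgroup_parabolic] t_in_parabolic) auto
    have g: "g \<in> parabolic f" "g \<in> parabolic (\<lambda>m. - f m)" using f(2) gp[of f] gp[of "\<lambda>m. - f m"] by simp_all
    have gc: "g \<in> carrier G" using car by (simp add: g_def)
    have uvc: "u \<in> carrier G" "u' \<in> carrier G" "v \<in> carrier G"
      using u v unipotent_carrier IG form_absolute by blast+
    have "cj (t k l d) (elementary_conjugate i j a c) = cj g (t i j a)"
      unfolding elementary_conjugate_def d'(2) g_def using car by (simp add: conjugate_conjugate)
    also have "\<dots> = cj g u' \<otimes> cj (cj g v) (cj g u)"
      unfolding eq conjugate_conjugate_commute[OF gc uvc(3,1), symmetric]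
      using uvc gc by (simp add: conjugate_mult)
    also have "\<dots> \<in> conjugate_group I Gam"
    proof (rule subgroup.m_closed[OF sg])
      have "cj g u' \<in> unipotent (\<lambda>m. - f m) I Gam" "cj g u \<in> unipotent (\<lambda>m. - f m) I Gam"
        by (rule parabolic_normalizes_unipotent[OF IG odd_fun_uminus[OF f(1)] g(2)] u)+
      then have gu: "cj g u' \<in> elementary I Gam" "cj g u \<in> elementary I Gam"
        using unipotent_subset_elementary by blast+
      then show "cj g u' \<in> conjugate_group I Gam" using el by blast
      have "elementary I Gam \<subseteq> negative_conjugate_group f I Gam"
        unfolding elementary_def negative_conjugate_group_def by (rule mono_generate) blast
      then have "cj (cj g v) (cj g u) \<in> negative_conjugate_group f I Gam"
        by (intro unipotent_normalizes_negative[OF IG f(1)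
              parabolic_normalizes_unipotent[OF form_absolute f(1) g(1) v]] subsetD[OF _ gu(2)])
      then show "cj (cj g v) (cj g u) \<in> conjugate_group I Gam"
        using negative_conjugate_group_subset[OF IG] by blast
    qed
    finally show ?thesis .
  qed
qed

lemma carrier_generate: "carrier G = generate G (root_elements UNIV Lam (\<lambda>_ _. True))"
  unfolding t_generate root_elements_def by (rule arg_cong[of _ _ "generate G"]) auto

lemma normal_generate_if_t_invariant:
  assumes A: "A \<subseteq> carrier G"
    and "\<And>k l d x. root k l \<Longrightarrow> d \<in> ent UNIV Lam k l \<Longrightarrow> x \<in> A \<Longrightarrow> cj (t k l d) x \<in> generate G A"
  shows "generate G A \<lhd> G"
  unfolding normal_inv_iff
proof (intro conjI ballI)
  show "subgroup (generate G A) G" by (rule generate_is_subgroup[OF A])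
  fix g x assume g: "g \<in> carrier G" and x: "x \<in> generate G A"
  have "cj g x \<in> generate G A"
  proof (rule generate_conjugate_closed[OF root_elements_carrier[OF form_absolute]
        root_elements_inv[OF form_absolute] A _ _ x])
    show "g \<in> generate G (root_elements UNIV Lam (\<lambda>_ _. True))" using g carrier_generate by simp
    show "cj s x \<in> generate G A" if "s \<in> root_elements UNIV Lam (\<lambda>_ _. True)" "x \<in> A" for s x
      using that assms(2) unfolding root_elements_def by blast
  qed
  then show "g \<otimes> x \<otimes> inv g \<in> generate G A" by (simp add: conjugate_def)
qed

theorem normal_conjugate_group:
  assumes "form I Gam"
  shows "conjugate_group I Gam \<lhd> G"
  unfolding conjugate_group_def
proof (rule normal_generate_if_t_invariant[OF conjugate_group_generators_carrier[OF assms]])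
  fix k l d x assume *: "root k l" "d \<in> ent UNIV Lam k l"
    and "x \<in> {elementary_conjugate i j a c | i j a c. root i j \<and> a \<in> ent I Gam i j \<and> c \<in> ent UNIV Lam j i}"
  then obtain i j a c where x: "x = elementary_conjugate i j a c" and
    ij: "root i j" "a \<in> ent I Gam i j" "c \<in> ent UNIV Lam j i" by blast
  show "cj (t k l d) x \<in> generate G {elementary_conjugate i j a c | i j a c.
      root i j \<and> a \<in> ent I Gam i j \<and> c \<in> ent UNIV Lam j i}"
    unfolding x by (rule conjugate_group_invariant[OF assms ij *, unfolded conjugate_group_def])
qed

lemma conjugate_group_least:
  assumes "form I Gam" "N \<lhd> G" "\<And>p q a. root p q \<Longrightarrow> a \<in> ent I Gam p q \<Longrightarrow> t p q a \<in> N"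
  shows "conjugate_group I Gam \<subseteq> N"
  unfolding conjugate_group_def
proof (rule generate_subgroup_incl[OF _ normal_imp_subgroup[OF assms(2)]], safe)
  fix i j a c assume "i \<in> Omega n" "j \<in> Omega n" "i \<noteq> j" "a \<in> ent I Gam i j" "c \<in> ent UNIV Lam j i"
  then show "elementary_conjugate i j a c \<in> N"
    unfolding elementary_conjugate_def
    using t_closed[OF form_absolute, of j i c] assms(3)[of i j a]
    by (auto intro: normal_conjugate[OF assms(2)])
qed

lemma t_in_conjugate_group:
  "form I Gam \<Longrightarrow> root p q \<Longrightarrow> a \<in> ent I Gam p q \<Longrightarrow> t p q a \<in> conjugate_group I Gam"
  using elementary_subset_conjugate_group t_in_elementary by blast

end


section \<open>The level is contained in the commutator subgroup\<close>

locale relative_commutator =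
  elementary_relations G bar lam Lam n t + two_form_ideals bar lam Lam I Gam J Del
  for G (structure) and bar :: "'a::{ring,monoid_mult} \<Rightarrow> 'a" and lam Lam n t I Gam J Del
begin

text \<open>Since \<open>conjugate_group I Gam\<close> is the relative elementary group, \<open>mutual\<close> is the commutator subgroup to be
generated and \<open>level\<close> is the relative elementary group of the symmetrised product.\<close>

definition mutual :: "'b set" where
  "mutual = commutator_subgroup G (conjugate_group I Gam) (conjugate_group J Del)"

definition level :: "'b set" where
  "level = conjugate_group K Theta"

definition elementary_commutator :: "int \<Rightarrow> int \<Rightarrow> 'a \<Rightarrow> 'a \<Rightarrow> 'b" where
  "elementary_commutator i j a b = cm (t i j a) (t j i b)"

lemma normal_level: "level \<lhd> G"
  unfolding level_def by (rule normal_conjugate_group[OF form_ideal_Theta])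

lemma subgroup_level: "subgroup level G"
  by (rule normal_imp_subgroup[OF normal_level])

lemma normal_mutual: "mutual \<lhd> G"
  unfolding mutual_def by (intro normal_commutator_subgroup normal_conjugate_group IG JD)

lemma subgroup_mutual: "subgroup mutual G"
  by (rule normal_imp_subgroup[OF normal_mutual])

lemma mutual_mem:
  assumes "x \<in> conjugate_group I Gam" "y \<in> conjugate_group J Del"
  shows "cm x y \<in> mutual" "cm y x \<in> mutual"
proof -
  show "cm x y \<in> mutual"
    unfolding mutual_def commutator_subgroup_def using assms by (intro generate.incl) blast
  then show "cm y x \<in> mutual"
    using assms normal_subset[OF normal_conjugate_group[OF IG]]
      normal_subset[OF normal_conjugate_group[OF JD]]
    by (intro commutator_mem_swap[OF subgroup_mutual, of x y]) auto
qed

lemma mutual_root_elements: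
  assumes "root i j" "root k l" "a \<in> ent I Gam i j" "b \<in> ent J Del k l"
  shows "cm (t i j a) (t k l b) \<in> mutual" "cm (t k l b) (t i j a) \<in> mutual"
  by (rule mutual_mem[OF t_in_conjugate_group[OF IG assms(1,3)] t_in_conjugate_group[OF JD assms(2,4)]])+

lemma add_subgroup_parameters:
  assumes "subgroup M G" "root i j" "add_subgroup S" "S \<subseteq> ent UNIV Lam i j"
  shows "add_subgroup {x \<in> S. t i j x \<in> M}"
  unfolding add_subgroup_def
proof (intro conjI ballI)
  note S = assms(3)
  show "0 \<in> {x \<in> S. t i j x \<in> M}"
    using assms add_subgroup_zero[OF S] subgroup.one_closed[OF assms(1)] by (simp add: t_zero)
  fix x assume x: "x \<in> {x \<in> S. t i j x \<in> M}"
  have "inv (t i j x) = t i j (- x)"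
    using assms x by (intro t_uminus[OF form_absolute, symmetric]) auto
  then show "- x \<in> {x \<in> S. t i j x \<in> M}"
    using x add_subgroup_minus[OF S] subgroup.m_inv_closed[OF assms(1), of "t i j x"] by simp
  fix y assume "y \<in> {x \<in> S. t i j x \<in> M}"
  then show "x + y \<in> {x \<in> S. t i j x \<in> M}"
    using x add_subgroup_add[OF S] subgroup.m_closed[OF assms(1), of "t i j x" "t i j y"] assms(2)
    by (simp add: t_add)
qed

lemma short_root_element_mutual:
  assumes ij: "root i j" "i \<noteq> - j" and x: "x \<in> K"
  shows "t i j x \<in> mutual"
proof -
  obtain k where k: "k \<in> Omega n" "k \<noteq> i" "k \<noteq> - i" "k \<noteq> j" "k \<noteq> - j" by (rule third_index)
  have "add_subgroup {x \<in> UNIV. t i j x \<in> mutual}"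
    using ij by (intro add_subgroup_parameters subgroup_mutual)
      (auto simp: entries_short add_subgroup_def)
  then have "K \<subseteq> {x \<in> UNIV. t i j x \<in> mutual}"
  proof (rule K_subset)
    fix a b assume ab: "a \<in> I" "b \<in> J"
    have "t i j (a * b) = cm (t i k a) (t k j b)"
      using k ij ab by (intro commutator_short[OF IG JD, symmetric]) (auto simp: entries_short)
    moreover have "t i j (b * a) = cm (t i k b) (t k j a)"
      using k ij ab by (intro commutator_short[OF JD IG, symmetric]) (auto simp: entries_short)
    moreover have "cm (t i k a) (t k j b) \<in> mutual"
      by (rule mutual_root_elements(1)) (use k ij ab in \<open>auto simp: entries_short\<close>)
    moreover have "cm (t i k b) (t k j a) \<in> mutual"
      by (rule mutual_root_elements(2)) (use k ij ab in \<open>auto simp: entries_short\<close>)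
    ultimately show "a * b \<in> {x \<in> UNIV. t i j x \<in> mutual}" "b * a \<in> {x \<in> UNIV. t i j x \<in> mutual}"
      by simp_all
  qed
  then show ?thesis using x by blast
qed

text \<open>\<open>\<Theta>\<close> is generated by traces and by twists \<open>b g (bar b)\<close>. The former are parameters of commutators of two
short root elements. For the latter, the commutator of a long and a short root element is a product of the wanted
long root element and a short one with parameter in \<open>K\<close>; the commutator is in the commutator subgroup
because one of its entries is (for the twists of the absolute form parameter) or because its entries have the
two given levels.\<close>

lemma long_root_element_mutual:
  assumes i: "i \<in> Omega n" and g: "g \<in> Theta"
  shows "t i (- i) (bar (nu i) * g) \<in> mutual"
proof -
  obtain k where k: "k \<in> Omega n" "k \<noteq> i" "k \<noteq> - i" by (rule third_index)
  have nz: "i \<noteq> 0" "i \<noteq> - i" "k \<noteq> 0" "k \<noteq> - k" using i k Omega_nonzero by auto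
  have ki: "root k (- i)" "k \<noteq> - (- i)" and ik: "root i k" "i \<noteq> - k" using k i by auto
  let ?S = "{g \<in> Lam. t i (- i) (bar (nu i) * g) \<in> mutual}"
  have S: "add_subgroup ?S"
  proof -
    have "add_subgroup {x \<in> ent UNIV Lam i (- i). t i (- i) x \<in> mutual}"
      using i nz by (intro add_subgroup_parameters subgroup_mutual add_subgroup_entries form_absolute) auto
    from add_subgroup_vimage[OF this, of "\<lambda>g. bar (nu i) * g"]
    show ?thesis using nz by (simp add: entries_long distrib_left)
  qed
  have mixed: "b * g * bar b \<in> ?S"
    if "form I' Gam'" "form J' Del'" "g \<in> Gam'" "b \<in> J'" "g * bar b \<in> K"
      and c: "cm (t k (- k) (- (bar (nu k) * g))) (t (- k) (- i) (bar b)) \<in> mutual"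
    for I' Gam' J' Del' g b
  proof -
    have gL: "b * g * bar b \<in> Lam" using that form_ideal_Gam_Lam Lam_mult by blast
    have "- (bar (nu k) * (g * bar b)) \<in> K"
      by (rule add_subgroup_minus[OF two_sided_ideal_add_subgroup[OF K_ideal]
            two_sided_ideal_mult_left[OF K_ideal that(5)]])
    then have "t k (- i) (- (bar (nu k) * (g * bar b))) \<in> mutual" (is "?z \<in> _")
      using ki by (intro short_root_element_mutual) auto
    moreover have "t i (- i) (bar (nu i) * (b * g * bar b)) \<in> carrier G" (is "?y \<in> _")
      using gL i nz by (intro t_closed[OF form_absolute]) (auto simp: entries_long)
    moreover have "?y \<otimes> ?z \<in> mutual"
      using c commutator_mixed_normalized[OF that(1-4) ik] by simp
    ultimately have "?y \<in> mutual"
      using subgroup.m_closed[OF subgroup_mutual, of "?y \<otimes> ?z" "inv ?z"]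
        subgroup.m_inv_closed[OF subgroup_mutual, of ?z] subgroup.mem_carrier[OF subgroup_mutual, of ?z]
      by (simp add: m_assoc)
    then show ?thesis using gL by simp
  qed
  have entk: "- (bar (nu k) * g) \<in> ent I' Gam' k (- k)" if "form I' Gam'" "g \<in> Gam'" for I' Gam' g
    using that nz add_subgroup_minus[OF form_ideal_add_subgroup[OF that(1)]] by (simp add: entries_long)
  have rk: "root k (- k)" "root (- k) (- i)" using k i nz by auto
  have "Theta \<subseteq> ?S"
  proof (rule Theta_subset[OF S])
    fix x assume x: "x \<in> K"
    have "K \<subseteq> {x. x - lam * bar x \<in> ?S}"
    proof (rule K_subset)
      show "add_subgroup {x. x - lam * bar x \<in> ?S}"
        by (rule add_subgroup_vimage[OF S]) (simp_all add: bar_add bar_minus distrib_left)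
      fix a b assume ab: "a \<in> I" "b \<in> J"
      have "bar (nu i) * a \<in> I" "bar (nu i) * b \<in> J"
        using ab IG JD by (auto intro: two_sided_ideal_mult_left form_ideal_ideal)
      note ab' = this ab
      have "cm (t i k (bar (nu i) * a)) (t k (- i) b) \<in> mutual"
        by (rule mutual_root_elements(1)) (use ab' ik ki in \<open>auto simp: entries_short\<close>)
      moreover have "cm (t i k (bar (nu i) * b)) (t k (- i) a) \<in> mutual"
        by (rule mutual_root_elements(2)) (use ab' ik ki in \<open>auto simp: entries_short\<close>)
      ultimately show "a * b \<in> {x. x - lam * bar x \<in> ?S}" "b * a \<in> {x. x - lam * bar x \<in> ?S}"
        using commutator_long_normalized[OF IG JD ab ik] commutator_long_normalized[OF JD IG ab(2,1) ik]
        by (simp_all add: Lam_min)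
    qed
    then show "x - lam * bar x \<in> ?S" using x by blast
  next
    fix x c assume xc: "x \<in> K" "c \<in> Lam"
    have "t (- k) (- i) (bar x) \<in> mutual"
      using rk ik xc bar_K by (intro short_root_element_mutual) auto
    then have "cm (t k (- k) (- (bar (nu k) * c))) (t (- k) (- i) (bar x)) \<in> mutual"
      by (rule normal_commutator[OF normal_mutual _ t_closed[OF form_absolute rk(1)
            entk[OF form_absolute xc(2)]]])
    moreover have "c * bar x \<in> K"
      by (intro two_sided_ideal_mult_left[OF K_ideal] bar_K xc)
    ultimately show "x * c * bar x \<in> ?S"
      using mixed[OF form_absolute form_ideal_Theta xc(2,1)] by blast
  next
    fix b g assume bg: "b \<in> J" "g \<in> Gam"
    have "bar b \<in> ent J Del (- k) (- i)"
      using bg ki form_ideal_bar[OF JD] by (auto simp: entries_short)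
    from mutual_root_elements(1)[OF rk entk[OF IG bg(2)] this]
    show "b * g * bar b \<in> ?S"
      by (rule mixed[OF IG JD bg(2,1) K_products(1)[OF form_ideal_Gam_I[OF IG bg(2)]
              form_ideal_bar[OF JD bg(1)]]])
  next
    fix a d assume ad: "a \<in> I" "d \<in> Del"
    have "bar a \<in> ent I Gam (- k) (- i)"
      using ad ki form_ideal_bar[OF IG] by (auto simp: entries_short)
    from mutual_root_elements(2)[OF rk(2,1) this entk[OF JD ad(2)]]
    show "a * d * bar a \<in> ?S"
      by (rule mixed[OF JD IG ad(2,1) K_products(2)[OF form_ideal_bar[OF IG ad(1)]
              form_ideal_Gam_I[OF JD ad(2)]]])
  qed
  then show ?thesis using g by blast
qed

lemma level_subset_mutual: "level \<subseteq> mutual"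
  unfolding level_def
proof (rule conjugate_group_least[OF form_ideal_Theta normal_mutual])
  fix p q x assume pq: "root p q" "x \<in> ent K Theta p q"
  show "t p q x \<in> mutual"
  proof (cases "q = - p")
    case True
    then have "nu p * x \<in> Theta" using pq Omega_nonzero by (simp add: entries_long)
    then have "t p (- p) (bar (nu p) * (nu p * x)) \<in> mutual"
      using pq by (intro long_root_element_mutual) auto
    then show ?thesis using True by simp
  next
    case False
    then show ?thesis
      using pq by (intro short_root_element_mutual) (auto simp: entries_short)
  qed
qed


section \<open>Elementary commutators modulo the level\<close>

lemma commuting_mod_level:
  assumes "\<And>i j k l. root i j \<Longrightarrow> root k l \<Longrightarrow> P i j \<Longrightarrow> Q k l \<Longrightarrow> \<not> opposite_roots i j k l"
    and "p \<in> generate G (root_elements I Gam P)" "q \<in> generate G (root_elements J Del Q)"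
  shows "cm p q \<in> level"
proof (rule generate_commuting_mod[OF normal_level root_elements_carrier[OF IG]
      root_elements_carrier[OF JD] _ assms(2,3)])
  fix x y assume "x \<in> root_elements I Gam P" "y \<in> root_elements J Del Q"
  then obtain i j a k l b where "x = t i j a" "root i j" "P i j" "a \<in> ent I Gam i j"
    "y = t k l b" "root k l" "Q k l" "b \<in> ent J Del k l"
    unfolding root_elements_def by blast
  then have "cm x y \<in> elementary K Theta"
    using commutator_in_elementary[OF IG JD] assms(1) by blast
  then show "cm x y \<in> level"
    unfolding level_def using elementary_subset_conjugate_group[OF form_ideal_Theta] by blast
qed

lemma elementary_commutator_carrier:
  assumes "root i j" "a \<in> ent I Gam i j" "b \<in> ent J Del j i"
  shows "elementary_commutator i j a b \<in> carrier G"
  unfolding elementary_commutator_def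
  using t_closed[OF IG assms(1,2)] t_closed[OF JD _ assms(3)] assms(1) by auto

text \<open>Take \<open>f\<close> vanishing at \<open>(i, j)\<close> and positive at \<open>(k, l)\<close>. Conjugation multiplies \<open>T\<^sub>i\<^sub>j(a)\<close> and \<open>T\<^sub>j\<^sub>i(b)\<close> by
elements \<open>p\<close> and \<open>q\<close> of the unipotent group of \<open>f\<close>. Modulo the level these commute with each other and with
\<open>T\<^sub>j\<^sub>i(b)\<close> and \<open>T\<^sub>i\<^sub>j(a)\<close> respectively, as no opposite roots are involved.\<close>

lemma elementary_commutator_generic_invariant:
  assumes ij: "root i j" "a \<in> ent I Gam i j" "b \<in> ent J Del j i"
    and kl: "root k l" "d \<in> ent UNIV Lam k l" and np: "\<not> proportional_roots i j k l"
  shows "congruent_mod level (cj (t k l d) (elementary_commutator i j a b)) (elementary_commutator i j a b)"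
proof -
  have "i \<noteq> 0" "j \<noteq> 0" "k \<noteq> 0" "l \<noteq> 0" using ij kl by auto
  then obtain f where f: "odd_fun f" "f i = f j" "f l < f k"
    using generic_functional[OF _ _ _ _ _ _ np] ij(1) kl(1) by auto
  have ji: "root j i" using ij by auto
  define p where "p = cm (t i j (- a)) (t k l d)"
  define q where "q = cm (t j i (- b)) (t k l d)"
  have ma: "- a \<in> ent I Gam i j" "- b \<in> ent J Del j i"
    by (rule ent_uminus[OF IG ij(1,2)] ent_uminus[OF JD ji ij(3)])+
  have car: "t i j a \<in> carrier G" "t j i b \<in> carrier G" "t k l d \<in> carrier G"
    "t i j (- a) \<in> carrier G" "t j i (- b) \<in> carrier G"
    by (rule t_closed[OF IG ij(1,2)] t_closed[OF JD ji ij(3)] t_closed[OF form_absolute kl]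
        t_closed[OF IG ij(1) ma(1)] t_closed[OF JD ji ma(2)])+
  have u: "t k l d \<in> unipotent f UNIV Lam" using kl f by (intro t_in_unipotent)
  have p: "p \<in> unipotent f I Gam"
    unfolding p_def
    by (rule commutator_mem_swap[OF subgroup_unipotent[OF IG] car(3,4)
          unipotent_commutator_level[OF IG f(1,2) ij(1) ma(1) u]])
  have q: "q \<in> unipotent f J Del"
    unfolding q_def
    by (rule commutator_mem_swap[OF subgroup_unipotent[OF JD] car(3,5)
          unipotent_commutator_level[OF JD f(1) f(2)[symmetric] ji ma(2) u]])
  have pqc: "p \<in> carrier G" "q \<in> carrier G"
    using p q unipotent_carrier IG JD by blast+
  have nonneg: "t i j a \<in> generate G (root_elements I Gam (\<lambda>p q. f q \<le> f p))"
    "t j i b \<in> generate G (root_elements J Del (\<lambda>p q. f q \<le> f p))"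
    using ij ji f by (auto intro!: t_in_generate)
  have no: "\<not> opposite_roots i j k l"
    if "f j \<le> f i" "f l \<le> f k" "f j < f i \<or> f l < f k" for i j k l
    using that f(1) by (auto simp: opposite_roots_def odd_fun_def)
  have "cj (t k l d) (t i j a) = t i j a \<otimes> p" "cj (t k l d) (t j i b) = t j i b \<otimes> q"
    unfolding p_def q_def t_uminus[OF IG ij(1,2)] t_uminus[OF JD ji ij(3)]
    using car by (simp_all add: conjugate_eq_mult_commutator)
  then have eq: "cj (t k l d) (elementary_commutator i j a b) = cm (t i j a \<otimes> p) (t j i b \<otimes> q)"
    unfolding elementary_commutator_def using car by (simp add: conjugate_commutator)
  have "cm p (t j i b) \<in> level"
    by (rule commuting_mod_level[OF _ p[unfolded unipotent_def] nonneg(2)]) (rule no; simp)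
  moreover have "cm p q \<in> level"
    by (rule commuting_mod_level[OF _ p[unfolded unipotent_def] q[unfolded unipotent_def]]) (rule no; simp)
  moreover have "cm (t i j a) q \<in> level"
    by (rule commuting_mod_level[OF _ nonneg(1) q[unfolded unipotent_def]]) (rule no; simp)
  ultimately have "cm (t i j a \<otimes> p) (t j i b \<otimes> q) \<otimes> inv (cm (t i j a) (t j i b)) \<in> level"
    using car pqc by (intro commutator_mod_absorb[OF normal_level])
  then show ?thesis
    unfolding congruent_mod_def eq using car pqc by (simp add: elementary_commutator_def)
qed

lemma weyl_invariant:
  assumes ij: "root i j" "a \<in> ent I Gam i j" "b \<in> ent J Del j i"
    and kl: "root k l" "k \<noteq> - l" and np: "\<not> proportional_roots i j k l"
  shows "congruent_mod level (cj (t k l 1 \<otimes> (t l k (- 1) \<otimes> t k l 1)) (elementary_commutator i j a b))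
    (elementary_commutator i j a b)"
proof -
  let ?y = "elementary_commutator i j a b"
  have lk: "root l k" "\<not> proportional_roots i j l k"
    using kl np by (auto simp: proportional_roots_def)
  have e: "1 \<in> ent UNIV Lam k l" "- 1 \<in> ent UNIV Lam l k" using kl by (auto simp: entries_short)
  have car: "t k l 1 \<in> carrier G" "t l k (- 1) \<in> carrier G" "?y \<in> carrier G"
    by (rule t_closed[OF form_absolute kl(1) e(1)] t_closed[OF form_absolute lk(1) e(2)]
        elementary_commutator_carrier[OF ij])+
  have 1: "congruent_mod level (cj (t k l 1) ?y) ?y"
    and 2: "congruent_mod level (cj (t l k (- 1)) ?y) ?y"
    by (rule elementary_commutator_generic_invariant[OF ij kl(1) e(1) np]
        elementary_commutator_generic_invariant[OF ij lk(1) e(2) lk(2)])+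
  note trans = congruent_mod_trans[OF subgroup_level]
  note conj = congruent_mod_conjugate[OF normal_level]
  have "congruent_mod level (cj (t l k (- 1)) (cj (t k l 1) ?y)) ?y"
    by (rule trans[OF conj[OF car(2) 1] 2])
  from trans[OF conj[OF car(1) this] 1] show ?thesis
    using car by (simp add: conjugate_conjugate)
qed

text \<open>The Weyl element of \<open>(k, j)\<close> carries one elementary commutator to the other and is a product of root elements not
proportional to \<open>(i, k)\<close>.\<close>

lemma elementary_commutator_change_short:
  assumes "root i k" "i \<noteq> - k" and j: "j \<in> Omega n" "j \<noteq> i" "j \<noteq> - i" "j \<noteq> k" "j \<noteq> - k"
    and ab: "a \<in> I" "b \<in> J"
  shows "congruent_mod level (elementary_commutator i j (- a) (- b)) (elementary_commutator i k a b)"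
proof -
  let ?w = "t k j 1 \<otimes> (t j k (- 1) \<otimes> t k j 1)"
  have r: "root k j" "root j k" "root k i" "root i j" "root j i" using assms by auto
  have mab: "- a \<in> I" "- b \<in> J"
    using ab IG JD by (auto intro: add_subgroup_minus two_sided_ideal_add_subgroup form_ideal_ideal)
  have w: "t k j 1 \<in> carrier G" "t j k (- 1) \<in> carrier G"
    using r j by (auto intro!: t_closed[OF form_absolute] simp: entries_short)
  have car: "t i k a \<in> carrier G" "t k i b \<in> carrier G" "t i j (- a) \<in> carrier G" "t j i (- b) \<in> carrier G"
    by (rule t_closed[OF IG] t_closed[OF JD]; use r assms mab in \<open>simp add: entries_short\<close>)+
  have "cj ?w (t i k a) = t i j (- a)" "cj ?w (t k i b) = t j i (- b)"
    using w car assms by (auto intro!: conjugate_eqI t_weyl_short)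
  then have "cj ?w (elementary_commutator i k a b) = elementary_commutator i j (- a) (- b)"
    unfolding elementary_commutator_def using w car by (simp add: conjugate_commutator)
  moreover have "congruent_mod level (cj ?w (elementary_commutator i k a b)) (elementary_commutator i k a b)"
    using assms by (intro weyl_invariant)
      (auto simp: entries_short proportional_roots_def opposite_roots_def)
  ultimately show ?thesis by simp
qed

lemma elementary_commutator_change_long:
  assumes i: "i \<in> Omega n" and k: "k \<in> Omega n" "k \<noteq> i" "k \<noteq> - i"
    and ab: "a \<in> ent I Gam i (- i)" "b \<in> ent J Del (- i) i"
  shows "congruent_mod level (elementary_commutator k (- k) (a * sc k i) (sc i k * b))
      (elementary_commutator i (- i) a b)"
    and "a * sc k i \<in> ent I Gam k (- k)" "sc i k * b \<in> ent J Del (- k) k"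
proof -
  let ?w = "t k i 1 \<otimes> (t i k (- 1) \<otimes> t k i 1)"
  have nz: "i \<noteq> 0" "i \<noteq> - i" "k \<noteq> 0" "k \<noteq> - k" using i k Omega_nonzero by auto
  have "sc k i = bar (nu k) * nu i" unfolding sc_def by (rule nu_commute)
  then have ka: "nu k * (a * sc k i) = nu i * a"
    unfolding sc_commute[of k i a, symmetric] by (simp add: mult.assoc)
  then show a': "a * sc k i \<in> ent I Gam k (- k)"
    using ab nz by (simp add: entries_long)
  have "sc i k = sc (- k) (- i)" using nz by (simp add: sc_uminus)
  also have "\<dots> = bar (nu (- k)) * nu (- i)" unfolding sc_def by (rule nu_commute)
  finally have "nu (- k) * (sc i k * b) = nu (- i) * b" by (simp add: mult.assoc)
  then show b': "sc i k * b \<in> ent J Del (- k) k"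
    using ab nz entries_long[of "- k" _ J Del] entries_long[of "- i" _ J Del] by simp
  have w: "t k i 1 \<in> carrier G" "t i k (- 1) \<in> carrier G"
    using i k by (auto intro!: t_closed[OF form_absolute] simp: entries_short)
  have car: "t i (- i) a \<in> carrier G" "t (- i) i b \<in> carrier G"
    "t k (- k) (a * sc k i) \<in> carrier G" "t (- k) k (sc i k * b) \<in> carrier G"
    by (rule t_closed[OF IG _ ab(1)] t_closed[OF JD _ ab(2)] t_closed[OF IG _ a'] t_closed[OF JD _ b'];
        use i k nz in simp)+
  have "cj ?w (t i (- i) a) = t k (- k) (a * sc k i)" "cj ?w (t (- i) i b) = t (- k) k (sc i k * b)"
    using w car i k by (auto intro!: conjugate_eqI t_weyl_long)
  then have "cj ?w (elementary_commutator i (- i) a b) =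
      elementary_commutator k (- k) (a * sc k i) (sc i k * b)"
    unfolding elementary_commutator_def using w car by (simp add: conjugate_commutator)
  moreover have "congruent_mod level (cj ?w (elementary_commutator i (- i) a b)) (elementary_commutator i (- i) a b)"
    using i k nz ab by (intro weyl_invariant) (auto simp: proportional_roots_def opposite_roots_def)
  ultimately show "congruent_mod level (elementary_commutator k (- k) (a * sc k i) (sc i k * b))
      (elementary_commutator i (- i) a b)" by simp
qed

text \<open>If the roots of \<open>(i, j)\<close> and \<open>(k, l)\<close> are proportional, replace the elementary commutator by a congruent
  one at a third index, whose root is not proportional to that of \<open>(k, l)\<close>.\<close>

lemma elementary_commutator_central:
  assumes ij: "root i j" "a \<in> ent I Gam i j" "b \<in> ent J Del j i"
    and kl: "root k l" "d \<in> ent UNIV Lam k l"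
  shows "congruent_mod level (cj (t k l d) (elementary_commutator i j a b)) (elementary_commutator i j a b)"
proof (cases "proportional_roots i j k l")
  case False
  then show ?thesis by (intro elementary_commutator_generic_invariant ij kl)
next
  case proportional: True
  let ?y = "elementary_commutator i j a b"
  obtain m where m: "m \<in> Omega n" "m \<noteq> i" "m \<noteq> - i" "m \<noteq> j" "m \<noteq> - j" by (rule third_index)
  have nz: "i \<noteq> - i" "m \<noteq> - m" "j \<noteq> - j" using ij m by (auto simp: Omega_neq_uminus)
  have "\<exists>i' j' a' b'. root i' j' \<and> a' \<in> ent I Gam i' j' \<and> b' \<in> ent J Del j' i' \<and>
    \<not> proportional_roots i' j' k l \<and> congruent_mod level (elementary_commutator i' j' a' b') ?y"
  proof (cases "j = - i")
    case True
    have "\<not> proportional_roots m (- m) k l"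
      using proportional m nz True by (auto simp: proportional_roots_def opposite_roots_def)
    then show ?thesis
      using elementary_commutator_change_long[of i m a b] ij m nz unfolding True
      by (intro exI[of _ m] exI[of _ "- m"] exI[of _ "a * sc m i"] exI[of _ "sc i m * b"]) simp
  next
    case False
    have "\<not> proportional_roots i m k l"
      using proportional m nz False ij by (auto simp: proportional_roots_def opposite_roots_def)
    moreover have "congruent_mod level (elementary_commutator i m (- a) (- b)) ?y"
      using ij m False by (intro elementary_commutator_change_short) (auto simp: entries_short)
    moreover have "- a \<in> I" "- b \<in> J"
      using ent_uminus[OF IG ij(1,2)] ent_uminus[OF JD _ ij(3)] ij False by (auto simp: entries_short)
    ultimately show ?thesis
      using ij m by (intro exI[of _ i] exI[of _ m] exI[of _ "- a"] exI[of _ "- b"]) (auto simp: entries_short)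
  qed
  then obtain i' j' a' b' where *: "root i' j'" "a' \<in> ent I Gam i' j'" "b' \<in> ent J Del j' i'"
    "\<not> proportional_roots i' j' k l" "congruent_mod level (elementary_commutator i' j' a' b') ?y" by blast
  note sym = congruent_mod_sym[OF subgroup_level] and trans = congruent_mod_trans[OF subgroup_level]
  have "congruent_mod level (cj (t k l d) (elementary_commutator i' j' a' b')) (cj (t k l d) ?y)"
    by (rule congruent_mod_conjugate[OF normal_level t_closed[OF form_absolute kl] *(5)])
  moreover have "congruent_mod level (cj (t k l d) (elementary_commutator i' j' a' b')) (elementary_commutator i' j' a' b')"
    by (rule elementary_commutator_generic_invariant[OF *(1-3) kl *(4)])
  ultimately show ?thesis using *(5) sym trans by blast
qed

end


section \<open>Generation of the commutator subgroup\<close>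

context relative_commutator
begin

definition conjugate_generators :: "'b set" where
  "conjugate_generators =
     {elementary_conjugate i j (a * b) c | i j a b c.
        i \<in> Omega n \<and> j \<in> Omega n \<and> i \<noteq> j \<and> i \<noteq> - j \<and> a \<in> I \<and> b \<in> J} \<union>
     {elementary_conjugate i j (b * a) c | i j a b c.
        i \<in> Omega n \<and> j \<in> Omega n \<and> i \<noteq> j \<and> i \<noteq> - j \<and> a \<in> I \<and> b \<in> J} \<union>
     {elementary_conjugate i (- i) x c | i x c. i \<in> Omega n \<and>
        x \<in> ent K Theta i (- i) \<and> c \<in> ent UNIV Lam (- i) i}"

definition commutators_at :: "int \<Rightarrow> int \<Rightarrow> 'b set" where
  "commutators_at i j = {elementary_commutator i j a b | a b. a \<in> ent I Gam i j \<and> b \<in> ent J Del j i}"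

lemma conjugate_generators_subset: "conjugate_generators \<subseteq> level"
  unfolding conjugate_generators_def level_def
  by (auto intro!: elementary_conjugate_mem simp: K_products entries_short Omega_neq_uminus)

lemma conjugate_generators_carrier: "conjugate_generators \<subseteq> carrier G"
  using conjugate_generators_subset subgroup.subset[OF subgroup_level] by blast

text \<open>An elementary conjugate is additive in its first parameter, so that products \<open>a b\<close> and \<open>b a\<close> suffice.\<close>

lemma generate_conjugate_generators: "generate G conjugate_generators = level"
proof
  show "generate G conjugate_generators \<subseteq> level"
    by (rule generate_subgroup_incl[OF conjugate_generators_subset subgroup_level])
  note sg = generate_is_subgroup[OF conjugate_generators_carrier]
  show "level \<subseteq> generate G conjugate_generators"
    unfolding level_def conjugate_group_def
  proof (rule generate_subgroup_incl[OF _ sg], rule subsetI)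
    fix z assume "z \<in> {elementary_conjugate i j a c | i j a c.
        root i j \<and> a \<in> ent K Theta i j \<and> c \<in> ent UNIV Lam j i}"
    then obtain i j x c where z: "z = elementary_conjugate i j x c" and ij: "root i j"
      and x: "x \<in> ent K Theta i j" and c: "c \<in> ent UNIV Lam j i" by blast
    show "z \<in> generate G conjugate_generators"
    proof (cases "j = - i")
      case True
      then show ?thesis
        unfolding z conjugate_generators_def using ij x c by (intro generate.incl) blast
    next
      case False
      have ji: "root j i" using ij by auto
      let ?M = "{g \<in> carrier G. cj (t j i c) g \<in> generate G conjugate_generators}"
      have M: "subgroup ?M G"
        by (rule subgroup_conjugate_vimage[OF sg t_closed[OF form_absolute ji c]])
      have "add_subgroup {x \<in> UNIV. t i j x \<in> ?M}"
        using ij False by (intro add_subgroup_parameters[OF M])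
          (auto simp: entries_short add_subgroup_def)
      then have "K \<subseteq> {x \<in> UNIV. t i j x \<in> ?M}"
      proof (rule K_subset)
        fix a b assume ab: "a \<in> I" "b \<in> J"
        have "i \<noteq> - j" using False by auto
        then have "elementary_conjugate i j (a * b) c \<in> conjugate_generators"
          "elementary_conjugate i j (b * a) c \<in> conjugate_generators"
          unfolding conjugate_generators_def using ij ab by blast+
        moreover have "t i j x \<in> carrier G" for x
          using ij False by (intro t_closed[OF form_absolute]) (simp_all add: entries_short)
        ultimately show "a * b \<in> {x \<in> UNIV. t i j x \<in> ?M}" "b * a \<in> {x \<in> UNIV. t i j x \<in> ?M}"
          by (auto simp: elementary_conjugate_def intro: generate.incl)
      qed
      then show ?thesis
        using x False unfolding z by (auto simp: entries_short elementary_conjugate_def)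
    qed
  qed
qed

lemma commutators_at_carrier: "root i j \<Longrightarrow> commutators_at i j \<subseteq> carrier G"
  unfolding commutators_at_def using elementary_commutator_carrier by blast

lemma commutators_at_mutual: "root i j \<Longrightarrow> commutators_at i j \<subseteq> mutual"
  unfolding commutators_at_def elementary_commutator_def using mutual_root_elements(1) by auto

lemma commutators_at_flip:
  assumes "root i j"
  shows "commutators_at (- j) (- i) \<subseteq> commutators_at i j"
proof
  fix z assume "z \<in> commutators_at (- j) (- i)"
  then obtain a b where z: "z = elementary_commutator (- j) (- i) a b"
    and a: "a \<in> ent I Gam (- j) (- i)" and b: "b \<in> ent J Del (- i) (- j)"
    unfolding commutators_at_def by blast
  obtain a' where "a' \<in> ent I Gam i j" "t (- j) (- i) a = t i j a'"
    using opposite_rootsE[of j i "- j" "- i", OF _ IG _ a] assms by (auto simp: opposite_roots_def)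
  moreover obtain b' where "b' \<in> ent J Del j i" "t (- i) (- j) b = t j i b'"
    using opposite_rootsE[of i j "- i" "- j", OF _ JD _ b] assms by (auto simp: opposite_roots_def)
  ultimately show "z \<in> commutators_at i j"
    unfolding z commutators_at_def elementary_commutator_def by auto
qed

context
  fixes H :: "'b set"
  assumes H: "subgroup H G" and level_H: "level \<subseteq> H"
begin

lemma commutators_at_change_second:
  assumes "root i k" "i \<noteq> - k" "root i j" "i \<noteq> - j" "j \<noteq> k" "j \<noteq> - k" "commutators_at i k \<subseteq> H"
  shows "commutators_at i j \<subseteq> H"
proof
  fix z assume "z \<in> commutators_at i j"
  then obtain a b where z: "z = elementary_commutator i j a b" and ab: "a \<in> I" "b \<in> J"
    unfolding commutators_at_def using assms by (auto simp: entries_short)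
  have mab: "- a \<in> I" "- b \<in> J"
    using ab IG JD by (auto intro: add_subgroup_minus two_sided_ideal_add_subgroup form_ideal_ideal)
  then have "elementary_commutator i k (- a) (- b) \<in> H"
    using assms unfolding commutators_at_def by (auto simp: entries_short)
  moreover have "congruent_mod level z (elementary_commutator i k (- a) (- b))"
    using elementary_commutator_change_short[of i k j "- a" "- b"] assms mab unfolding z by auto
  ultimately show "z \<in> H" using congruent_mod_mem[OF H level_H] by blast
qed

text \<open>The second index can be changed to any other, if necessary through a third index, as the congruences relate
only indices different up to sign. The flip \<open>(p, q) \<mapsto> (-q, -p)\<close> turns this into a change of the first index.\<close>

lemma commutators_at_short_pairs:
  assumes hk: "root h k" "h \<noteq> - k" "commutators_at h k \<subseteq> H" and ij: "root i j" "i \<noteq> - j"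
  shows "commutators_at i j \<subseteq> H"
proof -
  define S where "S p q \<longleftrightarrow> root p q \<and> p \<noteq> - q \<and> commutators_at p q \<subseteq> H" for p q
  have second: "S p r" if S: "S p q" and r: "root p r" "p \<noteq> - r" for p q r
  proof -
    have distinct: "S p r" if "S p q" "root p r" "p \<noteq> - r" "r \<noteq> q" "r \<noteq> - q" for p q r
      using that commutators_at_change_second[of p q r] unfolding S_def by blast
    obtain m where m: "m \<in> Omega n" "m \<noteq> p" "m \<noteq> - p" "m \<noteq> q" "m \<noteq> - q" by (rule third_index)
    show ?thesis
    proof (cases "r = q \<or> r = - q")
      case True
      have "S p m" using distinct[OF S, of m] m S by (auto simp: S_def)
      then show ?thesis using distinct[of p m r] r m True by auto
    qed (use distinct S r in blast)
  qed
  have flip: "S (- q) (- p)" if "S p q" for p q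
    using that commutators_at_flip[of p q] by (auto simp: S_def)
  have first: "S r q" if "S p q" "root r q" "r \<noteq> - q" for p q r
  proof -
    have "S (- q) (- r)" using second[OF flip[OF that(1)], of "- r"] that by auto
    then show ?thesis using flip by fastforce
  qed
  have S: "S h k" using hk by (simp add: S_def)
  obtain m where m: "m \<in> Omega n" "m \<noteq> h" "m \<noteq> - h" "m \<noteq> i" "m \<noteq> - i" by (rule third_index)
  have "S h m" using second[OF S, of m] m hk by auto
  then have "S i m" using first[of h m i] m ij by auto
  then have "S i j" using second ij by blast
  then show ?thesis by (simp add: S_def)
qed

lemma commutators_at_long_pairs:
  assumes h: "h \<in> Omega n" "commutators_at h (- h) \<subseteq> H" and i: "i \<in> Omega n"
  shows "commutators_at i (- i) \<subseteq> H"
proof -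
  have change: "commutators_at k (- k) \<subseteq> H"
    if "i \<in> Omega n" "k \<in> Omega n" "k \<noteq> i" "k \<noteq> - i" "commutators_at i (- i) \<subseteq> H" for i k
  proof
    fix z assume "z \<in> commutators_at k (- k)"
    then obtain a b where z: "z = elementary_commutator k (- k) a b"
      and ab: "a \<in> ent I Gam k (- k)" "b \<in> ent J Del (- k) k"
      unfolding commutators_at_def by blast
    have ik: "i \<noteq> k" "i \<noteq> - k" using that by auto
    note ch = elementary_commutator_change_long[OF that(2,1) ik ab]
    have "elementary_commutator i (- i) (a * sc i k) (sc k i * b) \<in> H"
      using that(5) ch(2,3) unfolding commutators_at_def by blast
    then show "z \<in> H"
      unfolding z using congruent_mod_mem[OF H level_H congruent_mod_sym[OF subgroup_level ch(1)]] by blast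
  qed
  obtain m where m: "m \<in> Omega n" "m \<noteq> h" "m \<noteq> - h" "m \<noteq> i" "m \<noteq> - i" by (rule third_index)
  have "commutators_at m (- m) \<subseteq> H" using change[of h m] h m by blast
  then show ?thesis using change[of m i] m i by auto
qed

end

text \<open>Modulo \<open>H\<close>, root elements of the two levels commute: for opposite roots by assumption, otherwise because \<open>H\<close>
contains the level. To pass to \<open>[T\<^sub>\<alpha>(a), y T\<^sub>\<beta>(b) y\<^bsup>-1\<^esup>]\<close> with \<open>y = T\<^sub>-\<^sub>\<beta>(c)\<close>, move \<open>y\<close> to the
first entry: if \<open>\<alpha> \<noteq> \<beta>\<close>, the conjugate \<open>y\<^bsup>-1\<^esup> T\<^sub>\<alpha>(a) y\<close> is again a product of relative root elements. If
\<open>\<alpha> = \<beta>\<close>, decompose \<open>T\<^sub>\<beta>(b) = u' v u v\<^bsup>-1\<^esup>\<close> instead: conjugation by \<open>y\<close> preserves the shape, and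
then \<open>v\<close> rather than \<open>y\<close> is moved to the first entry.\<close>

lemma mutual_subset:
  assumes N: "H \<lhd> G" and level_H: "level \<subseteq> H"
    and all: "\<And>i j. root i j \<Longrightarrow> commutators_at i j \<subseteq> H"
  shows "mutual \<subseteq> H"
proof -
  note sg = normal_imp_subgroup[OF N]
  have gens: "cm (t i j a) (t k l b) \<in> H"
    if ij: "root i j" and kl: "root k l" and a: "a \<in> ent I Gam i j" and b: "b \<in> ent J Del k l"
    for i j k l a b
  proof (cases "opposite_roots i j k l")
    case True
    obtain b' where "b' \<in> ent J Del j i" "t k l b = t j i b'"
      by (rule opposite_rootsE[OF True JD ij b])
    then show ?thesis
      using all[OF ij] a unfolding commutators_at_def elementary_commutator_def by auto
  next
    case False
    show ?thesis
      using commutator_in_elementary[OF IG JD ij kl False a b]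
        elementary_subset_conjugate_group[OF form_ideal_Theta] level_H
      unfolding level_def by blast
  qed
  have el: "cm x y \<in> H" if "x \<in> elementary I Gam" "y \<in> elementary J Del" for x y
  proof (rule generate_commuting_mod[OF N root_elements_carrier[OF IG] root_elements_carrier[OF JD]])
    show "x \<in> generate G (root_elements I Gam (\<lambda>_ _. True))"
      "y \<in> generate G (root_elements J Del (\<lambda>_ _. True))"
      using that by (simp_all add: elementary_def)
    show "cm x y \<in> H" if "x \<in> root_elements I Gam (\<lambda>_ _. True)"
      "y \<in> root_elements J Del (\<lambda>_ _. True)" for x y
      using that gens unfolding root_elements_def by blast
  qed
  have conj: "cm (t i j a) (elementary_conjugate k l b c) \<in> H"
    if ij: "root i j" "a \<in> ent I Gam i j"
      and kl: "root k l" "b \<in> ent J Del k l" "c \<in> ent UNIV Lam l k" for i j a k l b c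
  proof -
    have lk: "root l k" using kl by auto
    have mc: "- c \<in> ent UNIV Lam l k" by (rule ent_uminus[OF form_absolute lk kl(3)])
    have car: "t i j a \<in> carrier G" "t k l b \<in> carrier G" "t l k c \<in> carrier G"
      by (rule t_closed[OF IG ij] t_closed[OF JD kl(1,2)] t_closed[OF form_absolute lk kl(3)])+
    show ?thesis
    proof (cases "opposite_roots l k i j")
      case False
      have "cm (t l k (- c)) (t i j a) \<in> elementary I Gam"
        by (rule absolute_commutator_in_elementary[OF IG lk ij(1) False mc ij(2)])
      then have "cj (inv (t l k c)) (t i j a) \<in> elementary I Gam"
        using conjugate_eq_commutator[of "inv (t l k c)" "t i j a"] car t_in_elementary[OF ij]
          subgroup.m_closed[OF subgroup_elementary[OF IG]]
        by (simp add: t_uminus[OF form_absolute lk kl(3)])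
      then have "cm (cj (inv (t l k c)) (t i j a)) (t k l b) \<in> H"
        using t_in_elementary[OF kl(1,2)] by (rule el)
      then show ?thesis
        unfolding elementary_conjugate_def commutator_conjugate_right[OF car]
        by (rule normal_conjugate[OF N car(3)])
    next
      case True
      obtain a' where a': "a' \<in> ent I Gam k l" "t i j a = t k l a'"
        by (rule opposite_rootsE[OF True IG lk ij(2)])
      have car': "t k l a' \<in> carrier G" by (rule t_closed[OF IG kl(1) a'(1)])
      obtain f u u' v where f: "odd_fun f" "f k = f l" and v: "v \<in> unipotent f UNIV Lam"
        and u: "u \<in> unipotent (\<lambda>m. - f m) J Del" "u' \<in> unipotent (\<lambda>m. - f m) J Del"
        and eq: "t k l b = u' \<otimes> cj v u"
        by (rule root_element_decomposition[OF JD kl(1,2)])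
      let ?y = "t l k c"
      have y: "?y \<in> parabolic f" "?y \<in> parabolic (\<lambda>m. - f m)"
        using lk kl f by (auto intro!: t_in_parabolic)
      define w where "w = cj ?y v"
      have w: "w \<in> unipotent f UNIV Lam"
        unfolding w_def by (rule parabolic_normalizes_unipotent[OF form_absolute f(1) y(1) v])
      have yu: "cj ?y u \<in> unipotent (\<lambda>m. - f m) J Del" "cj ?y u' \<in> unipotent (\<lambda>m. - f m) J Del"
        by (rule parabolic_normalizes_unipotent[OF JD odd_fun_uminus[OF f(1)] y(2)] u)+
      then have yue: "cj ?y u \<in> elementary J Del" "cj ?y u' \<in> elementary J Del"
        using unipotent_subset_elementary by blast+
      have uvc: "u \<in> carrier G" "u' \<in> carrier G" "v \<in> carrier G" "w \<in> carrier G"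
        using u v w unipotent_carrier JD form_absolute by blast+
      note sgu = subgroup_unipotent[OF form_absolute, of f]
      have "cm (inv w) (t k l a') \<in> unipotent f I Gam"
        by (rule unipotent_commutator_level[OF IG f kl(1) a'(1) subgroup.m_inv_closed[OF sgu w]])
      then have "cm (inv w) (t k l a') \<in> elementary I Gam"
        using unipotent_subset_elementary by blast
      then have "cj (inv w) (t k l a') \<in> elementary I Gam"
        using conjugate_eq_commutator[of "inv w" "t k l a'"] uvc car' t_in_elementary[OF kl(1) a'(1)]
          subgroup.m_closed[OF subgroup_elementary[OF IG]] by simp
      then have "cm (cj (inv w) (t k l a')) (cj ?y u) \<in> H"
        using yue(1) by (rule el)
      then have 1: "cm (t k l a') (cj w (cj ?y u)) \<in> H"
        using uvc car car' by (simp add: commutator_conjugate_right normal_conjugate[OF N])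
      have 2: "cm (t k l a') (cj ?y u') \<in> H"
        by (rule el[OF t_in_elementary[OF kl(1) a'(1)] yue(2)])
      have "elementary_conjugate k l b c = cj ?y u' \<otimes> cj w (cj ?y u)"
        unfolding elementary_conjugate_def eq w_def
          conjugate_conjugate_commute[OF car(3) uvc(3,1), symmetric]
        using uvc car by (simp add: conjugate_mult)
      then have "cm (t i j a) (elementary_conjugate k l b c) =
          cm (t k l a') (cj ?y u') \<otimes> cj (cj ?y u') (cm (t k l a') (cj w (cj ?y u)))"
        unfolding a'(2) using uvc car car' by (simp add: commutator_mult_right)
      then show ?thesis
        using 1 2 uvc car by (simp add: subgroup.m_closed[OF sg] normal_conjugate[OF N])
    qed
  qed
  have IJ: "conjugate_group I Gam \<subseteq> carrier G" "conjugate_group J Del \<subseteq> carrier G"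
    by (intro normal_subset normal_conjugate_group IG JD)+
  have left: "cm (t i j a) y \<in> H"
    if "root i j" "a \<in> ent I Gam i j" "y \<in> conjugate_group J Del" for i j a y
  proof (rule generate_commuting_mod[OF N _ conjugate_group_generators_carrier[OF JD]])
    show "{t i j a} \<subseteq> carrier G" using t_closed[OF IG that(1,2)] by simp
    show "t i j a \<in> generate G {t i j a}" by (rule generate.incl) simp
    show "y \<in> generate G {elementary_conjugate i j a c |i j a c.
        root i j \<and> a \<in> ent J Del i j \<and> c \<in> ent UNIV Lam j i}"
      using that(3) by (simp add: conjugate_group_def)
  qed (use conj[OF that(1,2)] in blast)
  have "conjugate_group I Gam \<subseteq> {x \<in> carrier G. \<forall>y \<in> conjugate_group J Del. cm x y \<in> H}"
  proof (rule conjugate_group_least[OF IG])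
    show "t p q a \<in> {x \<in> carrier G. \<forall>y \<in> conjugate_group J Del. cm x y \<in> H}"
      if "root p q" "a \<in> ent I Gam p q" for p q a
      using left[OF that] t_closed[OF IG that] by blast
    show "{x \<in> carrier G. \<forall>y \<in> conjugate_group J Del. cm x y \<in> H} \<lhd> G"
      by (rule normal_commuting_mod[OF N normal_conjugate_group[OF JD]])
  qed
  then show ?thesis
    unfolding mutual_def by (intro commutator_subgroup_subset[OF sg]) blast
qed

theorem mutual_generated:
  assumes hk: "root h k" "h \<noteq> - k"
  shows "mutual = generate G (conjugate_generators \<union> commutators_at h k \<union> commutators_at h (- h))"
    (is "_ = generate G ?A")
proof
  have hh: "root h (- h)" using hk by (auto simp: Omega_neq_uminus)
  have A: "?A \<subseteq> mutual"
    using conjugate_generators_subset level_subset_mutual commutators_at_mutual[OF hk(1)]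
      commutators_at_mutual[OF hh] by blast
  then show "generate G ?A \<subseteq> mutual" by (rule generate_subgroup_incl[OF _ subgroup_mutual])
  have Ac: "?A \<subseteq> carrier G" using A subgroup.subset[OF subgroup_mutual] by blast
  note H = generate_is_subgroup[OF Ac]
  have level_H: "level \<subseteq> generate G ?A"
    unfolding generate_conjugate_generators[symmetric] by (rule mono_generate) blast
  have AH: "?A \<subseteq> generate G ?A" by (auto intro: generate.incl)
  show "mutual \<subseteq> generate G ?A"
  proof (rule mutual_subset[OF _ level_H])
    show "generate G ?A \<lhd> G"
    proof (rule normal_generate_if_t_invariant[OF Ac])
      fix k' l d x assume kl: "root k' l" "d \<in> ent UNIV Lam k' l" and x: "x \<in> ?A"
      have central: "cj (t k' l d) x \<in> generate G ?A"
        if "x \<in> commutators_at i j" "root i j" for i j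
      proof -
        have "congruent_mod level (cj (t k' l d) x) x"
          using that elementary_commutator_central[OF that(2) _ _ kl] unfolding commutators_at_def by blast
        then show ?thesis using congruent_mod_mem[OF H level_H] AH x by blast
      qed
      show "cj (t k' l d) x \<in> generate G ?A"
      proof (cases "x \<in> conjugate_generators")
        case True
        then show ?thesis
          using conjugate_generators_subset normal_conjugate[OF normal_level t_closed[OF form_absolute kl]]
            level_H by blast
      qed (use x central hk hh in blast)
    qed
    fix i j assume ij: "root i j"
    show "commutators_at i j \<subseteq> generate G ?A"
    proof (cases "j = - i")
      case True
      then show ?thesis
        using commutators_at_long_pairs[OF H level_H] hk ij AH by auto
    next
      case False
      then show ?thesis
        using commutators_at_short_pairs[OF H level_H hk] ij AH by auto
    qed
  qed
qed

end


section \<open>The elementary unitary group\<close>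

lemma (in form_ring_setting) EU_abs_subgroup: "subgroup (EU_abs bar lam n Lam) (GL n)"
  unfolding EU_abs_def by (intro group.generate_is_subgroup group_GL) (auto intro: T_GL)

text \<open>The relations hold in the general linear group; restricting the carrier to the elementary unitary group makes its
normal subgroups the normal subgroups of the ambient group.\<close>

lemma (in form_ring_setting) elementary_relations_EU_abs:
  assumes "n \<ge> 3"
  shows "elementary_relations (GL n\<lparr>carrier := EU_abs bar lam n Lam\<rparr>) bar lam Lam n (T bar lam n)"
proof -
  let ?E = "EU_abs bar lam n Lam"
  let ?S = "{T bar lam n i j c | i j c. i \<in> Omega n \<and> j \<in> Omega n \<and> i \<noteq> j \<and> c \<in> entries bar lam UNIV Lam i j}"
  interpret GL: group "GL n :: 'a sq_mat monoid" by (rule group_GL)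
  interpret E: group "GL n\<lparr>carrier := ?E\<rparr>"
    by (rule GL.subgroup_imp_group[OF EU_abs_subgroup])
  have S: "?S \<subseteq> ?E" unfolding EU_abs_def by (rule subsetI) (rule generate.incl)
  show ?thesis
  proof unfold_locales
    show "carrier (GL n\<lparr>carrier := ?E\<rparr>) = generate (GL n\<lparr>carrier := ?E\<rparr>) ?S"
      unfolding GL.generate_consistent[OF S EU_abs_subgroup] by (simp add: EU_abs_def)
    show "T bar lam n i j c \<in> carrier (GL n\<lparr>carrier := ?E\<rparr>)"
      if "i \<in> Omega n" "j \<in> Omega n" "i \<noteq> j" "c \<in> entries bar lam UNIV Lam i j" for i j c
      using S that by auto
    show "T bar lam n i j c = T bar lam n (- j) (- i) (- (sc i j * bar c))"
      if "i \<in> Omega n" "j \<in> Omega n" "j \<noteq> - i" for i j c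
      by (rule T_flip_mat[OF that])
  qed (use assms in \<open>simp_all add: mult_GL T_add_mat T_commute_mat T_commutator_short_mat
        T_commutator_long_mat T_commutator_mixed_mat weyl_short[unfolded weyl_def]
        weyl_long[unfolded weyl_def]\<close>)
qed

theorem theorem1:
  fixes bar :: "'a::{ring,monoid_mult} \<Rightarrow> 'a" and lam :: 'a
    and Lam I Gam J Del :: "'a set" and n :: nat
  assumes "form_ring bar lam Lam"
    and "form_ideal bar lam Lam I Gam"
    and "form_ideal bar lam Lam J Del"
    and "n \<ge> 3"
  shows
    "commutator_subgroup (GL n) (EU bar lam n Lam I Gam) (EU bar lam n Lam J Del) =
       generate (GL n)
         (Z_generators bar lam n Lam I Gam J Del \<union> Y_generators bar lam n I Gam J Del) \<and>
     (\<forall>h\<in>Omega n. \<forall>k\<in>Omega n. h \<noteq> k \<and> h \<noteq> - k \<longrightarrow>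
        commutator_subgroup (GL n) (EU bar lam n Lam I Gam) (EU bar lam n Lam J Del) =
          generate (GL n)
            (Z_generators bar lam n Lam I Gam J Del \<union>
             Y_generators_at bar lam n I Gam J Del h k \<union>
             Y_generators_at bar lam n I Gam J Del h (- h)))"
proof -
  interpret form_ring_setting bar lam Lam by unfold_locales (rule assms(1))
  let ?E = "EU_abs bar lam n Lam"
  let ?G = "GL n\<lparr>carrier := ?E\<rparr>"
  interpret GL: group "GL n :: 'a sq_mat monoid" by (rule group_GL)
  interpret elementary_relations ?G bar lam Lam n "T bar lam n"
    by (rule elementary_relations_EU_abs[OF assms(4)])
  interpret relative_commutator ?G bar lam Lam n "T bar lam n" I Gam J Del
    by unfold_locales (rule assms(2,3))+
  note E = EU_abs_subgroup[of n]
  have gen: "generate (GL n) A = generate ?G A" if "A \<subseteq> ?E" for A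
    by (rule GL.generate_consistent[OF that E, symmetric])
  have comm: "group_commutator (GL n) x y = group_commutator ?G x y" if "x \<in> ?E" "y \<in> ?E" for x y
    using that by (simp add: group_commutator_def GL.m_inv_consistent[OF E])
  have T_E: "T bar lam n i j a \<in> ?E" if "form_ideal bar lam Lam I' Gam'" "root i j" "a \<in> ent I' Gam' i j"
    for I' Gam' i j a
    using t_closed[OF that] by simp
  have EU: "EU bar lam n Lam I' Gam' = conjugate_group I' Gam'" if form': "form_ideal bar lam Lam I' Gam'"
    for I' Gam'
  proof -
    let ?T = "{T bar lam n i j a | i j a. i \<in> Omega n \<and> j \<in> Omega n \<and> i \<noteq> j \<and> a \<in> ent I' Gam' i j}"
    have roots: "root_elements I' Gam' (\<lambda>_ _. True) = ?T"
      unfolding root_elements_def by (intro Collect_cong ex_cong1) simp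
    then have "?T \<subseteq> ?E"
      using root_elements_carrier[OF form', of "\<lambda>_ _. True"] by simp
    then have FU: "FU bar lam n I' Gam' = elementary I' Gam'"
      unfolding FU_def elementary_def roots by (rule gen)
    show ?thesis
      unfolding EU_def normal_closure_def FU
    proof (rule antisym)
      show "\<Inter> {N. N \<lhd> ?G \<and> elementary I' Gam' \<subseteq> N} \<subseteq> conjugate_group I' Gam'"
        using normal_conjugate_group[OF form'] elementary_subset_conjugate_group[OF form']
        by (intro Inter_lower) simp
      show "conjugate_group I' Gam' \<subseteq> \<Inter> {N. N \<lhd> ?G \<and> elementary I' Gam' \<subseteq> N}"
      proof (rule Inter_greatest)
        fix N assume N: "N \<in> {N. N \<lhd> ?G \<and> elementary I' Gam' \<subseteq> N}"
        show "conjugate_group I' Gam' \<subseteq> N"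
          by (rule conjugate_group_least[OF form']) (use N t_in_elementary in auto)
      qed
    qed
  qed
  have sub: "conjugate_group I' Gam' \<subseteq> ?E" if "form_ideal bar lam Lam I' Gam'" for I' Gam'
    using normal_subset[OF normal_conjugate_group[OF that]] by simp
  have commutators: "{group_commutator (GL n) x y |x y. x \<in> conjugate_group I Gam \<and> y \<in> conjugate_group J Del}
      = {group_commutator ?G x y |x y. x \<in> conjugate_group I Gam \<and> y \<in> conjugate_group J Del}"
  proof -
    have "group_commutator (GL n) x y = group_commutator ?G x y"
      if "x \<in> conjugate_group I Gam" "y \<in> conjugate_group J Del" for x y
      by (rule comm[OF subsetD[OF sub[OF assms(2)] that(1)] subsetD[OF sub[OF assms(3)] that(2)]])
    then show ?thesis by (intro Collect_cong ex_cong1) auto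
  qed
  have mutual: "commutator_subgroup (GL n) (EU bar lam n Lam I Gam) (EU bar lam n Lam J Del) = mutual"
  proof -
    have "{group_commutator ?G x y |x y. x \<in> conjugate_group I Gam \<and> y \<in> conjugate_group J Del} \<subseteq> mutual"
      using mutual_mem(1) by blast
    then have "{group_commutator ?G x y |x y. x \<in> conjugate_group I Gam \<and> y \<in> conjugate_group J Del} \<subseteq> ?E"
      using subgroup.subset[OF subgroup_mutual] by simp
    from gen[OF this] show ?thesis
      unfolding EU[OF assms(2)] EU[OF assms(3)] mutual_def commutator_subgroup_def commutators .
  qed
  have Z: "Z bar lam n i j a c = elementary_conjugate i j a c"
    if "root i j" "c \<in> ent UNIV Lam j i" for i j a c
  proof -
    have ji: "root j i" using that by auto
    have "T bar lam n j i (- c) = inv\<^bsub>?G\<^esub> T bar lam n j i c"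
      by (rule t_uminus[OF form_absolute ji that(2)])
    then show ?thesis
      by (simp add: Z_def elementary_conjugate_def conjugate_def)
  qed
  have Zg: "Z_generators bar lam n Lam I Gam J Del = conjugate_generators"
  proof -
    have long: "lpow bar lam ((sgn i - 1) div 2) *o Lam = ent UNIV Lam (- i) i" if "i \<in> Omega n" for i
      using Omega_nonzero[OF that] lpow_exponent_entries[of "- i"]
      by (simp add: entries_def lpow_exponent_opposite_entries)
    have long': "lpow bar lam (- ((sgn i + 1) div 2)) *o Theta = ent K Theta i (- i)" for i
      by (simp add: entries_def)
    have short: "Z bar lam n i j x c = elementary_conjugate i j x c"
      if "i \<in> Omega n" "j \<in> Omega n" "i \<noteq> j" "i \<noteq> - j" for i j x c
      using that by (intro Z) (auto simp: entries_short)
    have eq: "Z bar lam n i (- i) x c = elementary_conjugate i (- i) x c"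
      if "i \<in> Omega n" "c \<in> ent UNIV Lam (- i) i" for i x c
      using that by (intro Z) (auto simp: Omega_neq_uminus)
    show ?thesis
      unfolding Z_generators_def conjugate_generators_def
      by (intro arg_cong2[of _ _ _ _ "(\<union>)"] Collect_cong ex_cong1)
        (use short long long' eq in auto)
  qed
  have Yg: "Y_generators_at bar lam n I Gam J Del i j = commutators_at i j" if ij: "root i j" for i j
  proof -
    have ji: "root j i" using ij by auto
    have "Y bar lam n i j a b = elementary_commutator i j a b"
      if "a \<in> ent I Gam i j" "b \<in> ent J Del j i" for a b
      unfolding Y_def elementary_commutator_def
      by (rule comm[OF T_E[OF assms(2) ij that(1)] T_E[OF assms(3) ji that(2)]])
    then show ?thesis
      unfolding Y_generators_at_def commutators_at_def by (intro Collect_cong ex_cong1) auto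
  qed
  have mutual_E: "mutual \<subseteq> ?E" using subgroup.subset[OF subgroup_mutual] by simp
  have at: "mutual = generate (GL n) (Z_generators bar lam n Lam I Gam J Del \<union>
      Y_generators_at bar lam n I Gam J Del h k \<union> Y_generators_at bar lam n I Gam J Del h (- h))"
    if "h \<in> Omega n" "k \<in> Omega n" "h \<noteq> k" "h \<noteq> - k" for h k
  proof -
    have r: "root h k" "root h (- h)" using that by (auto simp: Omega_neq_uminus)
    have "conjugate_generators \<union> commutators_at h k \<union> commutators_at h (- h) \<subseteq> ?E"
      using conjugate_generators_carrier commutators_at_carrier[OF r(1)] commutators_at_carrier[OF r(2)]
      by simp
    then show ?thesis
      unfolding Zg Yg[OF r(1)] Yg[OF r(2)] using mutual_generated[OF r(1) that(4)] by (simp add: gen)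
  qed
  have "mutual = generate (GL n)
      (Z_generators bar lam n Lam I Gam J Del \<union> Y_generators bar lam n I Gam J Del)" (is "_ = generate _ ?A")
  proof
    have at_subset: "Y_generators_at bar lam n I Gam J Del i j \<subseteq> Y_generators bar lam n I Gam J Del"
      if "root i j" for i j
      unfolding Y_generators_def using that by (intro Union_upper) blast
    have "1 \<in> Omega n" "2 \<in> Omega n" using assms(4) by (auto simp: Omega_def)
    then have "mutual = generate (GL n) (Z_generators bar lam n Lam I Gam J Del \<union>
      Y_generators_at bar lam n I Gam J Del 1 2 \<union> Y_generators_at bar lam n I Gam J Del 1 (- 1))"
      by (intro at) auto
    also have "\<dots> \<subseteq> generate (GL n) ?A"
      using at_subset[of 1 2] at_subset[of 1 "- 1"] \<open>1 \<in> Omega n\<close> \<open>2 \<in> Omega n\<close>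
      by (intro GL.mono_generate) auto
    finally show "mutual \<subseteq> generate (GL n) ?A" .
    have "Y_generators bar lam n I Gam J Del \<subseteq> mutual"
      unfolding Y_generators_def using Yg commutators_at_mutual by blast
    then have A: "?A \<subseteq> mutual"
      using conjugate_generators_subset level_subset_mutual unfolding Zg by blast
    show "generate (GL n) ?A \<subseteq> mutual"
      unfolding gen[OF subset_trans[OF A mutual_E]]
      by (rule generate_subgroup_incl[OF A subgroup_mutual])
  qed
  then show ?thesis unfolding mutual using at by blast
qed

end
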